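(* Let $f:\mathbb{Z}_{\geq 2}\to\mathbb{R}$ be a function satisfying $2\leq f(q)$ for all $q\ge 2$ and $f(q)=O(\log q)$ as $q\to+\infty$. For an integer $q\geq 2$ define \[ \mathcal{Q}(q,f) := \left\{ s=\sigma+it\in\mathbb{C} ~\bigg|~ \sigma > 1-\frac{1}{f(q)},\ |t| < 1-\frac{1}{\sqrt{f(q)\log(q)}} \right\}. \] Suppose that, for every integer $q\geq 2$, the region $\mathcal{Q}(q,f)$ is quasi zero-free for primitive Dirichlet characters modulo $q$. Then \[ \left|\Re\left(\frac{L'(1,\chi)}{L(1,\chi)}\right)\right| = O\!\left(\sqrt{f(q)\log(q)}\right) \qquad (q\to+\infty) \] uniformly for complex (i.e. non-real) primitive Dirichlet characters $\chi \pmod q$. Moreover, for the real primitive characters $\chi_D \pmod{|D|}$, with $D$ ranging over fundamental discriminants, \[ \left|\frac{L'(1,\chi_D)}{L(1,\chi_D)} - \frac{1}{1-\beta_D}\right| = O\!\left(\sqrt{f(|D|)\log(|D|)}\right) \qquad (|D|\to+\infty), \] where $\beta_D := \max\{\beta\in\mathbb{R} \mid L(\beta,\chi_D)=0\}$.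
   Context: For a Dirichlet character $\chi$, $L(s,\chi)=\sum_{n\ge1}\chi(n)n^{-s}$ denotes its Dirichlet $L$-function (analytically continued). A region $\mathcal{Q}(q)$ contained in the critical strip $\{0<\Re(s)<1\}$ is called quasi zero-free for primitive Dirichlet characters modulo $q$ if, for every primitive character $\chi \pmod q$: when $\chi$ is complex (not real-valued), $L(s,\chi)$ has no zeros in $\mathcal{Q}(q)$; when $\chi$ is real, $L(s,\chi)$ has at most one zero in $\mathcal{Q}(q)$, and such a zero is a real simple zero $\beta>\tfrac12$. An integer $D\neq0$ is a fundamental discriminant if it is the discriminant of a quadratic number field; $\chi_D(k)=(D\,|\,k)$ is the Kronecker symbol, which is a real primitive Dirichlet character modulo $|D|$, and these are all real primitive characters. *)

theory Defs
  imports
    "HOL-Complex_Analysis.Complex_Analysis"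
    "HOL-Number_Theory.Number_Theory"
    "HOL-Library.Landau_Symbols"
begin

section \<open>Dirichlet characters and their L-functions\<close>

definition dirichlet_char :: "nat \<Rightarrow> (int \<Rightarrow> complex) \<Rightarrow> bool" where
  "dirichlet_char q \<psi> \<longleftrightarrow>
     q > 0 \<and> \<psi> 1 = 1 \<and>
     (\<forall>m n. \<psi> (m * n) = \<psi> m * \<psi> n) \<and>
     (\<forall>n. \<psi> (n + int q) = \<psi> n) \<and>
     (\<forall>n. \<psi> n = 0 \<longleftrightarrow> \<not> coprime n (int q))"

text \<open>A divisor \<open>d\<close> of \<open>q\<close> is an induced modulus of \<open>\<psi>\<close> if \<open>\<psi>\<close> is trivial on the units modulo \<open>q\<close>
  that are congruent to 1 modulo \<open>d\<close>, i.e. if \<open>\<psi>\<close> factors through the units modulo \<open>d\<close>.\<close>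

definition induced_modulus :: "nat \<Rightarrow> (int \<Rightarrow> complex) \<Rightarrow> nat \<Rightarrow> bool" where
  "induced_modulus q \<psi> d \<longleftrightarrow>
     d dvd q \<and> (\<forall>n. coprime n (int q) \<and> [n = 1] (mod int d) \<longrightarrow> \<psi> n = 1)"

definition primitive_char :: "nat \<Rightarrow> (int \<Rightarrow> complex) \<Rightarrow> bool" where
  "primitive_char q \<psi> \<longleftrightarrow>
     dirichlet_char q \<psi> \<and> (\<forall>d. induced_modulus q \<psi> d \<longrightarrow> d = q)"

definition real_char :: "(int \<Rightarrow> complex) \<Rightarrow> bool" where
  "real_char \<psi> \<longleftrightarrow> range \<psi> \<subseteq> \<real>"

text \<open>The L-function is the meromorphic continuation to the whole plane of the Dirichlet series.
  Niceness (continuity away from poles, and the value 0 at poles) makes it unique as a total function;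
  for a non-principal character it is entire.\<close>

definition Dirichlet_L :: "(int \<Rightarrow> complex) \<Rightarrow> complex \<Rightarrow> complex" where
  "Dirichlet_L \<psi> = (THE L. L nicely_meromorphic_on UNIV \<and>
     (\<forall>s. Re s > 1 \<longrightarrow> L s = (\<Sum>n. \<psi> (int (Suc n)) * of_nat (Suc n) powr (- s))))"


section \<open>Quasi zero-free regions\<close>

definition critical_strip :: "complex set" where
  "critical_strip = {s. 0 < Re s \<and> Re s < 1}"

definition quasi_zero_free :: "nat \<Rightarrow> complex set \<Rightarrow> bool" where
  "quasi_zero_free q R \<longleftrightarrow>
     R \<subseteq> critical_strip \<and>
     (\<forall>\<psi>. primitive_char q \<psi> \<longrightarrow>
        (\<not> real_char \<psi> \<longrightarrow> (\<forall>s\<in>R. Dirichlet_L \<psi> s \<noteq> 0)) \<and>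
        (real_char \<psi> \<longrightarrow>
           (\<exists>\<^sub>\<le>\<^sub>1s. s \<in> R \<and> Dirichlet_L \<psi> s = 0) \<and>
           (\<forall>s\<in>R. Dirichlet_L \<psi> s = 0 \<longrightarrow>
              s \<in> \<real> \<and> zorder (Dirichlet_L \<psi>) s = 1 \<and> Re s > 1 / 2)))"

text \<open>This set is not bounded on the right, hence not itself contained in the critical strip:
  quasi zero-freeness is to be asserted of its intersection with \<^const>\<open>critical_strip\<close>.\<close>

definition Q_region :: "nat \<Rightarrow> (nat \<Rightarrow> real) \<Rightarrow> complex set" where
  "Q_region q f =
     {s. Re s > 1 - 1 / f q \<and> \<bar>Im s\<bar> < 1 - 1 / sqrt (f q * ln (real q))}"


section \<open>Fundamental discriminants\<close>

text \<open>Every quadratic number field embeds into the complex numbers, so only subfields of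
  the complex numbers are considered.\<close>

definition complex_subfield :: "complex set \<Rightarrow> bool" where
  "complex_subfield K \<longleftrightarrow>
     1 \<in> K \<and> (\<forall>x\<in>K. \<forall>y\<in>K. x - y \<in> K \<and> x * y \<in> K) \<and> (\<forall>x\<in>K. inverse x \<in> K)"

definition quadratic_number_field :: "complex set \<Rightarrow> bool" where
  "quadratic_number_field K \<longleftrightarrow>
     complex_subfield K \<and> vector_space.dim (\<lambda>(r::rat) (x::complex). of_rat r * x) K = 2"

definition ring_of_integers :: "complex set \<Rightarrow> complex set" where
  "ring_of_integers K = {x \<in> K. algebraic_int x}"

definition field_embedding :: "complex set \<Rightarrow> (complex \<Rightarrow> complex) \<Rightarrow> bool" where
  "field_embedding K \<sigma> \<longleftrightarrow>
     \<sigma> 1 = 1 \<and> (\<forall>x\<in>K. \<forall>y\<in>K. \<sigma> (x + y) = \<sigma> x + \<sigma> y \<and> \<sigma> (x * y) = \<sigma> x * \<sigma> y)"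

text \<open>The discriminant is the square of the determinant of the matrix of the conjugates of an
  integral basis \<open>w1, w2\<close>, the two embeddings of \<open>K\<close> being the identity and \<open>\<sigma>\<close>. Two generators of
  the group of integers of a quadratic field are automatically independent.\<close>

definition quadratic_field_discriminant :: "complex set \<Rightarrow> int \<Rightarrow> bool" where
  "quadratic_field_discriminant K D \<longleftrightarrow>
     (\<exists>w1 w2 \<sigma>.
        ring_of_integers K = {of_int a * w1 + of_int b * w2 | a b. True} \<and>
        field_embedding K \<sigma> \<and> (\<exists>x\<in>K. \<sigma> x \<noteq> x) \<and>
        of_int D = (w1 * \<sigma> w2 - w2 * \<sigma> w1)\<^sup>2)"

definition fundamental_discriminant :: "int \<Rightarrow> bool" where
  "fundamental_discriminant D \<longleftrightarrow>
     D \<noteq> 0 \<and> (\<exists>K. quadratic_number_field K \<and> quadratic_field_discriminant K D)"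


section \<open>The Kronecker symbol\<close>

definition kronecker_prime :: "int \<Rightarrow> int \<Rightarrow> int" where
  "kronecker_prime a p =
     (if p = 2 then
        (if even a then 0 else if a mod 8 = 1 \<or> a mod 8 = 7 then 1 else -1)
      else Legendre a p)"

definition kronecker :: "int \<Rightarrow> int \<Rightarrow> int" where
  "kronecker a n =
     (if n = 0 then (if \<bar>a\<bar> = 1 then 1 else 0)
      else (if n < 0 \<and> a < 0 then -1 else 1) *
           (\<Prod>p\<in>#prime_factorization n. kronecker_prime a p))"

definition kronecker_char :: "int \<Rightarrow> int \<Rightarrow> complex" where
  "kronecker_char D k = of_int (kronecker D k)"

text \<open>The set of real zeros is infinite (it contains trivial zeros), so its maximum is rendered
  by \<^const>\<open>Greatest\<close>; \<^const>\<open>Max\<close> is meaningful for finite sets only.\<close>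

definition largest_real_zero :: "int \<Rightarrow> real" where
  "largest_real_zero D = (GREATEST \<beta>. Dirichlet_L (kronecker_char D) (of_real \<beta>) = 0)"

end

theory Submission
  imports Defs "HOL-Computational_Algebra.Squarefree"
begin

text \<open>Put \<open>d = 1 / sqrt (f(q) log q)\<close>. At \<open>s = 1 + d\<close> comparison with the zeta function gives
  \<open>L'/L = O(1/d)\<close>. Near \<open>1\<close>, Landau's local factorization writes \<open>L'/L(s)\<close> as the sum of
  \<open>1/(s - \<rho>)\<close> over the zeros in a disc of fixed size, up to an error whose value and derivative are
  \<open>O(log q)\<close>; so no functional equation is required. Apart from the exceptional zero, the zeros satisfy
  \<open>Re \<rho> \<le> 1 - 1/f(q)\<close>, hence moving \<open>s\<close> from \<open>1 + d\<close> to \<open>1\<close> changes the term of \<open>\<rho>\<close> by at most a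
  factor \<open>O(d f(q))\<close> of its nonnegative real part, and these real parts sum up to \<open>O(log q)\<close> at
  \<open>1 + d\<close>. The total change is \<open>O(d f(q) log q) = O(sqrt (f(q) log q))\<close>. The zero-free region says
  nothing about the line \<open>Re s = 1\<close>, where the inequality \<open>3 + 4 cos \<theta> + cos 2\<theta> \<ge> 0\<close> excludes zeros.

  The continuation comes from iterated summation by parts against periodic antidifferences of mean
  zero. The parity of these antidifferences gives \<open>L(0) = 0\<close> or \<open>L(-1) = 0\<close>, so that a largest real
  zero exists.\<close>

section \<open>Logarithmic derivatives and zeros in a disc\<close>

text \<open>The choice of d balances two errors: 1/d from the Dirichlet series at 1 + d, and d f(q)
  log q from moving the zero terms. The hypothesis f = O(log q) keeps d f(q) bounded and makes 1/d
  at most a multiple of log q, so that the real parts of the zero terms at 1 + d still add up to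
  O(log q). The geometry is fixed by the disc of centre 2 and radius 5/4. It contains 1 with room to
  spare. Its points with Re < 1 satisfy Re > 0 and |Im| < 3/4, so as soon as sqrt(f(q) log q) \<ge>
  4 a zero in the disc can avoid the region only through the condition on Re. The doubled disc stays
  in Re \<ge> -1/2, where two summations by parts give |L| = O(q^2), hence errors O(log q) in the
  local factorization. The estimate at 1 is carried out for the real part; for real characters the
  quotient itself is real. If no zero of such a character is exceptional, the term of its largest
  real zero is small enough to be absorbed in the error. For the second claim each Kronecker symbol
  must also be shown to be primitive modulo |D|, starting from the definition of D by a quadratic
  field.\<close>

lemma holomorphic_factor_zeros_compact:
  assumes F: "F holomorphic_on S" and S: "open S" "connected S"
    and K: "compact K" "K \<subseteq> S" and nz: "\<exists>s\<in>S. F s \<noteq> 0"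
  obtains Z g where "finite Z" "Z = {z\<in>K. F z = 0}" "g holomorphic_on S"
    "\<And>s. s \<in> S \<Longrightarrow> F s = g s * (\<Prod>z\<in>Z. (s - z) ^ nat (zorder F z))"
    "\<And>s. s \<in> K \<Longrightarrow> g s \<noteq> 0"
proof -
  have fin: "finite {z\<in>K. F z = 0}"
  proof (cases "F constant_on S")
    case True
    then have "F s \<noteq> 0" if "s \<in> S" for s
      using nz that by (auto simp: constant_on_def)
    then have "{z\<in>K. F z = 0} = {}"
      using K by blast
    then show ?thesis by (metis finite.emptyI)
  next
    case False
    then show ?thesis
      by (intro holomorphic_compact_finite_zeros[OF F S K])
  qed
  \<comment> \<open>The induction runs over arbitrary finite \<open>Z \<subseteq> S\<close>, not
    only sets of zeros: at a point where \<open>F\<close> does not vanish the order is 0 and the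
    factor is 1.\<close>
  have ex: "\<exists>g. g holomorphic_on S \<and> 
     (\<forall>s\<in>S. F s = g s * (\<Prod>z\<in>Z. (s - z) ^ nat (zorder F z))) \<and> (\<forall>z\<in>Z. g z \<noteq> 0)" 
    if "finite Z" "Z \<subseteq> S" for Z
    using that
  proof (induction Z rule: finite_induct)
    case empty
    then show ?case using F by auto
  next
    case (insert \<xi> Z)
    then obtain g where g: "g holomorphic_on S" "\<forall>z\<in>Z. g z \<noteq> 0"
     "\<And>s. s \<in> S \<Longrightarrow> F s = g s * (\<Prod>z\<in>Z. (s - z) ^ nat (zorder F z))"
      by auto
    define P where "P = (\<lambda>s. \<Prod>z\<in>Z. (s - z) ^ nat (zorder F z))"
    have \<xi>: "\<xi> \<in> S" using insert by auto
    from zorder_exist_zero[OF F S \<xi> nz] obtain r where r: "r > 0" "cball \<xi> r \<subseteq> S"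
      "zor_poly F \<xi> holomorphic_on cball \<xi> r" and
      Fr: "\<And>w. w \<in> cball \<xi> r \<Longrightarrow> F w = zor_poly F \<xi> w * (w - \<xi>) ^ nat (zorder F \<xi>)"
      and nzr: "\<And>w. w \<in> cball \<xi> r \<Longrightarrow> zor_poly F \<xi> w \<noteq> 0"
      by (auto simp: ball_def split: if_splits)
    have "open (ball \<xi> r - Z)" "open (S - {\<xi>})"
      using insert S by (auto intro: open_Diff finite_imp_closed)
    define U where "U = ball \<xi> r - Z"
    have U: "open U" "\<xi> \<in> U" "U \<subseteq> S"
      using insert r S by (auto intro: open_Diff finite_imp_closed simp: U_def)
    have PU: "P s \<noteq> 0" if "s \<in> U" for s
      using that insert by (auto simp: P_def U_def)
    define n where "n = nat (zorder F \<xi>)"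
    \<comment> \<open>Near the new point the quotient comes from the local factorization, away from
      it from plain division. Both agree on the overlap, so \<open>G\<close> is holomorphic on all
      of \<open>S\<close>.\<close>
    define G where "G = (\<lambda>w. if w \<in> U then zor_poly F \<xi> w / P w else g w / (w - \<xi>) ^ n)"
    have eq: "zor_poly F \<xi> w / P w = g w / (w - \<xi>) ^ n" if "w \<in> U" "w \<noteq> \<xi>" for w
    proof -
      have "w \<in> S" "w \<in> cball \<xi> r" using that U by (auto simp: U_def)
      then have "zor_poly F \<xi> w * (w - \<xi>) ^ n = g w * P w"
        using g(3)[of w] Fr[of w] by (simp add: P_def n_def)
      then show ?thesis using PU[of w] that by (auto simp: field_simps)
    qed
    have 1: "G holomorphic_on U"
    proof -
      have "(\<lambda>w. zor_poly F \<xi> w / P w) holomorphic_on U"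
        using PU unfolding P_def
        by (intro holomorphic_intros holomorphic_on_subset[OF r(3)]) (auto simp: U_def)
      then show ?thesis by (rule holomorphic_transform) (auto simp: G_def)
    qed
    have 2: "G holomorphic_on (S - {\<xi>})"
    proof -
      have "(\<lambda>w. g w / (w - \<xi>) ^ n) holomorphic_on (S - {\<xi>})"
        by (intro holomorphic_intros holomorphic_on_subset[OF g(1)]) auto
      then show ?thesis by (rule holomorphic_transform) (auto simp: G_def eq)
    qed
    have "G holomorphic_on (U \<union> (S - {\<xi>}))"
      using 1 2 U S by (intro holomorphic_on_Un) auto
    moreover have "U \<union> (S - {\<xi>}) = S" using U \<xi> by auto
    ultimately have "G holomorphic_on S" by simp
    moreover have "F s = G s * (\<Prod>z\<in>insert \<xi> Z. (s - z) ^ nat (zorder F z))" if s: "s \<in> S" for s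
    proof (cases "s = \<xi>")
      case True
      then have "F s = zor_poly F \<xi> s * (s - \<xi>) ^ n"
        using Fr[of s] r by (simp add: n_def)
      then show ?thesis
        using True U insert PU[of s] by (simp add: G_def P_def n_def)
    next
      case False
      then have "G s = g s / (s - \<xi>) ^ n" using eq by (auto simp: G_def)
      then show ?thesis
        using False insert g(3)[OF s] by (simp add: n_def)
    qed
    moreover have "G z \<noteq> 0" if "z \<in> insert \<xi> Z" for z
    proof (cases "z = \<xi>")
      case True
      then show ?thesis using PU[of \<xi>] U nzr[of \<xi>] r by (auto simp: G_def)
    next
      case False
      then show ?thesis using that g(2) insert by (auto simp: G_def U_def)
    qed
    ultimately show ?case by blast
  qed
  have "{z\<in>K. F z = 0} \<subseteq> S" using K by auto
  from ex[OF fin this] obtain g where g0: "g holomorphic_on S \<and> 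
     (\<forall>s\<in>S. F s = g s * (\<Prod>z\<in>{z\<in>K. F z = 0}. (s - z) ^ nat (zorder F z))) \<and> 
     (\<forall>z\<in>{z\<in>K. F z = 0}. g z \<noteq> 0)" by (elim exE)
  note g = conjunct1[OF g0] bspec[OF conjunct1[OF conjunct2[OF g0]]] bspec[OF conjunct2[OF conjunct2[OF g0]]]
  show thesis
  proof (rule that[OF fin refl g(1,2)])
    show "g s \<noteq> 0" if "s \<in> K" for s
      using g(2)[of s] g(3)[of s] that K by (cases "F s = 0") auto
  qed
qed

lemma Borel_Caratheodory:
  fixes h :: "complex \<Rightarrow> complex"
  assumes h: "h holomorphic_on ball c r" and r: "r > 0" and h0: "h c = 0"
    and A: "\<And>s. s \<in> ball c r \<Longrightarrow> Re (h s) < A" and s: "s \<in> ball c r"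
  shows "norm (h s) \<le> 2 * A * dist c s / (r - dist c s)"
proof -
  have Apos: "A > 0" using A[of c] h0 r by simp
  \<comment> \<open>The Moebius map y / (2A - y) sends the half-plane Re y < A into the unit disc
    and fixes 0, so Schwarz's lemma applies to \<open>w\<close>; its conclusion is then solved for
    \<open>h\<close>.\<close>
  define w where "w = (\<lambda>z. h (c + of_real r * z) / (2 * of_real A - h (c + of_real r * z)))"
  have in_ball: "c + of_real r * z \<in> ball c r" if "norm z < 1" for z
    using that r by (simp add: dist_norm norm_mult)
  have ne: "2 * of_real A - h z \<noteq> 0" if "z \<in> ball c r" for z
    using A[OF that] Apos by (auto simp: complex_eq_iff)
  have hw: "(\<lambda>z. h (c + of_real r * z)) holomorphic_on ball 0 1"
  proof -
    have "(\<lambda>z. c + of_real r * z) holomorphic_on ball 0 1" by (intro holomorphic_intros)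
    moreover have "(\<lambda>z. c + of_real r * z) ` ball 0 1 \<subseteq> ball c r"
      using in_ball by auto
    ultimately show ?thesis
      using holomorphic_on_compose_gen[OF _ h] by (simp add: o_def)
  qed
  have w: "w holomorphic_on ball 0 1"
    unfolding w_def using ne in_ball hw by (intro holomorphic_intros) auto
  have w0: "w 0 = 0" by (simp add: w_def h0)
  have w1: "norm (w z) < 1" if "norm z < 1" for z
  proof -
    define y where "y = h (c + of_real r * z)"
    have "Re y < A" using A[OF in_ball[OF that]] by (simp add: y_def)
    then have "A * Re y < A * A" using Apos by simp
    then have "(norm y)\<^sup>2 < (norm (2 * of_real A - y))\<^sup>2"
      unfolding cmod_power2 by (simp add: power2_eq_square algebra_simps)
    then have "norm y < norm (2 * of_real A - y)"
      by (rule power2_less_imp_less) auto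
    moreover have "norm (2 * of_real A - y) > 0"
      using ne[OF in_ball[OF that]] by (simp add: y_def)
    ultimately show ?thesis by (simp add: w_def y_def norm_divide)
  qed
  define z where "z = (s - c) / of_real r"
  have z: "norm z = dist c s / r" "norm z < 1"
    using s r by (auto simp: z_def dist_norm norm_divide norm_minus_commute)
  have sz: "c + of_real r * z = s" using r by (simp add: z_def)
  have wz: "norm (w z) \<le> dist c s / r"
    using Schwarz_Lemma(1)[OF w w0 w1 z(2)] z by simp
  have wz': "w z = h s / (2 * of_real A - h s)" by (simp add: w_def sz)
  have ds: "dist c s < r" using s by simp
  have "norm (h s) = norm (w z) * norm (2 * of_real A - h s)"
    using ne[OF s] by (simp add: wz' norm_divide)
  also have "\<dots> \<le> dist c s / r * (2 * A + norm (h s))"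
    using wz Apos norm_triangle_ineq4[of "2 * of_real A" "h s"] r
    by (intro mult_mono) (auto simp: norm_mult)
  finally have "norm (h s) * r \<le> dist c s * (2 * A + norm (h s))"
    using r by (simp add: field_simps)
  then have "norm (h s) * (r - dist c s) \<le> 2 * A * dist c s"
    by (simp add: algebra_simps)
  then show ?thesis using ds by (simp add: field_simps)
qed

text \<open>Dividing out the zeros of the inner disc leaves a zero-free \<open>g\<close>, whose
  normalized logarithm \<open>h\<close> is bounded by Borel-Caratheodory; \<open>E\<close> is the
  derivative of \<open>h\<close>. The constant 76 is 4 * 19, from the radius 19/20 r. Each of two
  Cauchy estimates gives up r/40 of the radius (38/40, 37/40, 36/40) and costs a factor 40: 3040 and
  121600.\<close>

lemma local_factorization_log_deriv_bounds:
  fixes F :: "complex \<Rightarrow> complex"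
  assumes F: "F holomorphic_on S" and S: "open S" "connected S"
    and r: "r > 0" "cball c (2 * r) \<subseteq> S" and Fc: "F c \<noteq> 0" and M: "M > 1"
    and bound: "\<And>s. s \<in> cball c (2 * r) \<Longrightarrow> norm (F s) \<le> M * norm (F c)"
  obtains Z E where "finite Z" "Z = {z \<in> cball c r. F z = 0}"
    "\<And>s. s \<in> ball c r \<Longrightarrow> F s \<noteq> 0 \<Longrightarrow> 
        deriv F s / F s = E s + (\<Sum>z\<in>Z. of_nat (nat (zorder F z)) / (s - z))"
    "\<And>s. dist c s \<le> 9 / 10 * r \<Longrightarrow> norm (E s) \<le> 3040 * ln M / r"
    "\<And>s s'. dist c s \<le> 9 / 10 * r \<Longrightarrow> dist c s' \<le> 9 / 10 * r \<Longrightarrow>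
        norm (E s - E s') \<le> 121600 * ln M / r ^ 2 * norm (s - s')"
proof -
  have cS: "c \<in> S" using r by auto
  have cr: "cball c r \<subseteq> S"
    using r subset_cball[of r "2 * r" c] by simp
  have ex: "\<exists>s\<in>S. F s \<noteq> 0" using Fc cS by blast
  obtain Z g where Z: "finite Z" "Z = {z\<in>cball c r. F z = 0}" and g: "g holomorphic_on S"
    and Fg: "\<And>s. s \<in> S \<Longrightarrow> F s = g s * (\<Prod>z\<in>Z. (s - z) ^ nat (zorder F z))"
    and gnz: "\<And>s. s \<in> cball c r \<Longrightarrow> g s \<noteq> 0"
    by (rule holomorphic_factor_zeros_compact[OF F S compact_cball cr ex]) blast
  define A where "A = ln M"
  have Apos: "A > 0" using M by (simp add: A_def)
  define P where "P = (\<lambda>s. \<Prod>z\<in>Z. (s - z) ^ nat (zorder F z))"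
  have gc: "g c \<noteq> 0" using gnz r by auto
  have sub: "ball c (2*r) \<subseteq> S" "sphere c (2*r) \<subseteq> S" using r by auto
  \<comment> \<open>On the outer sphere every zero in \<open>Z\<close> is at least as far from
    \<open>s\<close> as from \<open>c\<close>, so dividing by \<open>P\<close> preserves the bound
    relative to the centre. The maximum principle then carries it inside.\<close>
  have sph: "norm (g s) \<le> M * norm (g c)" if "dist c s = 2 * r" for s
  proof -
    have "norm (P c) \<le> norm (P s)"
      unfolding P_def prod_norm[symmetric] norm_power
    proof (intro prod_mono conjI power_mono)
      fix z assume "z \<in> Z"
      then have "dist c z \<le> r" using Z by auto
      then have "dist c z \<le> dist s z" using that by metric
      then show "norm (c - z) \<le> norm (s - z)" by (simp add: dist_norm)
    qed auto
    moreover have "norm (F s) \<le> M * norm (F c)" using that bound by auto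
    moreover have "F s = g s * P s" "F c = g c * P c"
      using Fg cS that sub by (auto simp: P_def)
    moreover have "P c \<noteq> 0" using Fc \<open>F c = g c * P c\<close> by auto
    ultimately have "norm (g s) * norm (P s) \<le> M * norm (g c) * norm (P c)"
      by (simp add: norm_mult)
    also have "\<dots> \<le> M * norm (g c) * norm (P s)"
      using \<open>norm (P c) \<le> norm (P s)\<close> M by (intro mult_left_mono) auto
    finally show ?thesis
      using \<open>norm (P c) \<le> norm (P s)\<close> \<open>P c \<noteq> 0\<close>
      by (metis mult_le_cancel_right norm_le_zero_iff not_less order_trans)
  qed
  have gM: "norm (g s) \<le> M * norm (g c)" if "s \<in> ball c (2*r)" for s
  proof (rule maximum_modulus_frontier[of g "cball c (2*r)"])
    show "g holomorphic_on interior (cball c (2*r))" "continuous_on (closure (cball c (2*r))) g"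
      using g r sub by (auto intro: holomorphic_on_subset holomorphic_on_imp_continuous_on)
    show "\<And>z. z \<in> frontier (cball c (2*r)) \<Longrightarrow> norm (g z) \<le> M * norm (g c)"
      using sph by (auto simp: frontier_cball)
  qed (use that in auto)
  define g1 where "g1 = (\<lambda>s. g s / g c)"
  have g1: "g1 holomorphic_on ball c r" "\<And>s. s \<in> ball c r \<Longrightarrow> g1 s \<noteq> 0"
    unfolding g1_def using gc gnz r
    by (auto intro!: holomorphic_intros holomorphic_on_subset[OF g] simp: subset_iff)
  obtain h0 where h0: "h0 holomorphic_on ball c r" "\<And>s. s \<in> ball c r \<Longrightarrow> exp (h0 s) = g1 s"
    using holomorphic_logarithm_exists[OF convex_ball open_ball g1, of c] r by auto
  define h where "h = (\<lambda>s. h0 s - h0 c)"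
  have h: "h holomorphic_on ball c r" "h c = 0"
    unfolding h_def using h0 by (auto intro!: holomorphic_intros)
  have eh: "exp (h s) = g1 s" if "s \<in> ball c r" for s
    using h0(2)[OF that] h0(2)[of c] r gc by (simp add: h_def exp_diff g1_def)
  \<comment> \<open>\<open>2 * A\<close> instead of \<open>A\<close>, because Borel-Caratheodory
    wants a strict upper bound.\<close>
  have Reh: "Re (h s) < 2 * A" if "s \<in> ball c r" for s
  proof -
    have "s \<in> ball c (2 * r)" using that r by auto
    then have "norm (g s) \<le> M * norm (g c)" by (rule gM)
    moreover have "exp (Re (h s)) = norm (g s) / norm (g c)"
      using eh[OF that] norm_exp_eq_Re[of "h s"] by (simp add: g1_def norm_divide)
    ultimately have "exp (Re (h s)) \<le> M"
      using gc by (simp add: divide_le_eq)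
    then have "Re (h s) \<le> A" using M unfolding A_def by (subst ln_ge_iff) auto
    then show ?thesis using Apos by simp
  qed
  have hb: "norm (h s) \<le> 76 * A" if "dist c s \<le> 19 / 20 * r" for s
  proof -
    have s: "s \<in> ball c r" using that r by simp
    have "norm (h s) \<le> 2 * (2 * A) * dist c s / (r - dist c s)"
      by (rule Borel_Caratheodory[OF h(1) r(1) h(2) Reh s])
    also have "\<dots> \<le> 2 * (2 * A) * (19 / 20 * r) / (r / 20)"
      using that r Apos by (intro frac_le mult_left_mono) auto
    also have "\<dots> = 76 * A" using r by simp
    finally show ?thesis .
  qed
  have cauchy: "norm (deriv f s) \<le> B / (r / 40)"
    if "f holomorphic_on ball c r" "dist c s \<le> t - r / 40" "t < r" "\<And>z. dist c z \<le> t \<Longrightarrow> norm (f z) \<le> B" 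
    for f t s B
  proof -
    have sb: "cball s (r/40) \<subseteq> cball c t" using that(2) by (simp add: cball_subset_cball_iff dist_commute)
    also have "\<dots> \<subseteq> ball c r" using that(3) by auto
    finally have "cball s (r/40) \<subseteq> ball c r" .
    then have "f holomorphic_on cball s (r/40)" using that(1) by (rule holomorphic_on_subset[rotated])
    then have "norm ((deriv ^^ 1) f s) \<le> fact 1 * B / (r/40) ^ 1"
      using r that(4) sb
      by (intro Cauchy_inequality) 
         (auto intro: holomorphic_on_imp_continuous_on holomorphic_on_subset simp: subset_iff dist_norm)
    then show ?thesis by simp
  qed
  have dh: "deriv h holomorphic_on ball c r" using h by (intro holomorphic_deriv) auto
  have dhb: "norm (deriv h s) \<le> 3040 * A / r" if "dist c s \<le> 37/40 * r" for s
    using cauchy[OF h(1), of s "19/20*r" "76 * A"] that hb r by auto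
  have ddhb: "norm (deriv (deriv h) s) \<le> 121600 * A / r ^ 2" if "dist c s \<le> 9/10 * r" for s
    using cauchy[OF dh, of s "37/40*r" "3040 * A / r"] that dhb r
    by (auto simp: power2_eq_square field_simps)
  show thesis
  proof (rule that[OF Z, of "deriv h"])
    fix s assume s: "dist c s \<le> 9 / 10 * r"
    then show "norm (deriv h s) \<le> 3040 * ln M / r" using dhb[of s] r A_def by auto
    fix s' assume s': "dist c s' \<le> 9 / 10 * r"
    have "norm (deriv h s - deriv h s') \<le> 121600 * A / r ^ 2 * norm (s - s')"
    proof (rule field_differentiable_bound[of "cball c (9/10*r)" _ "deriv (deriv h)"])
      fix z assume z: "z \<in> cball c (9/10*r)"
      then have "z \<in> ball c r" using r by auto
      then show "(deriv h has_field_derivative deriv (deriv h) z) (at z within cball c (9/10*r))"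
        using dh by (meson has_field_derivative_at_within holomorphic_derivI open_ball)
      show "norm (deriv (deriv h) z) \<le> 121600 * A / r\<^sup>2" using ddhb z by simp
    qed (use s s' in auto)
    then show "norm (deriv h s - deriv h s') \<le> 121600 * ln M / r ^ 2 * norm (s - s')"
      by (simp add: A_def)
  next
    fix s assume s: "s \<in> ball c r" and Fs: "F s \<noteq> 0"
    then have sS: "s \<in> S" using r by (auto simp: subset_iff)
    have Ps: "P s \<noteq> 0" using Fg[OF sS] Fs by (auto simp: P_def)
    have "deriv F s = deriv (\<lambda>s. g c * exp (h s) * P s) s"
    proof (rule complex_derivative_transform_within_open[OF holomorphic_on_subset[OF F] _ open_ball s])
      show "ball c r \<subseteq> S" using r by (auto simp: subset_iff)
      show "(\<lambda>s. g c * exp (h s) * P s) holomorphic_on ball c r"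
        unfolding P_def by (intro holomorphic_intros h)
      fix w assume w: "w \<in> ball c r"
      then have "w \<in> S" using r by (auto simp: subset_iff)
      then show "F w = g c * exp (h w) * P w"
        using Fg eh[OF w] gc by (simp add: P_def g1_def)
    qed
    also have "\<dots> = g c * exp (h s) * deriv h s * P s + g c * exp (h s) * deriv P s"
    proof -
      have 1: "(h has_field_derivative deriv h s) (at s)"
        using h s by (auto intro: holomorphic_derivI)
      have "P holomorphic_on UNIV" unfolding P_def by (intro holomorphic_intros)
      then have 2: "(P has_field_derivative deriv P s) (at s)"
        by (auto intro: holomorphic_derivI)
      show ?thesis
        by (rule DERIV_imp_deriv) (auto intro!: derivative_eq_intros 1 2 simp: algebra_simps)
    qed
    finally have dF: "deriv F s = \<dots>" .
    have sZ: "s - z \<noteq> 0" if "z \<in> Z" for z using that Z Fs by auto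
    have dP: "deriv P s / P s = (\<Sum>z\<in>Z. of_nat (nat (zorder F z)) / (s - z))"
    proof -
      have "(P has_field_derivative P s * (\<Sum>z\<in>Z. of_nat (nat (zorder F z)) * 
              (s - z) ^ (nat (zorder F z) - 1) / (s - z) ^ nat (zorder F z))) (at s)"
        unfolding P_def using sZ by (intro has_field_derivative_prod') (auto intro!: derivative_eq_intros)
      moreover have "of_nat n * (s - z) ^ (n - 1) / (s - z) ^ n = of_nat n / (s - z)" if "z \<in> Z" for n z
        using sZ[OF that] by (cases n) auto
      ultimately have "(P has_field_derivative P s * (\<Sum>z\<in>Z. of_nat (nat (zorder F z)) / (s - z))) (at s)"
        by simp
      then show ?thesis using Ps by (simp add: DERIV_imp_deriv)
    qed
    have "F s = g c * exp (h s) * P s"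
      using Fg[OF sS] eh[OF s] gc by (simp add: P_def g1_def)
    then have "deriv F s / F s = deriv h s + deriv P s / P s"
      using dF gc Ps by (simp add: field_simps)
    then show "deriv F s / F s = deriv h s + (\<Sum>z\<in>Z. of_nat (nat (zorder F z)) / (s - z))"
      by (simp add: dP)
  qed
qed

section \<open>Analytic continuation of Dirichlet series with periodic coefficients\<close>

lemma series_of_holomorphic:
  fixes f :: "nat \<Rightarrow> complex \<Rightarrow> complex"
  assumes S: "open S" and f: "\<And>n. f n holomorphic_on S"
    and bound: "\<And>s. s \<in> S \<Longrightarrow> \<exists>d>0. \<exists>h. summable h \<and> (\<forall>n. \<forall>y\<in>ball s d \<inter> S. norm (f n y) \<le> h n)"
    and s: "s \<in> S"
  shows "summable (\<lambda>n. f n s)" "summable (\<lambda>n. deriv (f n) s)"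
    "((\<lambda>s. \<Sum>n. f n s) has_field_derivative (\<Sum>n. deriv (f n) s)) (at s)"
proof -
  have "\<exists>g g'. \<forall>x \<in> S. ((\<lambda>n. f n x) sums g x) \<and> ((\<lambda>n. deriv (f n) x) sums g' x) \<and> 
      (g has_field_derivative g' x) (at x)"
  proof (rule series_and_derivative_comparison_complex[OF S])
    show "(f n has_field_derivative deriv (f n) x) (at x)" if "x \<in> S" for n x
      using f S that by (rule holomorphic_derivI)
    fix x assume x: "x \<in> S"
    from bound[OF x] obtain d h where dh: "d > 0" "summable h" 
      "\<And>n y. y \<in> ball x d \<inter> S \<Longrightarrow> norm (f n y) \<le> h n" by blast
    have h0: "h n \<ge> 0" for n
      using dh(3)[of x n] norm_ge_zero[of "f n x"] x dh(1) by (simp del: norm_ge_zero)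
    show "\<exists>d h. 0 < d \<and> summable h \<and> range h \<subseteq> \<real>\<^sub>\<ge>\<^sub>0 \<and> 
            (\<forall>\<^sub>F n in sequentially. \<forall>y\<in>ball x d \<inter> S. cmod(f n y) \<le> cmod (h n))"
    proof (intro exI[of _ d] exI[of _ "\<lambda>n. complex_of_real (h n)"] conjI)
      show "summable (\<lambda>n. complex_of_real (h n))" using dh(2) by (rule summable_of_real)
    qed (use dh h0 in auto)
  qed
  then obtain g g' where g: "\<And>x. x \<in> S \<Longrightarrow> (\<lambda>n. f n x) sums g x" 
      "\<And>x. x \<in> S \<Longrightarrow> (\<lambda>n. deriv (f n) x) sums g' x"
      "\<And>x. x \<in> S \<Longrightarrow> (g has_field_derivative g' x) (at x)" by blast
  show "summable (\<lambda>n. f n s)" "summable (\<lambda>n. deriv (f n) s)"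
    using g s by (auto simp: sums_iff)
  have "((\<lambda>s. \<Sum>n. f n s) has_field_derivative g' s) (at s)"
    by (rule has_field_derivative_transform_within_open[OF g(3)[OF s] S s])
       (use g(1) in \<open>simp add: sums_iff\<close>)
  then show "((\<lambda>s. \<Sum>n. f n s) has_field_derivative (\<Sum>n. deriv (f n) s)) (at s)"
    using g(2)[OF s] by (simp add: sums_iff)
qed

lemma periodic_int_mod:
  fixes a :: "int \<Rightarrow> 'a"
  assumes "\<And>n. a (n + int q) = a n"
  shows "a (n mod int q) = a n"
proof -
  have *: "a (n + int k * int q) = a n" for n k
  proof (induction k)
    case (Suc k)
    have "a (n + int (Suc k) * int q) = a ((n + int k * int q) + int q)"
      by (simp add: algebra_simps)
    also have "\<dots> = a n" using Suc assms by simp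
    finally show ?case .
  qed simp
  show ?thesis
  proof (cases "n div int q \<ge> 0")
    case True
    then show ?thesis
      using *[of "n mod int q" "nat (n div int q)"] by (simp add: algebra_simps)
  next
    case False
    then show ?thesis
      using *[of n "nat (- (n div int q))"] by (simp add: minus_div_mult_eq_mod)
  qed
qed

section \<open>Periodic functions of mean zero and their antidifferences\<close>

definition mean_zero_periodic :: "nat \<Rightarrow> (int \<Rightarrow> complex) \<Rightarrow> bool" where
  "mean_zero_periodic q a \<longleftrightarrow> q > 0 \<and> (\<forall>n. a (n + int q) = a n) \<and> (\<Sum>k<q. a (int k)) = 0"

text \<open>The endpoint is reduced modulo q, so periodicity is built in. That differences come out
  right across multiples of q is where the vanishing mean enters.\<close>

definition period_sum :: "nat \<Rightarrow> (int \<Rightarrow> complex) \<Rightarrow> int \<Rightarrow> complex" where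
  "period_sum q a n = (\<Sum>k\<in>{1..nat (n mod int q)}. a (int k))"

text \<open>Subtracting the mean makes the result mean-zero again, so the operation can be iterated,
  and singles out one antidifference among all its translates by constants.\<close>

definition antidiff :: "nat \<Rightarrow> (int \<Rightarrow> complex) \<Rightarrow> int \<Rightarrow> complex" where
  "antidiff q a n = period_sum q a n - (\<Sum>k<q. period_sum q a (int k)) / of_nat q"

lemma antidiff_diff:
  assumes "mean_zero_periodic q a"
  shows "antidiff q a n - antidiff q a (n - 1) = a n"
proof -
  have q: "q > 0" and per: "\<And>n. a (n + int q) = a n" and mz: "(\<Sum>k<q. a (int k)) = 0"
    using assms by (auto simp: mean_zero_periodic_def)
  have "period_sum q a n - period_sum q a (n - 1) = a n"
  proof (cases "n mod int q = 0")
    case True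
    have "(n - 1) mod int q = int q - 1"
      using True q by (metis mod_diff_left_eq diff_0 zmod_minus1 of_nat_0_less_iff)
    then have "nat ((n - 1) mod int q) = q - 1" by simp
    moreover have "{..<q} = insert 0 {1..q-1}" using q by auto
    then have "(\<Sum>k<q. a (int k)) = a 0 + (\<Sum>k\<in>{1..q-1}. a (int k))" by simp
    moreover have "a 0 = a n" using periodic_int_mod[of a q n, OF per] True by simp
    ultimately have "a n + (\<Sum>k\<in>{1..q-1}. a (int k)) = 0" using mz by simp
    then show ?thesis using True \<open>nat ((n - 1) mod int q) = q - 1\<close>
      by (simp add: period_sum_def add_eq_0_iff2)
  next
    case False
    define m where "m = nat (n mod int q)"
    have "int m = n mod int q" using q by (simp add: m_def)
    moreover from this have "m > 0" using False by (cases m) auto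
    ultimately have m: "int m = n mod int q" "m > 0" by auto
    have "n mod int q < int q" using q by simp
    then have "(int m - 1) mod int q = int m - 1"
      using m by (intro mod_pos_pos_trivial) auto
    then have "nat ((n - 1) mod int q) = m - 1"
      using m mod_diff_left_eq[of n "int q" 1] by simp
    moreover have "{1..m} = insert m {1..m-1}" using m by auto
    moreover have "a (int m) = a n" using periodic_int_mod[of a q n, OF per] m by simp
    ultimately show ?thesis using m by (simp add: period_sum_def m_def[symmetric])
  qed
  then show ?thesis by (simp add: antidiff_def)
qed

lemma mean_zero_periodic_antidiff:
  assumes "mean_zero_periodic q a"
  shows "mean_zero_periodic q (antidiff q a)"
  using assms by (auto simp: mean_zero_periodic_def antidiff_def period_sum_def sum_subtractf)

lemma norm_antidiff_le:
  assumes q: "q > 0" and B: "\<And>n. norm (a n) \<le> B"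
  shows "norm (antidiff q a n) \<le> 2 * real q * B"
proof -
  have B0: "B \<ge> 0" using B[of 0] norm_ge_zero order_trans by blast
  have S: "norm (period_sum q a n) \<le> real q * B" for n
  proof -
    have "n mod int q < int q" using q by simp
    then have "nat (n mod int q) \<le> q" by linarith
    have "norm (period_sum q a n) \<le> (\<Sum>k\<in>{1..nat (n mod int q)}. B)"
      unfolding period_sum_def by (intro sum_norm_le B)
    also have "\<dots> \<le> real q * B"
      using \<open>nat (n mod int q) \<le> q\<close> B0 by (auto intro!: mult_right_mono)
    finally show ?thesis .
  qed
  have "norm (\<Sum>k<q. period_sum q a (int k)) \<le> (\<Sum>k<q. real q * B)"
    by (intro sum_norm_le S)
  then have "norm ((\<Sum>k<q. period_sum q a (int k)) / of_nat q) \<le> real q * B"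
    using q by (simp add: norm_divide divide_le_eq mult_ac)
  then have "norm (antidiff q a n) \<le> real q * B + real q * B"
    unfolding antidiff_def using S norm_triangle_ineq4 by (smt (verit))
  then show ?thesis by (simp add: mult_ac)
qed

text \<open>The terms are differences of the antidifference, so the sum over a period telescopes to
  0.\<close>

lemma mean_zero_periodic_reflect_sum:
  assumes "mean_zero_periodic q a"
  shows "(\<Sum>k<q. a (c - int k)) = 0"
proof -
  have "(\<Sum>k<q. a (c - int k)) = (\<Sum>k<q. antidiff q a (c - int k) - antidiff q a (c - int (Suc k)))"
    using antidiff_diff[OF assms, of "c - int k" for k] by (simp add: algebra_simps)
  also have "\<dots> = antidiff q a c - antidiff q a (c - int q)"
    by (subst sum_lessThan_telescope') simp
  also have "antidiff q a (c - int q) = antidiff q a c"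
    using mean_zero_periodic_antidiff[OF assms] unfolding mean_zero_periodic_def
    by (metis diff_add_cancel)
  finally show ?thesis by simp
qed

lemma mean_zero_periodic_reflect:
  assumes "mean_zero_periodic q a"
  shows "mean_zero_periodic q (\<lambda>n. a (c - n))" "mean_zero_periodic q (\<lambda>n. - a (c - n))"
proof -
  have "a (c - (n + int q)) = a (c - n)" for n
    using assms unfolding mean_zero_periodic_def by (metis add_diff_cancel diff_add_eq diff_diff_eq2)
  then show "mean_zero_periodic q (\<lambda>n. a (c - n))" "mean_zero_periodic q (\<lambda>n. - a (c - n))"
    using mean_zero_periodic_reflect_sum[OF assms] assms
    by (auto simp: mean_zero_periodic_def sum_negf)
qed

text \<open>The difference of two candidates is invariant under the shift by 1, hence constant, and
  its mean is 0. Symmetries of antidifferences follow, because a suitably reflected antidifference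
  solves the same difference equation.\<close>

lemma antidiff_unique:
  assumes a: "mean_zero_periodic q a" and b: "mean_zero_periodic q b" 
    and diff: "\<And>n. b n - b (n - 1) = a n"
  shows "b = antidiff q a"
proof -
  define d where "d = (\<lambda>n. b n - antidiff q a n)"
  have d: "d n = d (n - 1)" for n
    using diff[of n] antidiff_diff[OF a, of n] by (simp add: d_def algebra_simps)
  have d0: "d n = d 0" for n
  proof (induction n rule: int_induct[where k = 0])
    case (step1 i) then show ?case using d[of "i + 1"] by simp
  next
    case (step2 i) then show ?case using d[of i] by simp
  qed simp
  have "(\<Sum>k<q. d (int k)) = 0"
    using b mean_zero_periodic_antidiff[OF a] by (simp add: d_def sum_subtractf mean_zero_periodic_def)
  moreover have "(\<Sum>k<q. d (int k)) = (\<Sum>k<q. d 0)" by (intro sum.cong d0 refl)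
  ultimately have "of_nat q * d 0 = 0" by simp
  then have "d 0 = 0" using a by (simp add: mean_zero_periodic_def)
  then have "d n = 0" for n using d0 by simp
  then show ?thesis by (auto simp: d_def fun_eq_iff)
qed

text \<open>Every antidifference flips the parity and moves the centre of reflection by -1/2. An
  even function becomes odd about -1/2; an odd one becomes even about -1/2 and, after a second step,
  odd about -1.\<close>

lemma antidiff_even:
  assumes a: "mean_zero_periodic q a" and even: "\<And>n. a (- n) = a n"
  shows "antidiff q a (- 1 - n) = - antidiff q a n"
proof -
  have "(\<lambda>n. - antidiff q a (- 1 - n)) = antidiff q a"
  proof (rule antidiff_unique[OF a mean_zero_periodic_reflect(2)[OF mean_zero_periodic_antidiff[OF a]]])
    fix n show "- antidiff q a (- 1 - n) - - antidiff q a (- 1 - (n - 1)) = a n"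
      using antidiff_diff[OF a, of "- n"] even[of n] by (simp add: algebra_simps minus_diff_commute)
  qed
  from fun_cong[OF this, of n] show ?thesis by (simp add: minus_equation_iff)
qed

lemma antidiff_odd:
  assumes a: "mean_zero_periodic q a" and odd: "\<And>n. a (- n) = - a n"
  shows "antidiff q a (- 1 - n) = antidiff q a n"
proof -
  have "(\<lambda>n. antidiff q a (- 1 - n)) = antidiff q a"
  proof (rule antidiff_unique[OF a mean_zero_periodic_reflect(1)[OF mean_zero_periodic_antidiff[OF a]]])
    fix n show "antidiff q a (- 1 - n) - antidiff q a (- 1 - (n - 1)) = a n"
      using antidiff_diff[OF a, of "- n"] odd[of n] by (simp add: algebra_simps minus_diff_commute)
  qed
  from fun_cong[OF this, of n] show ?thesis by simp
qed

lemma antidiff_antidiff_odd: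
  assumes a: "mean_zero_periodic q a" and odd: "\<And>n. a (- n) = - a n"
  shows "antidiff q (antidiff q a) (- 2 - n) = - antidiff q (antidiff q a) n"
proof -
  note b = mean_zero_periodic_antidiff[OF a]
  have "(\<lambda>n. - antidiff q (antidiff q a) (- 2 - n)) = antidiff q (antidiff q a)"
  proof (rule antidiff_unique[OF b mean_zero_periodic_reflect(2)[OF mean_zero_periodic_antidiff[OF b]]])
    fix n show "- antidiff q (antidiff q a) (- 2 - n) - - antidiff q (antidiff q a) (- 2 - (n - 1)) = antidiff q a n"
      using antidiff_diff[OF b, of "- 1 - n"] antidiff_odd[OF assms, of n]
      by (simp add: algebra_simps minus_diff_commute)
  qed
  from fun_cong[OF this, of n] show ?thesis by (simp add: minus_equation_iff)
qed

section \<open>Iterated forward differences of complex powers\<close>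

fun powr_diff :: "nat \<Rightarrow> complex \<Rightarrow> complex \<Rightarrow> complex" where
  "powr_diff 0 s x = x powr - s"
| "powr_diff (Suc m) s x = powr_diff m s (x + 1) - powr_diff m s x"

lemma powr_diff_has_derivative:
  "Re x > 0 \<Longrightarrow> (powr_diff m s has_field_derivative - s * powr_diff m (s + 1) x) (at x)"
proof (induction m arbitrary: x)
  case 0
  then have "x \<notin> \<real>\<^sub>\<le>\<^sub>0" by (auto simp: complex_nonpos_Reals_iff)
  then have "((\<lambda>x. x powr - s) has_field_derivative - s * x powr (- s - 1)) (at x)"
    by (auto intro!: derivative_eq_intros)
  moreover have "powr_diff 0 s = (\<lambda>x. x powr - s)" by auto
  moreover have "- s - 1 = - (s + 1)" by simp
  ultimately show ?case by (simp only: powr_diff.simps)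
next
  case (Suc m)
  have "((\<lambda>x. powr_diff m s (x + 1)) has_field_derivative - s * powr_diff m (s + 1) (x + 1)) (at x)"
    using Suc.IH[of "x + 1"] Suc.prems DERIV_shift[of "powr_diff m s" _ x 1] by auto
  from DERIV_diff[OF this Suc.IH[OF Suc.prems]] 
  have "((\<lambda>x. powr_diff m s (x + 1) - powr_diff m s x) has_field_derivative
          - s * powr_diff (Suc m) (s + 1) x) (at x)"
    by (simp add: algebra_simps)
  moreover have "powr_diff (Suc m) s = (\<lambda>x. powr_diff m s (x + 1) - powr_diff m s x)" by auto
  ultimately show ?case by simp
qed

text \<open>Mean value inequality on the segment from x to x + 1. Differentiation in x turns
  \<open>s\<close> into \<open>s + 1\<close> with a factor -s, which accumulates to the Pochhammer
  symbol and explains why \<open>s\<close> is generalized in the induction. The condition on Re s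
  makes the majorant decreasing, so its value at the left endpoint serves for the whole
  segment.\<close>

lemma norm_powr_diff_le:
  assumes "x > 0" "Re s + real m \<ge> 0"
  shows "norm (powr_diff m s (of_real x)) \<le> norm (pochhammer s m) * x powr (- Re s - real m)"
  using assms
proof (induction m arbitrary: s x)
  case 0
  then show ?case by (simp add: norm_powr_real_powr)
next
  case (Suc m)
  define S where "S = complex_of_real ` {x..x+1}"
  have "norm (powr_diff m s (of_real x + 1) - powr_diff m s (of_real x)) \<le> 
      norm (pochhammer s (Suc m)) * x powr (- Re s - real (Suc m)) * norm (of_real x + 1 - complex_of_real x)"
  proof (rule field_differentiable_bound[of S])
    show "convex S" unfolding S_def by (intro convex_linear_image bounded_linear.linear bounded_linear_of_real) auto
    show "of_real x + 1 \<in> S" unfolding S_def by (rule image_eqI[of _ _ "x + 1"]) auto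
    show "of_real x \<in> S" by (auto simp: S_def)
    fix z assume "z \<in> S"
    then obtain y where y: "z = of_real y" "x \<le> y" "y \<le> x + 1" by (auto simp: S_def)
    show "(powr_diff m s has_field_derivative - s * powr_diff m (s + 1) z) (at z within S)"
      using powr_diff_has_derivative[of z m s] y Suc.prems
      by (auto intro: has_field_derivative_at_within)
    have "norm (powr_diff m (s + 1) (of_real y)) \<le> norm (pochhammer (s + 1) m) * y powr (- Re (s + 1) - real m)"
      using Suc.prems y by (intro Suc.IH) auto
    also have "\<dots> \<le> norm (pochhammer (s + 1) m) * x powr (- Re (s + 1) - real m)"
      using Suc.prems y by (intro mult_left_mono powr_mono2') auto
    finally have "norm s * norm (powr_diff m (s + 1) z) \<le> 
       norm s * (norm (pochhammer (s + 1) m) * x powr (- Re (s + 1) - real m))"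
      using y by (intro mult_left_mono) auto
    then show "norm (- s * powr_diff m (s + 1) z) \<le> norm (pochhammer s (Suc m)) * x powr (- Re s - real (Suc m))"
      by (simp add: pochhammer_rec norm_mult mult.assoc diff_diff_eq[symmetric] del: diff_diff_eq)
  qed
  then show ?case by simp
qed

lemma holomorphic_powr_diff: "Re x > 0 \<Longrightarrow> (\<lambda>s. powr_diff m s x) holomorphic_on S"
  by (induction m arbitrary: x) (auto intro!: holomorphic_intros)

section \<open>Continuation by iterated summation by parts\<close>

definition antidiff_series :: "nat \<Rightarrow> (int \<Rightarrow> complex) \<Rightarrow> nat \<Rightarrow> complex \<Rightarrow> complex" where
  "antidiff_series q a m s = (\<Sum>n. (antidiff q ^^ m) a (int (Suc n)) * powr_diff m s (of_nat (Suc n)))"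

text \<open>The outcome of m summations by parts: m boundary terms, all entire in s, and a remainder
  series that converges for Re s > 1 - m.\<close>

definition periodic_L_partial :: "nat \<Rightarrow> (int \<Rightarrow> complex) \<Rightarrow> nat \<Rightarrow> complex \<Rightarrow> complex" where
  "periodic_L_partial q a m s = 
     (\<Sum>j<m. (-1) ^ Suc j * (antidiff q ^^ Suc j) a 0 * powr_diff j s 1) + (-1) ^ m * antidiff_series q a m s"

text \<open>The number of summations is the least positive m with Re s > 1 - m. It jumps with s, but
  by \<open>periodic_L_eq_partial\<close> any admissible m gives the same value, so the pieces fit
  together holomorphically.\<close>

definition periodic_L :: "nat \<Rightarrow> (int \<Rightarrow> complex) \<Rightarrow> complex \<Rightarrow> complex" where
  "periodic_L q a s = periodic_L_partial q a (Suc (nat \<lfloor>1 - Re s\<rfloor>)) s"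

lemma mean_zero_periodic_antidiff_pow:
  "mean_zero_periodic q a \<Longrightarrow> mean_zero_periodic q ((antidiff q ^^ m) a)"
  by (induction m) (auto intro: mean_zero_periodic_antidiff)

lemma mean_zero_periodic_bounded:
  assumes "mean_zero_periodic q a"
  obtains B where "B > 0" "\<And>n. norm (a n) \<le> B"
proof
  have q: "q > 0" and per: "\<And>n. a (n + int q) = a n"
    using assms by (auto simp: mean_zero_periodic_def)
  show "(\<Sum>k<q. norm (a (int k))) + 1 > 0" by (simp add: add_nonneg_pos sum_nonneg)
  fix n
  have "nat (n mod int q) \<in> {..<q}" using q by (simp add: nat_less_iff)
  then have "norm (a (int (nat (n mod int q)))) \<le> (\<Sum>k<q. norm (a (int k)))"
    by (intro member_le_sum) auto
  moreover have "int (nat (n mod int q)) = n mod int q" using q by simp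
  ultimately show "norm (a n) \<le> (\<Sum>k<q. norm (a (int k))) + 1"
    using periodic_int_mod[of a q n, OF per] by simp
qed

lemma summable_Suc_powr: "p > 1 \<Longrightarrow> summable (\<lambda>n. real (Suc n) powr - p)"
  using summable_real_powr_iff[of "- p"] summable_Suc_iff[of "\<lambda>n. real n powr - p"] by simp

lemma antidiff_series_local_bound:
  assumes a: "mean_zero_periodic q a" and s: "Re s > 1 - real m"
  shows "\<exists>d>0. \<exists>h. summable h \<and> (\<forall>n. \<forall>y\<in>ball s d \<inter> S. 
     norm ((antidiff q ^^ m) a (int (Suc n)) * powr_diff m y (of_nat (Suc n))) \<le> h n)"
proof -
  define d where "d = (Re s + real m - 1) / 2"
  have d: "d > 0" using s by (simp add: d_def)
  obtain B where B: "B > 0" "\<And>n. norm ((antidiff q ^^ m) a n) \<le> B"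
    using mean_zero_periodic_bounded[OF mean_zero_periodic_antidiff_pow[OF a]] by metis
  have "bounded ((\<lambda>y. pochhammer y m) ` cball s d)"
    by (intro compact_imp_bounded compact_continuous_image continuous_intros) 
       (auto simp: pochhammer_prod intro!: continuous_intros)
  then obtain P where P: "P > 0" "\<And>y. y \<in> cball s d \<Longrightarrow> norm (pochhammer y m) \<le> P"
    by (auto simp: bounded_pos)
  define h where "h = (\<lambda>n. B * (P * real (Suc n) powr - (1 + d)))"
  have "summable h" unfolding h_def
    using d by (intro summable_mult summable_Suc_powr) auto
  moreover have "norm ((antidiff q ^^ m) a (int (Suc n)) * powr_diff m y (of_nat (Suc n))) \<le> h n" 
    if "y \<in> ball s d" for n y
  proof -
    have "\<bar>Re (s - y)\<bar> \<le> norm (s - y)" by (rule abs_Re_le_cmod)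
    then have y: "Re y + real m \<ge> 1 + d" using that by (simp add: dist_norm d_def field_simps)
    have "norm (powr_diff m y (of_real (real (Suc n)))) \<le> 
       norm (pochhammer y m) * real (Suc n) powr (- Re y - real m)"
      using y d by (intro norm_powr_diff_le) auto
    also have "\<dots> \<le> P * real (Suc n) powr - (1 + d)"
      using P(2)[of y] that y P(1) by (intro mult_mono powr_mono) auto
    finally have "norm (powr_diff m y (of_nat (Suc n))) \<le> P * real (Suc n) powr - (1 + d)"
      by simp
    then show ?thesis unfolding norm_mult h_def
      using B P by (intro mult_mono) auto
  qed
  ultimately show ?thesis using d by blast
qed

lemma 
  assumes a: "mean_zero_periodic q a"
  shows antidiff_series_summable: "Re s > 1 - real m \<Longrightarrow> 
      summable (\<lambda>n. (antidiff q ^^ m) a (int (Suc n)) * powr_diff m s (of_nat (Suc n)))"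
    and antidiff_series_holomorphic: "antidiff_series q a m holomorphic_on {s. Re s > 1 - real m}"
proof -
  let ?S = "{s. Re s > 1 - real m}"
  have S: "open ?S" by (rule open_halfspace_Re_gt)
  have hol: "(\<lambda>s. (antidiff q ^^ m) a (int (Suc n)) * powr_diff m s (of_nat (Suc n))) holomorphic_on ?S" for n
    by (intro holomorphic_intros holomorphic_powr_diff) auto
  note * = series_of_holomorphic[OF S hol antidiff_series_local_bound[OF a]]
  show "summable (\<lambda>n. (antidiff q ^^ m) a (int (Suc n)) * powr_diff m s (of_nat (Suc n)))"
    if "Re s > 1 - real m" using *(1)[of s] that by simp
  show "antidiff_series q a m holomorphic_on ?S"
    unfolding holomorphic_on_open[OF S] antidiff_series_def[abs_def] using *(3) by blast
qed

text \<open>Abel summation. The boundary term at infinity vanishes, because the antidifference is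
  bounded and the m-th difference of the power tends to 0 in this half-plane.\<close>

lemma antidiff_series_Suc:
  assumes a: "mean_zero_periodic q a" and s: "Re s > 1 - real m"
  shows "antidiff_series q a m s = - (antidiff q ^^ Suc m) a 0 * powr_diff m s 1 - antidiff_series q a (Suc m) s"
proof -
  define b where "b = (antidiff q ^^ Suc m) a"
  define v where "v = (\<lambda>n. powr_diff m s (of_nat n))"
  have b: "(antidiff q ^^ m) a n = b n - b (n - 1)" for n
    using antidiff_diff[OF mean_zero_periodic_antidiff_pow[OF a]] by (simp add: b_def)
  obtain B where B: "B > 0" "\<And>n. norm (b n) \<le> B"
    using mean_zero_periodic_bounded[OF mean_zero_periodic_antidiff_pow[OF a]] unfolding b_def by metis
  have vdiff: "powr_diff (Suc m) s (of_nat (Suc n)) = v (Suc (Suc n)) - v (Suc n)" for n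
    by (simp add: v_def add_ac)
  have part: "(\<Sum>n<N. (antidiff q ^^ m) a (int (Suc n)) * v (Suc n)) = 
    b (int N) * v (Suc N) - b 0 * v 1 - (\<Sum>n<N. b (int (Suc n)) * (v (Suc (Suc n)) - v (Suc n)))" for N
    by (induction N) (auto simp: b algebra_simps)
  have "v \<longlonglongrightarrow> 0"
  proof (rule Lim_null_comparison)
    show "\<forall>\<^sub>F n in sequentially. norm (v n) \<le> norm (pochhammer s m) * real n powr (- (Re s + real m))"
      using eventually_gt_at_top[of 0]
    proof eventually_elim
      case (elim n)
      then show ?case using norm_powr_diff_le[of "real n" s m] s by (simp add: v_def)
    qed
    show "(\<lambda>n. norm (pochhammer s m) * real n powr (- (Re s + real m))) \<longlonglongrightarrow> 0"
      using s by (intro tendsto_mult_right_zero tendsto_neg_powr filterlim_real_sequentially) auto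
  qed
  then have "(\<lambda>N. v (Suc N)) \<longlonglongrightarrow> 0" by (rule LIMSEQ_Suc)
  then have 1: "(\<lambda>N. b (int N) * v (Suc N)) \<longlonglongrightarrow> 0"
  proof (rule Lim_null_comparison[rotated, OF tendsto_mult_right_zero[OF tendsto_norm_zero]])
    show "\<forall>\<^sub>F N in sequentially. norm (b (int N) * v (Suc N)) \<le> B * norm (v (Suc N))"
      using B by (intro always_eventually allI) (auto simp: norm_mult intro!: mult_right_mono)
  qed
  have "summable (\<lambda>n. b (int (Suc n)) * powr_diff (Suc m) s (of_nat (Suc n)))"
    unfolding b_def using s by (intro antidiff_series_summable[OF a]) auto
  then have 2: "(\<lambda>N. \<Sum>n<N. b (int (Suc n)) * (v (Suc (Suc n)) - v (Suc n))) \<longlonglongrightarrow> antidiff_series q a (Suc m) s"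
    unfolding antidiff_series_def vdiff b_def[symmetric] by (intro summable_LIMSEQ) 
  have "(\<lambda>N. \<Sum>n<N. (antidiff q ^^ m) a (int (Suc n)) * v (Suc n)) \<longlonglongrightarrow> antidiff_series q a m s"
    using antidiff_series_summable[OF a s] unfolding antidiff_series_def v_def by (intro summable_LIMSEQ)
  moreover have "(\<lambda>N. \<Sum>n<N. (antidiff q ^^ m) a (int (Suc n)) * v (Suc n)) \<longlonglongrightarrow> 
      0 - b 0 * v 1 - antidiff_series q a (Suc m) s"
    unfolding part by (intro tendsto_diff tendsto_const 1 2)
  ultimately have "antidiff_series q a m s = 0 - b 0 * v 1 - antidiff_series q a (Suc m) s"
    by (rule LIMSEQ_unique)
  then show ?thesis by (simp add: b_def v_def)
qed

lemma periodic_L_partial_Suc: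
  assumes a: "mean_zero_periodic q a" and s: "Re s > 1 - real m"
  shows "periodic_L_partial q a (Suc m) s = periodic_L_partial q a m s"
  unfolding periodic_L_partial_def antidiff_series_Suc[OF assms] by (simp add: algebra_simps)

lemma periodic_L_eq_partial:
  assumes a: "mean_zero_periodic q a" and s: "Re s > 1 - real m"
  shows "periodic_L q a s = periodic_L_partial q a m s"
proof -
  have *: "periodic_L_partial q a (k + j) s = periodic_L_partial q a k s" if "Re s > 1 - real k" for k j
  proof (induction j)
    case (Suc j)
    have "Re s > 1 - real (k + j)" using that by simp
    from periodic_L_partial_Suc[OF a this] Suc show ?case by simp
  qed simp
  define k where "k = Suc (nat \<lfloor>1 - Re s\<rfloor>)"
  have k: "Re s > 1 - real k" unfolding k_def by linarith
  have "periodic_L_partial q a k s = periodic_L_partial q a m s"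
    using *[OF k, of "m - k"] *[OF s, of "k - m"] by (cases "k \<le> m") auto
  then show ?thesis by (simp add: periodic_L_def k_def)
qed

lemma periodic_L_holomorphic:
  assumes a: "mean_zero_periodic q a"
  shows "periodic_L q a holomorphic_on S"
proof -
  have "periodic_L q a holomorphic_on UNIV"
    unfolding holomorphic_on_open[OF open_UNIV]
  proof safe
    fix s
    define m where "m = Suc (nat \<lfloor>1 - Re s\<rfloor>)"
    have s: "s \<in> {s. Re s > 1 - real m}" unfolding m_def by simp linarith
    have op: "open {s. Re s > 1 - real m}" by (rule open_halfspace_Re_gt)
    have "periodic_L_partial q a m holomorphic_on {s. Re s > 1 - real m}"
      unfolding periodic_L_partial_def[abs_def]
      by (intro holomorphic_intros antidiff_series_holomorphic[OF a] holomorphic_powr_diff) auto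
    then have "periodic_L q a holomorphic_on {s. Re s > 1 - real m}"
      by (rule holomorphic_transform) (use periodic_L_eq_partial[OF a] in auto)
    then show "\<exists>f'. (periodic_L q a has_field_derivative f') (at s)"
      using s unfolding holomorphic_on_open[OF op] by blast
  qed
  then show ?thesis by (rule holomorphic_on_subset) auto
qed

lemma periodic_L_eq_series:
  assumes a: "mean_zero_periodic q a" and s: "Re s > 1"
  shows "periodic_L q a s = (\<Sum>n. a (int (Suc n)) * of_nat (Suc n) powr - s)"
  using periodic_L_eq_partial[OF a, of 0 s] s
  by (simp add: periodic_L_partial_def antidiff_series_def)

text \<open>At s = 0 the power is constant, so its differences vanish and only the boundary term
  with b(0) survives, b being the antidifference. Now b(-1) = -b(0) by parity, while b(0) - b(-1) =
  a(0) = 0. Two summations are needed to reach Re s = 0.\<close>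

lemma periodic_L_even_zero:
  assumes a: "mean_zero_periodic q a" and even: "\<And>n. a (- n) = a n" and a0: "a 0 = 0"
  shows "periodic_L q a 0 = 0"
proof -
  have 1: "powr_diff 1 0 (of_nat (Suc n)) = 0" for n
  proof -
    have p: "powr_diff 0 0 (of_nat (Suc k)) = 1" for k by (simp del: of_nat_Suc)
    have e: "of_nat (Suc n) + 1 = (of_nat (Suc (Suc n)) :: complex)" by simp
    show ?thesis unfolding One_nat_def powr_diff.simps(2) e p by simp
  qed
  have 2: "powr_diff 2 0 (of_nat (Suc n)) = 0" for n
  proof -
    have e: "of_nat (Suc n) + 1 = (of_nat (Suc (Suc n)) :: complex)" by simp
    show ?thesis unfolding numeral_2_eq_2 powr_diff.simps(2)[of "Suc 0"] e 1[unfolded One_nat_def] by simp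
  qed
  have s2: "antidiff_series q a 2 0 = 0" by (simp only: antidiff_series_def 2) simp
  have "antidiff q a 0 = 0"
    using antidiff_even[OF a even, of 0] antidiff_diff[OF a, of 0] a0 by simp
  then show ?thesis
    using periodic_L_eq_partial[OF a, of 2 0] 1[of 0] s2
    by (simp add: periodic_L_partial_def lessThan_Suc numeral_2_eq_2 del: powr_diff.simps)
qed

text \<open>At s = -1 the power is x itself, with first difference 1 and no further ones. What
  remains is c(0) - b(0), with b and c the first and second antidifference. Since c is odd about -1,
  c(-1) = 0, and c(0) - c(-1) = b(0) finishes the cancellation.\<close>

lemma periodic_L_odd_zero:
  assumes a: "mean_zero_periodic q a" and odd: "\<And>n. a (- n) = - a n"
  shows "periodic_L q a (- 1) = 0"
proof -
  have e: "of_nat (Suc n) + 1 = (of_nat (Suc (Suc n)) :: complex)" for n by simp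
  have p: "powr_diff 0 (- 1) (of_nat (Suc n)) = of_nat (Suc n)" for n
    by (simp del: of_nat_Suc)
  have p1: "powr_diff 1 (- 1) (of_nat (Suc n)) = 1" for n
    unfolding One_nat_def powr_diff.simps(2) e p by simp
  have p2: "powr_diff 2 (- 1) (of_nat (Suc n)) = 0" for n
    unfolding numeral_2_eq_2 powr_diff.simps(2)[of "Suc 0"] e p1[unfolded One_nat_def] by simp
  have p3: "powr_diff 3 (- 1) (of_nat (Suc n)) = 0" for n
    unfolding numeral_3_eq_3 powr_diff.simps(2)[of "Suc (Suc 0)"] e p2[unfolded numeral_2_eq_2] by simp
  have "antidiff q (antidiff q a) (- 1) = 0"
    using antidiff_antidiff_odd[OF a odd, of "- 1"] by simp
  moreover have "antidiff q (antidiff q a) 0 - antidiff q (antidiff q a) (- 1) = antidiff q a 0"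
    using antidiff_diff[OF mean_zero_periodic_antidiff[OF a], of 0] by simp
  moreover have "antidiff_series q a 3 (- 1) = 0" by (simp only: antidiff_series_def p3) simp
  ultimately show ?thesis
    using periodic_L_eq_partial[OF a, of 3 "- 1"] p[of 0] p1[of 0] p2[of 0]
    by (simp add: periodic_L_partial_def lessThan_Suc numeral_3_eq_3 numeral_2_eq_2 del: powr_diff.simps)
qed

text \<open>In this disc Re s \<ge> -1/2, so two summations by parts already converge, with terms
  O(n^(-3/2)). Each antidifference costs a factor 2q, hence q^2. The number 25 bounds |s (s + 1)|
  via 9/2 times 11/2. The disc is the one of radius 5/4 doubled, as the local factorization
  asks.\<close>

lemma periodic_L_growth:
  "\<exists>C>0. \<forall>q a s. mean_zero_periodic q a \<longrightarrow> (\<forall>n. norm (a n) \<le> 1) \<longrightarrow> s \<in> cball 2 (5/2) \<longrightarrow> 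
      norm (periodic_L q a s) \<le> C * real q ^ 2"
proof -
  define K where "K = (\<Sum>n. real (Suc n) powr - (3/2))"
  have K0: "K \<ge> 0" unfolding K_def by (intro suminf_nonneg summable_Suc_powr) auto
  show ?thesis
  proof (intro exI[of _ "20 + 100 * K"] conjI allI impI)
    show "20 + 100 * K > 0" using K0 by simp
    fix q a and s :: complex
    assume a: "mean_zero_periodic q a" and "\<forall>n. norm (a n) \<le> 1" and s: "s \<in> cball 2 (5/2)"
    then have a1: "norm (a n) \<le> 1" for n by simp
    have q: "q > 0" using a by (simp add: mean_zero_periodic_def)
    have A1: "norm (antidiff q a n) \<le> 2 * real q" for n
      using norm_antidiff_le[OF q a1] by simp
    have A2: "norm (antidiff q (antidiff q a) n) \<le> 4 * real q ^ 2" for n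
      using norm_antidiff_le[OF q A1] by (simp add: power2_eq_square)
    have "\<bar>Re (s - 2)\<bar> \<le> norm (s - 2)" by (rule abs_Re_le_cmod)
    moreover have d: "norm (s - 2) \<le> 5/2" using s by (simp add: dist_norm norm_minus_commute)
    ultimately have Re: "Re s \<ge> - 1 / 2" by simp
    have ns: "norm s \<le> 9/2" "norm (s + 1) \<le> 11/2"
      using d norm_triangle_ineq[of "s - 2" 2] norm_triangle_ineq[of "s - 2" 3] by (auto simp: algebra_simps)
    have "norm s * norm (s + 1) \<le> 9/2 * (11/2)" using ns by (intro mult_mono) auto
    then have poch: "norm (pochhammer s 2) \<le> 25"
      by (simp add: numeral_2_eq_2 pochhammer_Suc norm_mult)
    have "norm (powr_diff 1 s (of_real 1)) \<le> norm (pochhammer s 1) * 1 powr (- Re s - real 1)"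
      using Re by (intro norm_powr_diff_le) auto
    then have pd1: "norm (powr_diff 1 s 1) \<le> 9/2" using ns by simp
    have bound: "norm (antidiff q (antidiff q a) (int (Suc n)) * powr_diff 2 s (of_nat (Suc n))) \<le> 
       100 * real q ^ 2 * real (Suc n) powr - (3/2)" for n
    proof -
      have "norm (powr_diff 2 s (of_real (real (Suc n)))) \<le> norm (pochhammer s 2) * real (Suc n) powr (- Re s - real 2)"
        using Re by (intro norm_powr_diff_le) auto
      also have "\<dots> \<le> 25 * real (Suc n) powr - (3/2)"
      proof (intro mult_mono powr_mono poch)
        show "- Re s - real 2 \<le> - (3 / 2)" using Re by (simp add: field_simps)
      qed auto
      finally have "norm (powr_diff 2 s (of_nat (Suc n))) \<le> 25 * real (Suc n) powr - (3/2)" by simp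
      then have "norm (antidiff q (antidiff q a) (int (Suc n))) * norm (powr_diff 2 s (of_nat (Suc n))) \<le> 
         4 * real q ^ 2 * (25 * real (Suc n) powr - (3/2))"
        using A2 by (intro mult_mono) auto
      then show ?thesis by (simp add: norm_mult)
    qed
    have "norm (antidiff_series q a 2 s) \<le> (\<Sum>n. 100 * real q ^ 2 * real (Suc n) powr - (3/2))"
      unfolding antidiff_series_def
    proof (rule norm_suminf_le)
      show "norm ((antidiff q ^^ 2) a (int (Suc n)) * powr_diff 2 s (of_nat (Suc n)))
        \<le> 100 * real q ^ 2 * real (Suc n) powr - (3/2)" for n
        using bound[of n] by (simp only: numeral_2_eq_2 funpow.simps o_def id_def)
    qed (intro summable_mult summable_Suc_powr, simp)
    also have "\<dots> = 100 * real q ^ 2 * K"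
      unfolding K_def by (intro suminf_mult summable_Suc_powr) auto
    finally have S2: "norm (antidiff_series q a 2 s) \<le> 100 * real q ^ 2 * K" .
    have "periodic_L q a s = - antidiff q a 0 * powr_diff 0 s 1 + antidiff q (antidiff q a) 0 * powr_diff 1 s 1
        + antidiff_series q a 2 s"
      using periodic_L_eq_partial[OF a, of 2 s] Re
      by (simp add: periodic_L_partial_def numeral_2_eq_2)
    also have "norm \<dots> \<le> norm (antidiff q a 0) + norm (antidiff q (antidiff q a) 0) * norm (powr_diff 1 s 1) 
       + norm (antidiff_series q a 2 s)"
      by (rule norm_triangle_le, rule add_mono, rule norm_triangle_le) (auto simp: norm_mult)
    also have "\<dots> \<le> 2 * real q + 4 * real q ^ 2 * (9/2) + 100 * real q ^ 2 * K"
      using A1 A2 pd1 S2 by (intro add_mono mult_mono) auto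
    also have "\<dots> \<le> 2 * real q ^ 2 + 4 * real q ^ 2 * (9/2) + 100 * real q ^ 2 * K"
      using q by (simp add: power2_eq_square)
    finally show "norm (periodic_L q a s) \<le> (20 + 100 * K) * real q ^ 2"
      by (simp add: algebra_simps)
  qed
qed

section \<open>Dirichlet series with completely multiplicative coefficients\<close>

definition dirichlet_series :: "(nat \<Rightarrow> complex) \<Rightarrow> complex \<Rightarrow> complex" where
  "dirichlet_series b s = (\<Sum>n. b (Suc n) * of_nat (Suc n) powr - s)"

text \<open>A majorant shared by completely multiplicative coefficients of norm at most 1, by their
  products with the von Mangoldt function, and by ln n itself.\<close>

definition log_bounded :: "(nat \<Rightarrow> complex) \<Rightarrow> bool" where
  "log_bounded b \<longleftrightarrow> (\<forall>n>0. norm (b n) \<le> 1 + ln (real n))"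

lemma one_plus_ln_le_powr:
  fixes x \<epsilon> :: real
  assumes "x \<ge> 1" "\<epsilon> > 0"
  shows "1 + ln x \<le> (1 + 2 / \<epsilon>) * x powr (\<epsilon> / 2)"
proof -
  have "ln (x powr (\<epsilon> / 2)) \<le> x powr (\<epsilon> / 2) - 1"
    using assms by (intro ln_le_minus_one) auto
  then have "\<epsilon> / 2 * ln x \<le> x powr (\<epsilon> / 2)" using assms by (simp add: ln_powr)
  then have "ln x \<le> 2 / \<epsilon> * x powr (\<epsilon> / 2)" using assms by (simp add: field_simps)
  moreover have "1 \<le> x powr (\<epsilon> / 2)" using assms by (intro ge_one_powr_ge_zero) auto
  ultimately show ?thesis by (simp add: algebra_simps)
qed

lemma dirichlet_series_term_bound:
  assumes b: "log_bounded b" and \<epsilon>: "\<epsilon> > 0" "Re s \<ge> 1 + \<epsilon>"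
  shows "norm (b (Suc n) * of_nat (Suc n) powr - s) \<le> (1 + 2 / \<epsilon>) * real (Suc n) powr - (1 + \<epsilon> / 2)"
proof -
  have "norm (of_real (real (Suc n)) powr - s) = real (Suc n) powr - Re s"
    by (subst norm_powr_real_powr) auto
  then have "norm (b (Suc n) * of_nat (Suc n) powr - s) = norm (b (Suc n)) * real (Suc n) powr - Re s"
    by (simp add: norm_mult)
  also have "\<dots> \<le> (1 + ln (real (Suc n))) * real (Suc n) powr - (1 + \<epsilon>)"
  proof (rule mult_mono)
    show "norm (b (Suc n)) \<le> 1 + ln (real (Suc n))" using b by (simp add: log_bounded_def del: of_nat_Suc)
    show "real (Suc n) powr - Re s \<le> real (Suc n) powr - (1 + \<epsilon>)" using \<epsilon> by (intro powr_mono) auto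
  qed (auto simp del: of_nat_Suc)
  also have "\<dots> \<le> (1 + 2 / \<epsilon>) * real (Suc n) powr (\<epsilon> / 2) * real (Suc n) powr - (1 + \<epsilon>)"
    using \<epsilon> by (intro mult_right_mono one_plus_ln_le_powr) auto
  also have "\<dots> = (1 + 2 / \<epsilon>) * real (Suc n) powr (\<epsilon> / 2 + - (1 + \<epsilon>))"
    unfolding powr_add by simp
  also have "\<epsilon> / 2 + - (1 + \<epsilon>) = - (1 + \<epsilon> / 2)" by simp
  finally show ?thesis .
qed

lemma dirichlet_series_norm_summable:
  assumes b: "log_bounded b" and s: "Re s > 1"
  shows "summable (\<lambda>n. norm (b (Suc n) * of_nat (Suc n) powr - s))"
proof (rule summable_comparison_test')
  define \<epsilon> where "\<epsilon> = Re s - 1"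
  show "summable (\<lambda>n. (1 + 2 / \<epsilon>) * real (Suc n) powr - (1 + \<epsilon> / 2))"
    using s by (intro summable_mult summable_Suc_powr) (auto simp: \<epsilon>_def)
  show "norm (norm (b (Suc n) * of_nat (Suc n) powr - s)) \<le> (1 + 2 / \<epsilon>) * real (Suc n) powr - (1 + \<epsilon> / 2)"
    if "n \<ge> 0" for n
    using dirichlet_series_term_bound[OF b, of \<epsilon> s n] s by (simp add: \<epsilon>_def)
qed

lemmas dirichlet_series_summable = summable_norm_cancel[OF dirichlet_series_norm_summable]

lemma dirichlet_series_has_derivative:
  assumes b: "log_bounded b" and s: "Re s > 1"
  shows "(dirichlet_series b has_field_derivative - dirichlet_series (\<lambda>n. of_real (ln (real n)) * b n) s) (at s)"
    and "summable (\<lambda>n. of_real (ln (real (Suc n))) * b (Suc n) * of_nat (Suc n) powr - s)"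
proof -
  let ?S = "{s. Re s > 1}"
  let ?f = "\<lambda>n s. b (Suc n) * of_nat (Suc n) powr - s"
  have S: "open ?S" by (rule open_halfspace_Re_gt)
  have hol: "?f n holomorphic_on ?S" for n by (intro holomorphic_intros)
  have bound: "\<exists>d>0. \<exists>h. summable h \<and> (\<forall>n. \<forall>y\<in>ball x d \<inter> ?S. norm (?f n y) \<le> h n)" if x: "x \<in> ?S" for x
  proof -
    define \<epsilon> where "\<epsilon> = (Re x - 1) / 2"
    have \<epsilon>: "\<epsilon> > 0" using x by (simp add: \<epsilon>_def)
    have "norm (?f n y) \<le> (1 + 2 / \<epsilon>) * real (Suc n) powr - (1 + \<epsilon> / 2)" if "y \<in> ball x \<epsilon>" for n y
    proof (rule dirichlet_series_term_bound[OF b \<epsilon>])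
      have "\<bar>Re (x - y)\<bar> \<le> norm (x - y)" by (rule abs_Re_le_cmod)
      also have "\<dots> < \<epsilon>" using that by (simp add: dist_norm)
      finally have "Re x - Re y \<le> \<epsilon>" by (simp add: abs_less_iff)
      then show "1 + \<epsilon> \<le> Re y" unfolding \<epsilon>_def by (simp add: field_simps)
    qed
    moreover have "summable (\<lambda>n. (1 + 2 / \<epsilon>) * real (Suc n) powr - (1 + \<epsilon> / 2))"
      using \<epsilon> by (intro summable_mult summable_Suc_powr) auto
    ultimately show ?thesis using \<epsilon> by blast
  qed
  have d: "deriv (?f n) s = - (of_real (ln (real (Suc n))) * b (Suc n) * of_nat (Suc n) powr - s)" for n s
  proof (rule DERIV_imp_deriv)
    have "of_nat (Suc n) \<noteq> (0 :: complex)" by (simp del: of_nat_Suc)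
    moreover have "ln (of_nat (Suc n)) = complex_of_real (ln (real (Suc n)))"
      by (subst Ln_of_real[symmetric]) auto
    ultimately have e: "of_nat (Suc n) powr - s = exp (- s * complex_of_real (ln (real (Suc n))))" for s
      by (simp add: powr_def del: of_nat_Suc)
    show "(?f n has_field_derivative 
       - (of_real (ln (real (Suc n))) * b (Suc n) * of_nat (Suc n) powr - s)) (at s)"
      unfolding e by (auto intro!: derivative_eq_intros simp del: of_nat_Suc)
  qed
  note * = series_of_holomorphic[OF S hol bound, of s]
  show sm: "summable (\<lambda>n. of_real (ln (real (Suc n))) * b (Suc n) * of_nat (Suc n) powr - s)"
    using *(2) s unfolding d by (simp only: summable_minus_iff mem_Collect_eq)
  show "(dirichlet_series b has_field_derivative - dirichlet_series (\<lambda>n. of_real (ln (real n)) * b n) s) (at s)"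
    using *(3) s sm unfolding d dirichlet_series_def[abs_def]
    by (simp only: suminf_minus mem_Collect_eq)
qed

lemma dirichlet_series_convolution:
  assumes b: "log_bounded b" and c: "log_bounded c" and s: "Re s > 1"
  shows "dirichlet_series b s * dirichlet_series c s = 
     dirichlet_series (\<lambda>n. \<Sum>d | d dvd n. b d * c (n div d)) s"
proof -
  define B where "B = (\<lambda>n. b (Suc n) * of_nat (Suc n) powr - s)"
  define C where "C = (\<lambda>n. c (Suc n) * of_nat (Suc n) powr - s)"
  have sB: "summable (\<lambda>n. norm (B n))" and sC: "summable (\<lambda>n. norm (C n))"
    unfolding B_def C_def by (intro dirichlet_series_norm_summable b c s)+
  have hB: "(B has_sum dirichlet_series b s) UNIV" and hC: "(C has_sum dirichlet_series c s) UNIV"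
    using norm_summable_imp_has_sum[OF sB] norm_summable_imp_has_sum[OF sC]
      summable_sums[OF summable_norm_cancel[OF sB]] summable_sums[OF summable_norm_cancel[OF sC]]
    unfolding B_def C_def dirichlet_series_def by blast+
  have aB: "(\<lambda>n. norm (B n)) summable_on UNIV" and aC: "(\<lambda>n. norm (C n)) summable_on UNIV"
    using sB sC by (auto intro!: norm_summable_imp_summable_on)
  have "(\<lambda>p. norm (case p of (m, n) \<Rightarrow> B m * C n)) summable_on UNIV \<times> UNIV"
  proof (rule summable_on_SigmaI[where g = "\<lambda>m. norm (B m) * (\<Sum>\<^sub>\<infinity>n. norm (C n))"])
    show "((\<lambda>n. norm (case (m, n) of (m, n) \<Rightarrow> B m * C n)) has_sum norm (B m) * (\<Sum>\<^sub>\<infinity>n. norm (C n))) UNIV" for m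
      unfolding prod.case norm_mult using aC by (intro has_sum_cmult_right has_sum_infsum)
    show "(\<lambda>m. norm (B m) * (\<Sum>\<^sub>\<infinity>n. norm (C n))) summable_on UNIV"
      using aB by (rule summable_on_cmult_left)
  qed auto
  then have "(\<lambda>(m, n). B m * C n) summable_on UNIV \<times> UNIV"
    by (rule abs_summable_summable)
  then have "((\<lambda>(m, n). B m * C n) has_sum dirichlet_series b s * dirichlet_series c s) (UNIV \<times> UNIV)"
    using has_sum_cmult_right[OF hC] has_sum_cmult_left[OF hB]
    by (intro has_sum_SigmaI[where g = "\<lambda>m. B m * dirichlet_series c s"]) auto
  \<comment> \<open>Index n stands for the integer n + 1: a pair of factors goes to their product,
    stored minus one, together with the first factor, stored as it is.\<close>
  also have "?this \<longleftrightarrow> ((\<lambda>(n, d). b d * c (Suc n div d) * of_nat (Suc n) powr - s) 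
      has_sum dirichlet_series b s * dirichlet_series c s) (SIGMA n:UNIV. {d. d dvd Suc n})"
  proof (rule has_sum_reindex_bij_witness[where i = "\<lambda>(n, d). (d - 1, Suc n div d - 1)" 
        and j = "\<lambda>(m, n). (Suc m * Suc n - 1, Suc m)"])
    fix p :: "nat \<times> nat" assume "p \<in> UNIV \<times> UNIV"
    obtain m n where p: "p = (m, n)" by force
    have "of_nat (Suc m * Suc n) powr - s = (of_nat (Suc m) powr - s) * (of_nat (Suc n) powr - s :: complex)"
      unfolding of_nat_mult by (rule powr_times_real) (auto simp del: of_nat_Suc)
    moreover have "Suc (Suc m * Suc n - 1) = Suc m * Suc n" by simp
    moreover have "Suc m * Suc n div Suc m = Suc n" by (rule nonzero_mult_div_cancel_left) simp
    ultimately show "(case (case p of (m, n) \<Rightarrow> (Suc m * Suc n - 1, Suc m)) of 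
        (n, d) \<Rightarrow> b d * c (Suc n div d) * of_nat (Suc n) powr - s) = (case p of (m, n) \<Rightarrow> B m * C n)"
      unfolding p prod.case B_def C_def by (simp only: mult_ac)
    have "Suc m * Suc n div Suc m - 1 = n" unfolding \<open>Suc m * Suc n div Suc m = Suc n\<close> by simp
    then show "(case (case p of (m, n) \<Rightarrow> (Suc m * Suc n - 1, Suc m)) of (n, d) \<Rightarrow> (d - 1, Suc n div d - 1)) = p"
      unfolding p prod.case \<open>Suc (Suc m * Suc n - 1) = Suc m * Suc n\<close> by simp
    show "(case p of (m, n) \<Rightarrow> (Suc m * Suc n - 1, Suc m)) \<in> (SIGMA n:UNIV. {d. d dvd Suc n})"
      unfolding p prod.case mem_Sigma_iff \<open>Suc (Suc m * Suc n - 1) = Suc m * Suc n\<close> mem_Collect_eq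
      by (intro conjI UNIV_I dvd_triv_left)
  next
    fix p :: "nat \<times> nat" assume "p \<in> (SIGMA n:UNIV. {d. d dvd Suc n})"
    then obtain n d where p: "p = (n, d)" and d: "d dvd Suc n" by auto
    have "d > 0" using d by (intro Nat.gr0I) auto
    have "Suc n div d > 0" using d \<open>d > 0\<close> by (simp add: dvd_imp_le div_greater_zero_iff)
    have "Suc (d - 1) * Suc (Suc n div d - 1) = Suc n"
      using \<open>d > 0\<close> \<open>Suc n div d > 0\<close> d by simp
    then show "(case (case p of (n, d) \<Rightarrow> (d - 1, Suc n div d - 1)) of (m, n) \<Rightarrow> (Suc m * Suc n - 1, Suc m)) = p"
      unfolding p prod.case using \<open>d > 0\<close> by simp
  qed auto
  finally have "((\<lambda>n. \<Sum>d | d dvd Suc n. b d * c (Suc n div d) * of_nat (Suc n) powr - s) 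
     has_sum dirichlet_series b s * dirichlet_series c s) UNIV"
    by (rule has_sum_SigmaD) (auto intro!: has_sum_finite finite_divisors_nat)
  then have "(\<lambda>n. \<Sum>d | d dvd Suc n. b d * c (Suc n div d) * of_nat (Suc n) powr - s) sums
     (dirichlet_series b s * dirichlet_series c s)"
    by (rule has_sum_imp_sums)
  then show ?thesis
    by (simp add: dirichlet_series_def sums_iff sum_distrib_right)
qed

section \<open>Logarithmic derivatives through the von Mangoldt function\<close>

definition completely_multiplicative :: "(nat \<Rightarrow> complex) \<Rightarrow> bool" where
  "completely_multiplicative a \<longleftrightarrow> a 1 = 1 \<and> (\<forall>m n. a (m * n) = a m * a n) \<and> (\<forall>n. norm (a n) \<le> 1)"

definition twisted_mangoldt :: "(nat \<Rightarrow> complex) \<Rightarrow> nat \<Rightarrow> complex" where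
  "twisted_mangoldt a n = mangoldt n * a n"

lemma log_bounded_completely_multiplicative: 
  assumes "completely_multiplicative a" shows "log_bounded a"
  unfolding log_bounded_def
proof (intro allI impI)
  fix n :: nat assume "n > 0"
  then have "1 \<le> 1 + ln (real n)" by simp
  moreover have "norm (a n) \<le> 1" using assms by (simp add: completely_multiplicative_def)
  ultimately show "norm (a n) \<le> 1 + ln (real n)" by linarith
qed

lemma log_bounded_twisted_mangoldt:
  assumes "completely_multiplicative a" shows "log_bounded (twisted_mangoldt a)"
  unfolding log_bounded_def
proof (intro allI impI)
  fix n :: nat assume n: "n > 0"
  have "norm (twisted_mangoldt a n) \<le> mangoldt n * 1"
    unfolding twisted_mangoldt_def norm_mult norm_mangoldt
    using assms by (intro mult_left_mono) (auto simp: completely_multiplicative_def mangoldt_nonneg)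
  also have "\<dots> \<le> 1 + ln (real n)" using mangoldt_le[OF n] by simp
  finally show "norm (twisted_mangoldt a n) \<le> 1 + ln (real n)" .
qed

text \<open>Complete multiplicativity lets \<open>a\<close> pass through the convolution, which
  reduces the claim to the divisor sum of the von Mangoldt function being the logarithm. The
  right-hand side is minus the derivative of the series of \<open>a\<close>.\<close>

lemma dirichlet_series_mult_mangoldt:
  assumes a: "completely_multiplicative a" and s: "Re s > 1"
  shows "dirichlet_series a s * dirichlet_series (twisted_mangoldt a) s = 
     dirichlet_series (\<lambda>n. of_real (ln (real n)) * a n) s"
proof -
  have "(\<Sum>d | d dvd n. twisted_mangoldt a d * a (n div d)) = of_real (ln (real n)) * a n" if n: "n > 0" for n
  proof -
    have "twisted_mangoldt a d * a (n div d) = mangoldt d * a n" if "d dvd n" for d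
    proof -
      have "a d * a (n div d) = a n"
        using a that by (metis completely_multiplicative_def dvd_mult_div_cancel)
      then show ?thesis by (simp add: twisted_mangoldt_def mult.assoc)
    qed
    then have "(\<Sum>d | d dvd n. twisted_mangoldt a d * a (n div d)) = (\<Sum>d | d dvd n. mangoldt d * a n)"
      by (intro sum.cong) auto
    also have "\<dots> = of_real (ln (real n)) * a n"
      using mangoldt_sum[of n, where 'a = complex] n by (simp flip: sum_distrib_right)
    finally show ?thesis .
  qed
  then show ?thesis
    using dirichlet_series_convolution[OF log_bounded_twisted_mangoldt[OF a] log_bounded_completely_multiplicative[OF a] s]
    by (simp add: dirichlet_series_def mult.commute)
qed

lemma dirichlet_series_log_deriv:
  assumes a: "completely_multiplicative a" and s: "Re s > 1"
  shows "(dirichlet_series a has_field_derivative 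
     dirichlet_series a s * - dirichlet_series (twisted_mangoldt a) s) (at s)"
  using dirichlet_series_has_derivative[OF log_bounded_completely_multiplicative[OF a] s]
    dirichlet_series_mult_mangoldt[OF a s] by simp

text \<open>Equal to -\<zeta>'/\<zeta> at x > 1; it majorizes the logarithmic derivative of every
  completely multiplicative series on the line Re s = x.\<close>

definition mangoldt_series :: "real \<Rightarrow> real" where
  "mangoldt_series x = (\<Sum>n. mangoldt (Suc n) * real (Suc n) powr - x)"

lemma norm_of_nat_powr: "norm (of_nat (Suc n) powr s) = real (Suc n) powr Re s"
  using norm_powr_real_powr[of "of_nat (Suc n)" s] by simp

lemma of_nat_powr_of_real: "of_nat (Suc n) powr - complex_of_real x = of_real (real (Suc n) powr - x)"
  using powr_of_real[of "real (Suc n)" "- x"] by (simp del: of_nat_Suc)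

lemma completely_multiplicative_one: "completely_multiplicative (\<lambda>_. 1)"
  by (simp add: completely_multiplicative_def)

lemma mangoldt_series_summable:
  assumes "x > 1"
  shows "summable (\<lambda>n. mangoldt (Suc n) * real (Suc n) powr - x)"
  using dirichlet_series_norm_summable[OF log_bounded_twisted_mangoldt[OF completely_multiplicative_one], of "of_real x"] assms
  by (simp add: twisted_mangoldt_def norm_mult norm_of_nat_powr del: of_nat_Suc)

lemma dirichlet_series_mangoldt_one:
  assumes "x > 1"
  shows "dirichlet_series (twisted_mangoldt (\<lambda>_. 1)) (of_real x) = of_real (mangoldt_series x)"
proof -
  have "of_real (mangoldt_series x) = (\<Sum>n. complex_of_real (mangoldt (Suc n) * real (Suc n) powr - x))"
    unfolding mangoldt_series_def by (rule suminf_of_real[OF mangoldt_series_summable[OF assms]])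
  then show ?thesis
    by (simp add: dirichlet_series_def twisted_mangoldt_def of_nat_powr_of_real del: of_nat_Suc)
qed

lemma norm_dirichlet_series_mangoldt_le:
  assumes a: "completely_multiplicative a" and s: "Re s > 1"
  shows "norm (dirichlet_series (twisted_mangoldt a) s) \<le> mangoldt_series (Re s)"
  unfolding dirichlet_series_def mangoldt_series_def
proof (rule norm_suminf_le)
  fix n
  show "norm (twisted_mangoldt a (Suc n) * of_nat (Suc n) powr - s) \<le> mangoldt (Suc n) * real (Suc n) powr - Re s"
    using a by (auto simp: twisted_mangoldt_def norm_mult norm_of_nat_powr completely_multiplicative_def mangoldt_nonneg
        intro!: mult_right_mono mult_left_le simp del: of_nat_Suc)
qed (rule mangoldt_series_summable[OF s])

lemma mangoldt_series_antimono:
  assumes "1 < x" "x \<le> y" shows "mangoldt_series y \<le> mangoldt_series x"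
  unfolding mangoldt_series_def using assms
  by (intro suminf_le mult_left_mono powr_mono mangoldt_series_summable mangoldt_nonneg) auto

section \<open>Bounds to the right of 1 by comparison with the zeta function\<close>

definition real_zeta :: "real \<Rightarrow> real" where
  "real_zeta x = (\<Sum>n. real (Suc n) powr - x)"

text \<open>The middle quantity is the integral of t^(-1-\<epsilon>) over [x, x + 1], compared with
  the endpoint values by the mean value theorem. It telescopes over the integers, which yields the
  integral test for \<open>real_zeta\<close>.\<close>

lemma powr_neg_diff_bounds:
  fixes \<epsilon> x :: real
  assumes "\<epsilon> > 0" "x > 0"
  shows "(x + 1) powr - (1 + \<epsilon>) \<le> (x powr - \<epsilon> - (x + 1) powr - \<epsilon>) / \<epsilon>"
    and "(x powr - \<epsilon> - (x + 1) powr - \<epsilon>) / \<epsilon> \<le> x powr - (1 + \<epsilon>)"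
proof -
  have "\<exists>z. x < z \<and> z < x + 1 \<and> (x + 1) powr - \<epsilon> - x powr - \<epsilon> = (x + 1 - x) * (- \<epsilon> * z powr (- \<epsilon> - 1))"
  proof (rule MVT2)
    fix z assume "x \<le> z"
    then show "((\<lambda>z. z powr - \<epsilon>) has_field_derivative - \<epsilon> * z powr (- \<epsilon> - 1)) (at z)"
      using assms by (auto intro!: derivative_eq_intros)
  qed simp
  then obtain z where z: "x < z" "z < x + 1" "(x + 1) powr - \<epsilon> - x powr - \<epsilon> = - \<epsilon> * z powr (- \<epsilon> - 1)" by auto
  then have eq: "(x powr - \<epsilon> - (x + 1) powr - \<epsilon>) / \<epsilon> = z powr - (1 + \<epsilon>)"
    using assms by (simp add: field_simps minus_diff_commute)
  show "(x + 1) powr - (1 + \<epsilon>) \<le> (x powr - \<epsilon> - (x + 1) powr - \<epsilon>) / \<epsilon>"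
    unfolding eq using z assms by (intro powr_mono2') auto
  show "(x powr - \<epsilon> - (x + 1) powr - \<epsilon>) / \<epsilon> \<le> x powr - (1 + \<epsilon>)"
    unfolding eq using z assms by (intro powr_mono2') auto
qed

lemma real_zeta_bounds:
  assumes \<epsilon>: "\<epsilon> > 0"
  shows "1 / \<epsilon> \<le> real_zeta (1 + \<epsilon>)" "real_zeta (1 + \<epsilon>) \<le> 1 + 1 / \<epsilon>"
proof -
  let ?g = "\<lambda>n. real (Suc n) powr - \<epsilon>"
  have sm: "summable (\<lambda>n. real (Suc n) powr - (1 + \<epsilon>))" using \<epsilon> by (intro summable_Suc_powr) auto
  have "(\<lambda>n. real n powr - \<epsilon>) \<longlonglongrightarrow> 0"
    using \<epsilon> by (intro tendsto_neg_powr filterlim_real_sequentially) auto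
  then have "?g \<longlonglongrightarrow> 0" by (rule LIMSEQ_Suc)
  from telescope_sums'[OF this] have tel: "(\<lambda>n. ?g n - ?g (Suc n)) sums 1" by simp
  then have tel': "(\<lambda>n. (?g n - ?g (Suc n)) / \<epsilon>) sums (1 / \<epsilon>)" by (rule sums_divide)
  have e: "real (Suc (Suc n)) = real (Suc n) + 1" for n by simp
  show "1 / \<epsilon> \<le> real_zeta (1 + \<epsilon>)"
    unfolding real_zeta_def using tel' powr_neg_diff_bounds(2)[OF \<epsilon>, of "real (Suc n)" for n]
    by (intro sums_le[OF _ tel' summable_sums[OF sm]]) (simp add: e)
  have "(\<lambda>n. real (Suc (Suc n)) powr - (1 + \<epsilon>)) sums (real_zeta (1 + \<epsilon>) - 1)"
    using sums_Suc_iff[of "\<lambda>n. real (Suc n) powr - (1 + \<epsilon>)" "real_zeta (1 + \<epsilon>) - 1"] summable_sums[OF sm]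
    by (simp add: real_zeta_def)
  then have "real_zeta (1 + \<epsilon>) - 1 \<le> 1 / \<epsilon>"
    using powr_neg_diff_bounds(1)[OF \<epsilon>, of "real (Suc n)" for n] 
    by (intro sums_le[OF _ _ tel']) (simp_all add: e)
  then show "real_zeta (1 + \<epsilon>) \<le> 1 + 1 / \<epsilon>" by simp
qed

lemma dirichlet_series_one: 
  assumes "x > 1" shows "dirichlet_series (\<lambda>_. 1) (of_real x) = of_real (real_zeta x)"
proof -
  have "of_real (real_zeta x) = (\<Sum>n. complex_of_real (real (Suc n) powr - x))"
    unfolding real_zeta_def by (rule suminf_of_real[OF summable_Suc_powr[OF assms]])
  then show ?thesis by (simp add: dirichlet_series_def of_nat_powr_of_real del: of_nat_Suc)
qed

text \<open>Multiplied by \<zeta>(1 + \<epsilon>) \<ge> 1/\<epsilon>, the series becomes the sum of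
  ln n * n^(-1-\<epsilon>). Half of \<epsilon> is spent on absorbing ln n, the other half on
  convergence, and each half costs a factor 1 + 2/\<epsilon>.\<close>

lemma mangoldt_series_le:
  assumes \<epsilon>: "\<epsilon> > 0"
  shows "mangoldt_series (1 + \<epsilon>) \<le> (1 + 2 / \<epsilon>)\<^sup>2 * \<epsilon>"
proof -
  let ?s = "complex_of_real (1 + \<epsilon>)"
  have s: "Re ?s > 1" using \<epsilon> by simp
  have "of_real (real_zeta (1 + \<epsilon>) * mangoldt_series (1 + \<epsilon>)) = 
     dirichlet_series (\<lambda>n. of_real (ln (real n)) * 1) ?s"
    using dirichlet_series_mult_mangoldt[OF completely_multiplicative_one s] \<epsilon>
    by (simp add: dirichlet_series_one dirichlet_series_mangoldt_one del: of_real_add)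
  from arg_cong[OF this, of norm]
  have "norm (dirichlet_series (\<lambda>n. of_real (ln (real n)) * 1) ?s) = 
      \<bar>real_zeta (1 + \<epsilon>) * mangoldt_series (1 + \<epsilon>)\<bar>"
    unfolding norm_of_real by (rule sym)
  then have "real_zeta (1 + \<epsilon>) * mangoldt_series (1 + \<epsilon>) \<le> norm (dirichlet_series (\<lambda>n. of_real (ln (real n))) ?s)"
    by (simp only: mult_1_right)
  also have "\<dots> \<le> (\<Sum>n. (1 + 2 / \<epsilon>) * real (Suc n) powr - (1 + \<epsilon> / 2))"
    unfolding dirichlet_series_def
  proof (rule norm_suminf_le)
    show "norm (complex_of_real (ln (real (Suc n))) * of_nat (Suc n) powr - ?s) \<le> 
       (1 + 2 / \<epsilon>) * real (Suc n) powr - (1 + \<epsilon> / 2)" for n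
      using \<epsilon> by (intro dirichlet_series_term_bound[of "\<lambda>n. complex_of_real (ln (real n))"]) (auto simp: log_bounded_def)
    show "summable (\<lambda>n. (1 + 2 / \<epsilon>) * real (Suc n) powr - (1 + \<epsilon> / 2))"
      using \<epsilon> by (intro summable_mult summable_Suc_powr) auto
  qed
  also have "\<dots> = (1 + 2 / \<epsilon>) * real_zeta (1 + \<epsilon> / 2)"
    unfolding real_zeta_def using \<epsilon> by (intro suminf_mult summable_Suc_powr) auto
  also have "\<dots> \<le> (1 + 2 / \<epsilon>) * (1 + 2 / \<epsilon>)"
    using real_zeta_bounds(2)[of "\<epsilon> / 2"] \<epsilon> by (intro mult_left_mono) (auto simp: add_nonneg_nonneg)
  finally have 1: "real_zeta (1 + \<epsilon>) * mangoldt_series (1 + \<epsilon>) \<le> (1 + 2 / \<epsilon>)\<^sup>2" by (simp add: power2_eq_square)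
  have "mangoldt_series (1 + \<epsilon>) \<ge> 0"
    unfolding mangoldt_series_def using \<epsilon> 
    by (intro suminf_nonneg mangoldt_series_summable mult_nonneg_nonneg mangoldt_nonneg) auto
  then have "1 / \<epsilon> * mangoldt_series (1 + \<epsilon>) \<le> (1 + 2 / \<epsilon>)\<^sup>2"
    using 1 real_zeta_bounds(1)[OF \<epsilon>] by (meson mult_right_mono order_trans)
  then show ?thesis using \<epsilon> by (simp add: field_simps)
qed

text \<open>The term n = 1 is 1, and the others add up to at most \<pi>^2/6 - 1 < 3/4 in
  norm.\<close>

lemma norm_dirichlet_series_ge:
  assumes a: "completely_multiplicative a" and s: "Re s \<ge> 2"
  shows "norm (dirichlet_series a s) \<ge> 1 / 4"
proof -
  have lb: "log_bounded a" by (rule log_bounded_completely_multiplicative[OF a])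
  have sm: "summable (\<lambda>n. a (Suc n) * of_nat (Suc n) powr - s)"
    using s by (intro dirichlet_series_summable lb) auto
  have zs: "(\<lambda>n. 1 / (real (Suc n))\<^sup>2) sums (pi\<^sup>2 / 6)" using inverse_squares_sums by simp
  then have zs1: "(\<lambda>n. 1 / (real (Suc (Suc n)))\<^sup>2) sums (pi\<^sup>2 / 6 - 1)"
    using sums_Suc_iff[of "\<lambda>n. 1 / (real (Suc n))\<^sup>2" "pi\<^sup>2 / 6 - 1"] by simp
  have "dirichlet_series a s - 1 = (\<Sum>n. a (Suc (Suc n)) * of_nat (Suc (Suc n)) powr - s)"
    using suminf_split_head[OF sm] a by (simp add: dirichlet_series_def completely_multiplicative_def)
  also have "norm \<dots> \<le> (\<Sum>n. 1 / (real (Suc (Suc n)))\<^sup>2)"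
  proof (rule norm_suminf_le)
    fix n
    have "norm (a (Suc (Suc n)) * of_nat (Suc (Suc n)) powr - s) \<le> 1 * real (Suc (Suc n)) powr - 2"
      unfolding norm_mult norm_of_nat_powr using a s
      by (intro mult_mono powr_mono) (auto simp: completely_multiplicative_def)
    also have "\<dots> = 1 / (real (Suc (Suc n)))\<^sup>2"
      by (simp add: powr_minus powr_numeral divide_inverse del: of_nat_Suc)
    finally show "norm (a (Suc (Suc n)) * of_nat (Suc (Suc n)) powr - s) \<le> 1 / (real (Suc (Suc n)))\<^sup>2" .
  qed (use zs1 in \<open>simp add: sums_iff\<close>)
  also have "\<dots> = pi\<^sup>2 / 6 - 1" using zs1 by (simp add: sums_iff)
  also have "\<dots> \<le> 3 / 4"
  proof -
    have "pi\<^sup>2 \<le> 3.2\<^sup>2" using pi_approx(2) by (intro power_mono) auto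
    then show ?thesis by (simp add: power2_eq_square)
  qed
  finally have "norm (dirichlet_series a s - 1) \<le> 3 / 4" .
  then show ?thesis using norm_triangle_ineq2[of 1 "1 - dirichlet_series a s"] by (simp add: norm_minus_commute)
qed

lemma inner_mult_self_complex: "w \<bullet> (w * z) = (w \<bullet> w) * Re z" for w z :: complex
  by (simp add: inner_complex_def algebra_simps)

text \<open>A Gronwall argument: |W|^2 exp(-2Kx) is nonincreasing. It turns a one-sided bound for
  the logarithmic derivative into one for the function, without choosing a logarithm, and stays
  meaningful if W has a zero.\<close>

lemma norm_log_derivative_growth:
  fixes W c :: "real \<Rightarrow> complex"
  assumes W: "\<And>x. x \<in> {u..v} \<Longrightarrow> (W has_vector_derivative W x * c x) (at x)"
    and c: "\<And>x. x \<in> {u..v} \<Longrightarrow> Re (c x) \<le> K" and uv: "u \<le> v"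
  shows "norm (W v) \<le> norm (W u) * exp (K * (v - u))"
proof -
  define g where "g = (\<lambda>x. (W x \<bullet> W x) * exp (- 2 * K * x))"
  have "g v \<le> g u"
  proof (rule DERIV_nonpos_imp_nonincreasing[OF uv])
    fix x assume x: "u \<le> x" "x \<le> v"
    have 1: "W x \<bullet> (W x * c x) + W x \<bullet> (W x * c x) = 2 * ((W x \<bullet> W x) * Re (c x))"
      by (simp only: inner_mult_self_complex mult_2)
    have "((\<lambda>x. W x \<bullet> W x) has_vector_derivative W x \<bullet> (W x * c x) + (W x * c x) \<bullet> W x) (at x)"
      using x by (intro bounded_bilinear.has_vector_derivative[OF bounded_bilinear_inner] W) auto
    then have "((\<lambda>x. W x \<bullet> W x) has_real_derivative 2 * ((W x \<bullet> W x) * Re (c x))) (at x)"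
      unfolding has_real_derivative_iff_has_vector_derivative inner_commute[of "W x * c x"] 1 .
    moreover have "((\<lambda>x. exp (- 2 * K * x)) has_real_derivative exp (- 2 * K * x) * (- 2 * K)) (at x)"
      by (auto intro!: derivative_eq_intros)
    ultimately have "(g has_real_derivative 2 * ((W x \<bullet> W x) * Re (c x)) * exp (- 2 * K * x) + 
        exp (- 2 * K * x) * (- 2 * K) * (W x \<bullet> W x)) (at x)"
      unfolding g_def by (rule DERIV_mult)
    moreover have "2 * ((W x \<bullet> W x) * Re (c x)) * exp (- 2 * K * x) + exp (- 2 * K * x) * (- 2 * K) * (W x \<bullet> W x)
       = 2 * (W x \<bullet> W x) * exp (- 2 * K * x) * (Re (c x) - K)"
      by (simp add: algebra_simps)
    moreover have "2 * (W x \<bullet> W x) * exp (- 2 * K * x) * (Re (c x) - K) \<le> 0"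
      using c[of x] x by (intro mult_nonneg_nonpos) auto
    ultimately show "\<exists>y. (g has_real_derivative y) (at x) \<and> y \<le> 0" by metis
  qed
  then have "(norm (W v))\<^sup>2 * exp (- 2 * K * v) \<le> (norm (W u))\<^sup>2 * exp (- 2 * K * u)"
    by (simp add: g_def dot_square_norm)
  then have "(norm (W v))\<^sup>2 \<le> (norm (W u))\<^sup>2 * (exp (- 2 * K * u) / exp (- 2 * K * v))"
    by (simp add: pos_le_divide_eq)
  also have "exp (- 2 * K * u) / exp (- 2 * K * v) = exp (2 * (K * (v - u)))"
    by (simp add: exp_diff[symmetric] algebra_simps)
  also have "\<dots> = (exp (K * (v - u)))\<^sup>2" by (rule exp_double)
  finally have "(norm (W v))\<^sup>2 \<le> (norm (W u) * exp (K * (v - u)))\<^sup>2" by (simp add: power_mult_distrib)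
  then show ?thesis by (rule power2_le_imp_le) auto
qed

lemma dirichlet_series_horizontal_derivative:
  assumes a: "completely_multiplicative a" and x: "x > 1"
  shows "((\<lambda>x. dirichlet_series a (Complex x t)) has_vector_derivative 
      dirichlet_series a (Complex x t) * - dirichlet_series (twisted_mangoldt a) (Complex x t)) (at x)"
proof -
  have e: "Complex x t = of_real x + \<i> * of_real t" for x by (rule Complex_eq)
  have "((\<lambda>z. dirichlet_series a (z + \<i> * of_real t)) has_field_derivative 
      dirichlet_series a (Complex x t) * - dirichlet_series (twisted_mangoldt a) (Complex x t)) (at (of_real x))"
    unfolding e using x by (subst DERIV_shift[symmetric], intro dirichlet_series_log_deriv[OF a]) simp
  from has_vector_derivative_real_field[OF this] show ?thesis unfolding e .
qed

text \<open>By the growth estimate a zero would propagate horizontally to real part at least 2,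
  where the series has norm at least 1/4.\<close>

lemma dirichlet_series_nonzero:
  assumes a: "completely_multiplicative a" and s: "Re s > 1"
  shows "dirichlet_series a s \<noteq> 0"
proof
  assume 0: "dirichlet_series a s = 0"
  define y where "y = max 2 (Re s)"
  have "norm (dirichlet_series a (Complex y (Im s))) \<le> 
     norm (dirichlet_series a (Complex (Re s) (Im s))) * exp (mangoldt_series (Re s) * (y - Re s))"
  proof (rule norm_log_derivative_growth)
    fix x assume x: "x \<in> {Re s..y}"
    then show "((\<lambda>x. dirichlet_series a (Complex x (Im s))) has_vector_derivative 
      dirichlet_series a (Complex x (Im s)) * - dirichlet_series (twisted_mangoldt a) (Complex x (Im s))) (at x)"
      using s by (intro dirichlet_series_horizontal_derivative a) auto
    have "Re (- dirichlet_series (twisted_mangoldt a) (Complex x (Im s))) \<le> mangoldt_series x"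
      using norm_dirichlet_series_mangoldt_le[OF a, of "Complex x (Im s)"] x s 
        abs_Re_le_cmod[of "dirichlet_series (twisted_mangoldt a) (Complex x (Im s))"] by simp
    also have "\<dots> \<le> mangoldt_series (Re s)" using x s by (intro mangoldt_series_antimono) auto
    finally show "Re (- dirichlet_series (twisted_mangoldt a) (Complex x (Im s))) \<le> mangoldt_series (Re s)" .
  qed (simp add: y_def)
  then have "dirichlet_series a (Complex y (Im s)) = 0" using 0 by simp
  then show False using norm_dirichlet_series_ge[OF a, of "Complex y (Im s)"] by (simp add: y_def)
qed

section \<open>Non-vanishing on the line of real part one\<close>

text \<open>The classical inequality for the closed disc rather than the circle, since character
  values may be 0. Replacing (Im z)^2 by 1 - (Re z)^2 leaves 2 (1 + Re z)^2.\<close>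

lemma three_four_one_complex:
  assumes "norm z \<le> 1"
  shows "3 + 4 * Re z + Re (z ^ 2) \<ge> 0"
proof -
  have "(Re z)\<^sup>2 + (Im z)\<^sup>2 \<le> 1"
    using power_mono[OF assms, of 2] by (simp add: cmod_power2)
  then have "3 + 4 * Re z + Re (z ^ 2) \<ge> 2 * (1 + Re z)\<^sup>2"
    by (simp add: power2_eq_square algebra_simps)
  moreover have "2 * (1 + Re z)\<^sup>2 \<ge> 0" by simp
  ultimately show ?thesis by linarith
qed

lemma completely_multiplicative_power2:
  assumes "completely_multiplicative a"
  shows "completely_multiplicative (\<lambda>n. a n ^ 2)"
  using assms by (auto simp: completely_multiplicative_def power_mult_distrib norm_power power_le_one)

text \<open>Termwise, with z = a(n) n^(-it) and the von Mangoldt function times n^(-x) as weight: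
  the square of z is the matching term of the series of a^2 at height 2t.\<close>

lemma mangoldt_series_three_four_one:
  assumes a: "completely_multiplicative a" and x: "x > 1"
  shows "0 \<le> 3 * mangoldt_series x + 4 * Re (dirichlet_series (twisted_mangoldt a) (Complex x t))
     + Re (dirichlet_series (twisted_mangoldt (\<lambda>n. a n ^ 2)) (Complex x (2 * t)))"
proof -
  note a2 = completely_multiplicative_power2[OF a]
  let ?w = "\<lambda>n. mangoldt (Suc n) * real (Suc n) powr - x"
  let ?e = "\<lambda>n. of_nat (Suc n) powr - (\<i> * of_real t) :: complex"
  have split: "of_nat (Suc n) powr - Complex x u = of_real (real (Suc n) powr - x) * of_nat (Suc n) powr - (\<i> * of_real u)" for n u
  proof -
    have e: "- Complex x u = - of_real x + - (\<i> * of_real u)" by (simp add: Complex_eq)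
    show ?thesis unfolding e powr_add of_nat_powr_of_real ..
  qed
  have sq: "of_nat (Suc n) powr - (\<i> * of_real (2 * t)) = ?e n ^ 2" for n
    using powr_add[of "of_nat (Suc n)" "- (\<i> * of_real t)" "- (\<i> * of_real t)"]
    by (simp add: power2_eq_square algebra_simps del: of_nat_Suc)
  have R: "Re (of_real r * z) = r * Re z" for r z by simp
  have A: "(\<lambda>n. 3 * ?w n) sums (3 * mangoldt_series x)"
    unfolding mangoldt_series_def by (intro sums_mult summable_sums mangoldt_series_summable x)
  have B: "(\<lambda>n. ?w n * Re (a (Suc n) * ?e n)) sums Re (dirichlet_series (twisted_mangoldt a) (Complex x t))"
  proof -
    have "(\<lambda>n. Re (twisted_mangoldt a (Suc n) * of_nat (Suc n) powr - Complex x t)) sums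
       Re (dirichlet_series (twisted_mangoldt a) (Complex x t))"
      unfolding dirichlet_series_def using x
      by (intro sums_Re summable_sums dirichlet_series_summable log_bounded_twisted_mangoldt a) auto
    moreover have "Re (twisted_mangoldt a (Suc n) * of_nat (Suc n) powr - Complex x t) = ?w n * Re (a (Suc n) * ?e n)" for n
    proof -
      have "twisted_mangoldt a (Suc n) * of_nat (Suc n) powr - Complex x t = of_real (?w n) * (a (Suc n) * ?e n)"
        unfolding split twisted_mangoldt_def of_real_mult of_real_mangoldt by (simp only: mult_ac)
      then show ?thesis by (simp only: R)
    qed
    ultimately show ?thesis by (simp only:)
  qed
  have C: "(\<lambda>n. ?w n * Re ((a (Suc n) * ?e n)\<^sup>2)) sums Re (dirichlet_series (twisted_mangoldt (\<lambda>n. a n ^ 2)) (Complex x (2 * t)))"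
  proof -
    have "(\<lambda>n. Re (twisted_mangoldt (\<lambda>n. a n ^ 2) (Suc n) * of_nat (Suc n) powr - Complex x (2 * t))) sums
       Re (dirichlet_series (twisted_mangoldt (\<lambda>n. a n ^ 2)) (Complex x (2 * t)))"
      unfolding dirichlet_series_def using x
      by (intro sums_Re summable_sums dirichlet_series_summable log_bounded_twisted_mangoldt a2) auto
    moreover have "Re (twisted_mangoldt (\<lambda>n. a n ^ 2) (Suc n) * of_nat (Suc n) powr - Complex x (2 * t)) 
       = ?w n * Re ((a (Suc n) * ?e n)\<^sup>2)" for n
    proof -
      have "twisted_mangoldt (\<lambda>n. a n ^ 2) (Suc n) * of_nat (Suc n) powr - Complex x (2 * t) 
         = of_real (?w n) * (a (Suc n) * ?e n)\<^sup>2"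
        unfolding split sq twisted_mangoldt_def
        by (simp only: of_real_mult of_real_mangoldt power_mult_distrib mult_ac)
      then show ?thesis by (simp only: R)
    qed
    ultimately show ?thesis by (simp only:)
  qed
  have sums: "(\<lambda>n. 3 * ?w n + 4 * (?w n * Re (a (Suc n) * ?e n)) + ?w n * Re ((a (Suc n) * ?e n)\<^sup>2)) sums
    (3 * mangoldt_series x + 4 * Re (dirichlet_series (twisted_mangoldt a) (Complex x t))
     + Re (dirichlet_series (twisted_mangoldt (\<lambda>n. a n ^ 2)) (Complex x (2 * t))))"
    by (intro sums_add A sums_mult B C)
  have nonneg: "0 \<le> 3 * ?w n + 4 * (?w n * Re (a (Suc n) * ?e n)) + ?w n * Re ((a (Suc n) * ?e n)\<^sup>2)" for n
  proof -
    have "norm (a (Suc n) * ?e n) \<le> 1"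
      unfolding norm_mult norm_of_nat_powr using a by (simp add: completely_multiplicative_def)
    then have "0 \<le> ?w n * (3 + 4 * Re (a (Suc n) * ?e n) + Re ((a (Suc n) * ?e n)\<^sup>2))"
      by (intro mult_nonneg_nonneg three_four_one_complex mangoldt_nonneg powr_ge_zero)
    then show ?thesis by (simp only: distrib_left mult_ac)
  qed
  show ?thesis by (rule sums_le[OF nonneg sums_zero sums])
qed

lemma has_vector_derivative_mult_logarithmic:
  fixes f g :: "real \<Rightarrow> complex"
  assumes "(f has_vector_derivative f x * c) (at x)" "(g has_vector_derivative g x * d) (at x)"
  shows "((\<lambda>x. f x * g x) has_vector_derivative (f x * g x) * (c + d)) (at x)"
  using has_vector_derivative_mult[OF assms] by (simp add: algebra_simps)

text \<open>W is the product of \<zeta>(x)^3, L(x + it)^4 and the series of a^2 at x + 2it. Its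
  logarithmic derivative has real part at most 0, so |W| is nonincreasing in x and stays above
  |W(2)| > 0 as x decreases to 1. A zero at 1 + it would give |W(1 + \<epsilon>)| =
  O(\<epsilon>^(-3) \<epsilon>^4) instead; the bound \<open>B\<close> says that the third factor has
  no pole in the way.\<close>

lemma no_zero_on_line_one:
  assumes a: "completely_multiplicative a" and F: "F holomorphic_on UNIV"
    and eq: "\<And>s. Re s > 1 \<Longrightarrow> F s = dirichlet_series a s"
    and B: "\<And>x. x \<in> {1<..2} \<Longrightarrow> norm (dirichlet_series (\<lambda>n. a n ^ 2) (Complex x (2 * t))) \<le> B"
  shows "F (Complex 1 t) \<noteq> 0"
proof
  assume zero: "F (Complex 1 t) = 0"
  note a2 = completely_multiplicative_power2[OF a]
  define L0 where "L0 = (\<lambda>x. dirichlet_series (\<lambda>_. 1) (Complex x 0))"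
  define L1 where "L1 = (\<lambda>x. dirichlet_series a (Complex x t))"
  define L2 where "L2 = (\<lambda>x. dirichlet_series (\<lambda>n. a n ^ 2) (Complex x (2 * t)))"
  define W where "W = (\<lambda>x. (L0 x * (L0 x * L0 x)) * (((L1 x * L1 x) * (L1 x * L1 x)) * L2 x))"
  let ?G0 = "\<lambda>x. dirichlet_series (twisted_mangoldt (\<lambda>_. 1)) (Complex x 0)"
  let ?G1 = "\<lambda>x. dirichlet_series (twisted_mangoldt a) (Complex x t)"
  let ?G2 = "\<lambda>x. dirichlet_series (twisted_mangoldt (\<lambda>n. a n ^ 2)) (Complex x (2 * t))"
  have growth: "norm (W 2) \<le> norm (W x)" if x: "1 < x" "x \<le> 2" for x
  proof -
    have "norm (W 2) \<le> norm (W x) * exp (0 * (2 - x))"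
    proof (rule norm_log_derivative_growth)
      fix y assume y: "y \<in> {x..2}"
      then have y1: "y > 1" using x by simp
      show "(W has_vector_derivative W y * (- ?G0 y + (- ?G0 y + - ?G0 y) + (((- ?G1 y + - ?G1 y) + (- ?G1 y + - ?G1 y)) + - ?G2 y))) (at y)"
        unfolding W_def L0_def L1_def L2_def
        by (intro has_vector_derivative_mult_logarithmic dirichlet_series_horizontal_derivative
            completely_multiplicative_one a a2 y1)
      have "?G0 y = of_real (mangoldt_series y)"
        using dirichlet_series_mangoldt_one[OF y1] by (simp add: complex_of_real_def)
      then show "Re (- ?G0 y + (- ?G0 y + - ?G0 y) + (((- ?G1 y + - ?G1 y) + (- ?G1 y + - ?G1 y)) + - ?G2 y)) \<le> 0"
        using mangoldt_series_three_four_one[OF a y1, of t] by simp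
    qed (use x in auto)
    then show ?thesis by simp
  qed
  have W2: "norm (W 2) > 0"
    unfolding W_def L0_def L1_def L2_def
    using dirichlet_series_nonzero[OF a] dirichlet_series_nonzero[OF a2] dirichlet_series_nonzero[OF completely_multiplicative_one]
    by simp
  define K where "K = norm (deriv F (Complex 1 t)) + 1"
  have K: "K > 0" by (simp add: K_def add_nonneg_pos)
  have B0: "B \<ge> 0" by (rule order_trans[OF norm_ge_zero B[of 2]]) simp
  have "(F has_field_derivative deriv F (Complex 1 t)) (at (Complex 1 t))"
    using F by (auto intro: holomorphic_derivI)
  then have "((\<lambda>h. (F (Complex 1 t + h) - F (Complex 1 t)) / h) \<longlongrightarrow> deriv F (Complex 1 t)) (at 0)"
    by (simp add: DERIV_def)
  then have "((\<lambda>h. norm (F (Complex 1 t + h) / h)) \<longlongrightarrow> norm (deriv F (Complex 1 t))) (at 0)"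
    using zero by (auto intro: tendsto_norm)
  then have "eventually (\<lambda>h. norm (F (Complex 1 t + h) / h) < K) (at 0)"
    by (rule order_tendstoD) (simp add: K_def)
  then obtain d where d: "d > 0" "\<And>h. h \<noteq> 0 \<Longrightarrow> norm h < d \<Longrightarrow> norm (F (Complex 1 t + h) / h) < K"
    by (auto simp: eventually_at)
  have bound: "norm (W 2) \<le> 8 * K ^ 4 * B * \<epsilon>" if \<epsilon>: "0 < \<epsilon>" "\<epsilon> < d" "\<epsilon> \<le> 1" for \<epsilon>
  proof -
    have "L0 (1 + \<epsilon>) = of_real (real_zeta (1 + \<epsilon>))"
      using dirichlet_series_one[of "1 + \<epsilon>"] \<epsilon> unfolding L0_def by (simp only: complex_of_real_def)
    moreover have "real_zeta (1 + \<epsilon>) \<ge> 0" using real_zeta_bounds(1)[OF \<epsilon>(1)] \<epsilon> by (smt (verit) divide_nonneg_nonneg)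
    moreover have "1 + 1 / \<epsilon> \<le> 2 / \<epsilon>" using \<epsilon> by (simp add: field_simps)
    ultimately have 0: "norm (L0 (1 + \<epsilon>)) \<le> 2 / \<epsilon>"
      using real_zeta_bounds(2)[OF \<epsilon>(1)] by simp
    have "L1 (1 + \<epsilon>) = F (Complex 1 t + of_real \<epsilon>)"
    proof -
      have "Complex 1 t + of_real \<epsilon> = Complex (1 + \<epsilon>) t" by (simp add: complex_eq_iff)
      then show ?thesis using \<epsilon> eq[of "Complex (1 + \<epsilon>) t"] by (simp add: L1_def)
    qed
    then have 1: "norm (L1 (1 + \<epsilon>)) \<le> K * \<epsilon>"
      using d(2)[of "of_real \<epsilon>"] \<epsilon> by (simp add: norm_divide divide_less_eq)
    have 2: "norm (L2 (1 + \<epsilon>)) \<le> B" unfolding L2_def using \<epsilon> by (intro B) auto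
    have "norm (W 2) \<le> norm (W (1 + \<epsilon>))" using \<epsilon> by (intro growth) auto
    also have "\<dots> \<le> (2 / \<epsilon> * (2 / \<epsilon> * (2 / \<epsilon>))) * (((K * \<epsilon>) * (K * \<epsilon>)) * ((K * \<epsilon>) * (K * \<epsilon>)) * B)"
      unfolding W_def norm_mult using 0 1 2 \<epsilon> K B0
      by (intro mult_mono) (auto intro!: mult_nonneg_nonneg)
    also have "\<dots> = 8 * K ^ 4 * B * \<epsilon>"
      using \<epsilon> by (simp add: field_simps eval_nat_numeral)
    finally show ?thesis .
  qed
  define M where "M = 8 * K ^ 4 * B"
  have M: "M \<ge> 0" using K B0 by (simp add: M_def)
  \<comment> \<open>Small enough for M \<epsilon> to be at most half of |W(2)|; M + 1 guards against
    division by M = 0.\<close>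
  define \<epsilon> where "\<epsilon> = min (min (d / 2) 1) (norm (W 2) / (2 * (M + 1)))"
  have \<epsilon>: "0 < \<epsilon>" "\<epsilon> < d" "\<epsilon> \<le> 1" "\<epsilon> \<le> norm (W 2) / (2 * (M + 1))"
    using d W2 M by (auto simp: \<epsilon>_def min_less_iff_disj)
  have "norm (W 2) \<le> M * \<epsilon>" using bound[OF \<epsilon>(1-3)] by (simp add: M_def)
  also have "\<dots> \<le> (M + 1) * (norm (W 2) / (2 * (M + 1)))"
    using M \<epsilon> by (intro mult_mono) auto
  also have "\<dots> = norm (W 2) / 2" using M by (simp add: field_simps)
  finally show False using W2 by simp
qed

text \<open>Multiplying by \<open>1 - 2 powr (1 - s)\<close> removes the possible pole at \<open>s = 1\<close> of the Dirichlet
  series of a periodic function: the new coefficients are periodic with mean zero.\<close>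

definition two_twist :: "(int \<Rightarrow> complex) \<Rightarrow> int \<Rightarrow> complex" where
  "two_twist a n = a n - (if even n then 2 * a (n div 2) else 0)"

text \<open>Over a period 2q the function \<open>a\<close> sums to twice its sum over q, and so does
  the subtracted part, which lives on the even integers.\<close>

lemma mean_zero_periodic_two_twist:
  assumes q: "q > 0" and per: "\<And>n. a (n + int q) = a n"
  shows "mean_zero_periodic (2 * q) (two_twist a)"
  unfolding mean_zero_periodic_def
proof (intro conjI allI)
  show "2 * q > 0" using q by simp
  fix n
  have "a (n + int (2 * q)) = a n" using per[of n] per[of "n + int q"] by (simp add: algebra_simps)
  moreover have "(n + int (2 * q)) div 2 = n div 2 + int q" by simp
  ultimately show "two_twist a (n + int (2 * q)) = two_twist a n"
    unfolding two_twist_def using per by simp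
next
  have 1: "(\<Sum>k<2*m. (if even (int k) then 2 * a (int k div 2) else 0)) = (\<Sum>k<m. 2 * a (int k))" for m
    by (induction m) (auto simp: zdiv_int[symmetric])
  have "(\<Sum>k<2*q. a (int k)) = (\<Sum>k<q. a (int k)) + (\<Sum>k=q..<2*q. a (int k))"
    by (simp add: lessThan_atLeast0 sum.atLeastLessThan_concat)
  also have "(\<Sum>k=q..<2*q. a (int k)) = (\<Sum>k<q. a (int k + int q))"
    by (rule sum.reindex_bij_witness[of _ "\<lambda>k. k + q" "\<lambda>k. k - q"]) auto
  also have "\<dots> = (\<Sum>k<q. a (int k))" by (simp add: per)
  finally have "(\<Sum>k<2*q. a (int k)) = 2 * (\<Sum>k<q. a (int k))" by simp
  then show "(\<Sum>k<2*q. two_twist a (int k)) = 0"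
    unfolding two_twist_def sum_subtractf 1 by (simp add: sum_distrib_left)
qed

lemma dirichlet_series_two_twist:
  assumes a: "log_bounded (\<lambda>n. a (int n))" and s: "Re s > 1"
  shows "dirichlet_series (\<lambda>n. two_twist a (int n)) s = (1 - 2 powr (1 - s)) * dirichlet_series (\<lambda>n. a (int n)) s"
proof -
  let ?f = "\<lambda>n. (if even (int (Suc n)) then 2 * a (int (Suc n) div 2) else 0) * of_nat (Suc n) powr - s"
  have A: "(\<lambda>n. a (int (Suc n)) * of_nat (Suc n) powr - s) sums dirichlet_series (\<lambda>n. a (int n)) s"
    unfolding dirichlet_series_def using dirichlet_series_summable[OF a s] by (rule summable_sums)
  have "(\<lambda>n. ?f (2 * n + 1)) sums (2 powr (1 - s) * dirichlet_series (\<lambda>n. a (int n)) s)"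
  proof -
    have "?f (2 * n + 1) = 2 powr (1 - s) * (a (int (Suc n)) * of_nat (Suc n) powr - s)" for n
    proof -
      have e: "Suc (2 * n + 1) = 2 * Suc n" by simp
      have P: "of_nat (2 * Suc n) powr - s = (2 powr - s) * (of_nat (Suc n) powr - s :: complex)"
        unfolding of_nat_mult by (subst powr_times_real) (auto simp del: of_nat_Suc)
      have D: "int (2 * Suc n) div 2 = int (Suc n)" by simp
      have E: "even (int (2 * Suc n))" by simp
      have T: "2 powr (1 - s) = 2 * 2 powr - s"
        using powr_add[of "2 :: complex" 1 "- s"] by simp
      show ?thesis unfolding e D P if_P[OF E] T by (simp only: mult_ac)
    qed
    then show ?thesis using sums_mult[OF A, of "2 powr (1 - s)"] by (simp only:)
  qed
  also have "?this \<longleftrightarrow> ?f sums (2 powr (1 - s) * dirichlet_series (\<lambda>n. a (int n)) s)"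
  proof (rule sums_mono_reindex)
    show "strict_mono (\<lambda>n. 2 * n + 1 :: nat)" by (auto simp: strict_mono_def)
    fix n :: nat assume n: "n \<notin> range (\<lambda>n. 2 * n + 1)"
    have "even n"
    proof (rule ccontr)
      assume "odd n"
      then obtain k where "n = 2 * k + 1" by (elim oddE)
      then show False using n by blast
    qed
    then show "?f n = 0" by simp
  qed
  finally have "(\<lambda>n. a (int (Suc n)) * of_nat (Suc n) powr - s - ?f n) sums 
     (dirichlet_series (\<lambda>n. a (int n)) s - 2 powr (1 - s) * dirichlet_series (\<lambda>n. a (int n)) s)"
    by (intro sums_diff A)
  moreover have "dirichlet_series (\<lambda>n. two_twist a (int n)) s = 
     (\<Sum>n. a (int (Suc n)) * of_nat (Suc n) powr - s - ?f n)"
    unfolding dirichlet_series_def two_twist_def by (simp only: left_diff_distrib)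
  ultimately show ?thesis by (simp only: sums_iff left_diff_distrib mult_1)
qed

text \<open>The series is an entire function divided by 1 - 2^(1-s), continuous on a compact segment
  as long as the denominator has no zero there. A zero would make u ln 2 a multiple of 2\<pi>,
  impossible for 0 < |u| \<le> 3.\<close>

lemma periodic_dirichlet_series_bounded_right_of_line:
  assumes q: "q > 0" and per: "\<And>n. a (n + int q) = a n" and lb: "log_bounded (\<lambda>n. a (int n))"
    and u: "u \<noteq> 0" "\<bar>u\<bar> \<le> 3"
  shows "\<exists>B. \<forall>x\<in>{1<..2}. norm (dirichlet_series (\<lambda>n. a (int n)) (Complex x u)) \<le> B"
proof -
  let ?P = "periodic_L (2 * q) (two_twist a)"
  note mz = mean_zero_periodic_two_twist[of q a, OF q per]
  have nz: "1 - 2 powr (1 - Complex x u) \<noteq> 0" if "x \<ge> 1" for x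
  proof
    assume "1 - 2 powr (1 - Complex x u) = 0"
    then have e1: "exp ((1 - Complex x u) * of_real (ln 2)) = 1"
      by (simp add: powr_def Ln_of_real[symmetric])
    then have "Im ((1 - Complex x u) * of_real (ln 2)) \<in> {of_int (2 * n) * pi |n. True}"
      unfolding exp_eq_1 by auto
    then obtain n :: int where n: "- u * ln 2 = of_int (2 * n) * pi" by auto
    have "\<bar>u\<bar> * ln 2 \<le> 3 * 1" using u ln_2_less_1 by (intro mult_mono) auto
    then have "\<bar>- u * ln 2\<bar> \<le> 3" by (simp add: abs_mult)
    then have "2 * \<bar>of_int n\<bar> * pi \<le> 3" unfolding n by (simp add: abs_mult)
    moreover have "n \<noteq> 0" using n u by auto
    then have "\<bar>real_of_int n\<bar> \<ge> 1" by linarith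
    then have "2 * \<bar>of_int n\<bar> * pi \<ge> 2 * 1 * pi" by (intro mult_right_mono mult_left_mono) auto
    ultimately show False using pi_gt3 by linarith
  qed
  have "continuous_on {1..2} (\<lambda>x. ?P (Complex x u) / (1 - 2 powr (1 - Complex x u)))"
  proof (intro continuous_on_divide ballI)
    have C: "continuous_on {1..2} (\<lambda>x. Complex x u)"
      by (auto simp: Complex_eq intro!: continuous_intros)
    show "continuous_on {1..2} (\<lambda>x. ?P (Complex x u))"
      by (rule continuous_on_compose2[OF holomorphic_on_imp_continuous_on[OF periodic_L_holomorphic[OF mz, of UNIV]] C]) auto
    show "continuous_on {1..2} (\<lambda>x. 1 - 2 powr (1 - Complex x u))"
      by (intro continuous_intros C) auto
  qed (use nz in auto)
  then have "bounded ((\<lambda>x. ?P (Complex x u) / (1 - 2 powr (1 - Complex x u))) ` {1..2})"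
    by (intro compact_imp_bounded compact_continuous_image) auto
  then obtain B where "\<forall>y\<in>(\<lambda>x. ?P (Complex x u) / (1 - 2 powr (1 - Complex x u))) ` {1..2}. norm y \<le> B"
    unfolding bounded_iff by blast
  then have B: "norm (?P (Complex x u) / (1 - 2 powr (1 - Complex x u))) \<le> B" if "x \<in> {1..2}" for x
    using that by blast
  show ?thesis
  proof (intro exI[of _ B] ballI)
    fix x :: real assume x: "x \<in> {1<..2}"
    have "?P (Complex x u) = (1 - 2 powr (1 - Complex x u)) * dirichlet_series (\<lambda>n. a (int n)) (Complex x u)"
      using periodic_L_eq_series[OF mz, of "Complex x u"] dirichlet_series_two_twist[OF lb, of "Complex x u"] x
      by (simp add: dirichlet_series_def)
    then show "norm (dirichlet_series (\<lambda>n. a (int n)) (Complex x u)) \<le> B"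
      using B[of x] nz[of x] x by simp
  qed
qed

section \<open>Dirichlet L-functions\<close>

lemma dirichlet_char_periodic: "dirichlet_char q \<psi> \<Longrightarrow> \<psi> (n + int q) = \<psi> n"
  by (simp add: dirichlet_char_def)

lemma dirichlet_char_cong:
  assumes "dirichlet_char q \<psi>" "[m = n] (mod int q)"
  shows "\<psi> m = \<psi> n"
  using periodic_int_mod[of \<psi> q m, OF dirichlet_char_periodic[OF assms(1)]]
    periodic_int_mod[of \<psi> q n, OF dirichlet_char_periodic[OF assms(1)]] assms(2)
  by (simp add: cong_def)

text \<open>By Euler's theorem the values at units are roots of unity; all other values are
  0.\<close>

lemma dirichlet_char_norm_le:
  assumes \<psi>: "dirichlet_char q \<psi>"
  shows "norm (\<psi> n) \<le> 1"
proof (cases "coprime n (int q)")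
  case True
  have q: "q > 0" using \<psi> by (simp add: dirichlet_char_def)
  define k where "k = nat (n mod int q)"
  have k: "int k = n mod int q" using q by (simp add: k_def)
  have "coprime (int k) (int q)" unfolding k using True q by (simp add: coprime_iff_gcd_eq_1 gcd_red_int[symmetric] gcd.commute)
  then have "coprime k q" by simp
  then have "[k ^ totient q = 1] (mod q)" by (rule euler_theorem)
  then have c: "[int k ^ totient q = 1] (mod int q)" 
    using cong_int_iff[of "k ^ totient q" 1 q] by simp
  have pow: "\<psi> (m ^ j) = \<psi> m ^ j" for m j
    using \<psi> by (induction j) (auto simp: dirichlet_char_def)
  have "\<psi> (int k) ^ totient q = 1"
    using dirichlet_char_cong[OF \<psi> c] \<psi> by (simp add: pow dirichlet_char_def)
  then have "norm (\<psi> (int k)) ^ totient q = 1" by (metis norm_one norm_power)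
  moreover have "totient q > 0" using q by simp
  ultimately have "norm (\<psi> (int k)) = 1" using power_eq_imp_eq_base[of "norm (\<psi> (int k))" "totient q" 1] by simp
  moreover have "\<psi> (int k) = \<psi> n" by (rule dirichlet_char_cong[OF \<psi>]) (simp add: k)
  ultimately show ?thesis by simp
next
  case False
  then have "\<psi> n = 0" using \<psi> by (simp add: dirichlet_char_def)
  then show ?thesis by simp
qed

lemma dirichlet_char_completely_multiplicative:
  assumes "dirichlet_char q \<psi>"
  shows "completely_multiplicative (\<lambda>n. \<psi> (int n))"
  using assms dirichlet_char_norm_le[OF assms] by (auto simp: completely_multiplicative_def dirichlet_char_def)

text \<open>Multiplication by c permutes the residues, so the sum over a period is unchanged when
  multiplied by \<psi>(c) \<noteq> 1.\<close>

lemma dirichlet_char_mean_zero: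
  assumes \<psi>: "dirichlet_char q \<psi>" and c: "coprime c (int q)" "\<psi> c \<noteq> 1"
  shows "mean_zero_periodic q \<psi>"
proof -
  have q: "q > 0" using \<psi> by (simp add: dirichlet_char_def)
  have inj: "inj_on (\<lambda>k. c * k mod int q) {0..<int q}"
  proof (rule inj_onI)
    fix x y assume xy: "x \<in> {0..<int q}" "y \<in> {0..<int q}" "c * x mod int q = c * y mod int q"
    then have "[c * x = c * y] (mod int q)" by (simp add: cong_def)
    then have "[x = y] (mod int q)" using cong_mult_lcancel[of c "int q" x y] c by simp
    then show "x = y" using xy by (simp add: cong_def)
  qed
  have bij: "bij_betw (\<lambda>k. c * k mod int q) {0..<int q} {0..<int q}"
    unfolding bij_betw_def using q by (intro conjI inj endo_inj_surj inj) auto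
  have "(\<Sum>k\<in>{0..<int q}. \<psi> k) = (\<Sum>k\<in>{0..<int q}. \<psi> (c * k mod int q))"
    using sum.reindex_bij_betw[OF bij, of \<psi>] by simp
  also have "\<dots> = (\<Sum>k\<in>{0..<int q}. \<psi> c * \<psi> k)"
  proof (intro sum.cong refl)
    fix k
    have "\<psi> (c * k mod int q) = \<psi> (c * k)" by (rule dirichlet_char_cong[OF \<psi>]) simp
    then show "\<psi> (c * k mod int q) = \<psi> c * \<psi> k" using \<psi> by (simp add: dirichlet_char_def)
  qed
  also have "\<dots> = \<psi> c * (\<Sum>k\<in>{0..<int q}. \<psi> k)" by (simp add: sum_distrib_left)
  finally have "(1 - \<psi> c) * (\<Sum>k\<in>{0..<int q}. \<psi> k) = 0" by (simp add: algebra_simps)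
  then have "(\<Sum>k\<in>{0..<int q}. \<psi> k) = 0" using c by simp
  also have "(\<Sum>k\<in>{0..<int q}. \<psi> k) = (\<Sum>k<q. \<psi> (int k))"
    by (rule sum.reindex_bij_witness[of _ int nat]) auto
  finally show ?thesis using \<psi> by (simp add: mean_zero_periodic_def dirichlet_char_def)
qed

text \<open>For q \<ge> 2 primitivity forbids 1 as an induced modulus, and this failure supplies a
  unit with value different from 1.\<close>

lemma primitive_char_mean_zero:
  assumes \<psi>: "primitive_char q \<psi>" and q: "q \<ge> 2"
  shows "mean_zero_periodic q \<psi>"
proof -
  have "\<not> induced_modulus q \<psi> 1" using \<psi> q by (auto simp: primitive_char_def)
  then obtain c where "coprime c (int q)" "\<psi> c \<noteq> 1" by (auto simp: induced_modulus_def)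
  then show ?thesis using \<psi> by (intro dirichlet_char_mean_zero) (auto simp: primitive_char_def)
qed

text \<open>The difference is meromorphic and vanishes on an open set, hence off a sparse set. So
  \<open>L\<close> and \<open>P\<close> have the same limit at each point, and niceness forces
  \<open>L\<close> to take its limit where there is no pole.\<close>

lemma nicely_meromorphic_on_eq_entire:
  assumes L: "L nicely_meromorphic_on UNIV" and P: "P holomorphic_on UNIV"
    and U: "open U" "U \<noteq> {}" and eq: "\<And>s. s \<in> U \<Longrightarrow> L s = P s"
  shows "L = P"
proof -
  have "L meromorphic_on UNIV" using L by (simp add: nicely_meromorphic_on_def)
  moreover have "P analytic_on UNIV" using P by (simp add: analytic_on_open)
  then have "P meromorphic_on UNIV" by (rule analytic_on_imp_meromorphic_on)
  ultimately have mero: "(\<lambda>s. L s - P s) meromorphic_on UNIV" by (rule meromorphic_on_diff)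
  obtain u where u: "u \<in> U" using U by blast
  have ev0: "eventually (\<lambda>s. L s - P s = 0) (at u)"
    unfolding eventually_at_topological using U u eq by (intro exI[of _ U]) auto
  have "(\<forall>\<^sub>\<approx>s\<in>UNIV. L s - P s = 0) \<or> (\<forall>\<^sub>\<approx>s\<in>UNIV. L s - P s \<noteq> 0)"
    by (rule meromorphic_imp_constant_or_avoid[OF mero]) auto
  moreover have "\<not> (\<forall>\<^sub>\<approx>s\<in>UNIV. L s - P s \<noteq> 0)"
  proof
    assume "\<forall>\<^sub>\<approx>s\<in>UNIV. L s - P s \<noteq> 0"
    then have "eventually (\<lambda>s. L s - P s \<noteq> 0) (at u)"
      by (rule eventually_cosparse_imp_eventually_at) simp
    with ev0 have "eventually (\<lambda>s. False) (at u)" by eventually_elim simp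
    then show False by simp
  qed
  ultimately have ev: "\<forall>\<^sub>\<approx>s\<in>UNIV. L s - P s = 0" by blast
  show ?thesis
  proof
    fix z
    have "eventually (\<lambda>s. L s - P s = 0) (at z)"
      using ev by (rule eventually_cosparse_imp_eventually_at) simp
    then have ev: "eventually (\<lambda>s. L s = P s) (at z)" by eventually_elim simp
    have "\<not> is_pole P z" by (rule not_is_pole_holomorphic[OF open_UNIV _ P]) simp
    then have "\<not> is_pole L z" using is_pole_cong[OF ev] by simp
    then have "L \<midarrow>z\<rightarrow> L z" using L by (auto simp: nicely_meromorphic_on_def)
    moreover have "isCont P z"
      using P by (meson continuous_on_eq_continuous_at holomorphic_on_imp_continuous_on open_UNIV UNIV_I)
    then have "P \<midarrow>z\<rightarrow> P z" by (simp add: isCont_def)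
    then have "L \<midarrow>z\<rightarrow> P z" using ev by (simp add: tendsto_cong)
    ultimately show "L z = P z" by (rule LIM_unique)
  qed
qed

lemma Dirichlet_L_eq_entire:
  assumes P: "P holomorphic_on UNIV"
    and eq: "\<And>s. Re s > 1 \<Longrightarrow> P s = (\<Sum>n. \<psi> (int (Suc n)) * of_nat (Suc n) powr (- s))"
  shows "Dirichlet_L \<psi> = P"
  unfolding Dirichlet_L_def
proof (rule the_equality)
  show "P nicely_meromorphic_on UNIV \<and>
    (\<forall>s. 1 < Re s \<longrightarrow> P s = (\<Sum>n. \<psi> (int (Suc n)) * of_nat (Suc n) powr - s))"
    using P eq by (auto intro!: analytic_on_imp_nicely_meromorphic_on simp: analytic_on_open)
  fix L assume L: "L nicely_meromorphic_on UNIV \<and>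
    (\<forall>s. 1 < Re s \<longrightarrow> L s = (\<Sum>n. \<psi> (int (Suc n)) * of_nat (Suc n) powr - s))"
  show "L = P"
  proof (rule nicely_meromorphic_on_eq_entire[of L P "{s. Re s > 1}"])
    show "open {s. Re s > 1}" by (rule open_halfspace_Re_gt)
    have "2 \<in> {s. Re s > 1}" by simp
    then show "{s. Re s > 1} \<noteq> {}" by blast
  qed (use L P eq in auto)
qed

lemma Dirichlet_L_eq_periodic_L:
  assumes "mean_zero_periodic q \<psi>"
  shows "Dirichlet_L \<psi> = periodic_L q \<psi>"
  using assms by (intro Dirichlet_L_eq_entire periodic_L_holomorphic periodic_L_eq_series)

lemma Dirichlet_L_eq_dirichlet_series:
  assumes "mean_zero_periodic q \<psi>" "Re s > 1"
  shows "Dirichlet_L \<psi> s = dirichlet_series (\<lambda>n. \<psi> (int n)) s"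
  using assms by (simp add: Dirichlet_L_eq_periodic_L periodic_L_eq_series dirichlet_series_def)

lemma Dirichlet_L_holomorphic: 
  "mean_zero_periodic q \<psi> \<Longrightarrow> Dirichlet_L \<psi> holomorphic_on S"
  by (simp add: Dirichlet_L_eq_periodic_L periodic_L_holomorphic)

lemma Dirichlet_L_nonzero_right:
  assumes "mean_zero_periodic q \<psi>" "dirichlet_char q \<psi>" "Re s > 1"
  shows "Dirichlet_L \<psi> s \<noteq> 0"
  using dirichlet_series_nonzero[OF dirichlet_char_completely_multiplicative] assms
  by (simp add: Dirichlet_L_eq_dirichlet_series)

text \<open>The square of \<psi> may be principal, and its series then has a pole at 1. The height 2
  Im s stays off it, and |2 Im s| \<le> 3 is the range in which boundedness was shown.\<close>

lemma Dirichlet_L_nonzero_line: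
  assumes mz: "mean_zero_periodic q \<psi>" and \<psi>: "dirichlet_char q \<psi>" and s: "Re s = 1" "Im s \<noteq> 0" "\<bar>Im s\<bar> \<le> 3 / 2"
  shows "Dirichlet_L \<psi> s \<noteq> 0"
proof -
  note a = dirichlet_char_completely_multiplicative[OF \<psi>]
  have "\<exists>B. \<forall>x\<in>{1<..2}. norm (dirichlet_series (\<lambda>n. \<psi> (int n) ^ 2) (Complex x (2 * Im s))) \<le> B"
  proof (rule periodic_dirichlet_series_bounded_right_of_line)
    show "q > 0" using \<psi> by (simp add: dirichlet_char_def)
    show "\<psi> (n + int q) ^ 2 = \<psi> n ^ 2" for n using dirichlet_char_periodic[OF \<psi>] by simp
    show "log_bounded (\<lambda>n. \<psi> (int n) ^ 2)"
      by (intro log_bounded_completely_multiplicative completely_multiplicative_power2 a)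
  qed (use s in auto)
  then obtain B where "\<And>x. x \<in> {1<..2} \<Longrightarrow> norm (dirichlet_series (\<lambda>n. \<psi> (int n) ^ 2) (Complex x (2 * Im s))) \<le> B"
    by blast
  from no_zero_on_line_one[OF a Dirichlet_L_holomorphic[OF mz] Dirichlet_L_eq_dirichlet_series[OF mz] this]
  show ?thesis using s by (metis complex_surj)
qed

text \<open>Conjugation fixes the coefficients, so both functions continue the same Dirichlet
  series. The purpose is that L is real on the real axis.\<close>

lemma Dirichlet_L_cnj:
  assumes mz: "mean_zero_periodic q \<psi>" and real: "real_char \<psi>"
  shows "Dirichlet_L \<psi> (cnj s) = cnj (Dirichlet_L \<psi> s)"
proof -
  have c: "cnj (\<psi> n) = \<psi> n" for n
    using real by (auto simp: real_char_def Reals_cnj_iff[symmetric])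
  have "Dirichlet_L \<psi> = cnj \<circ> Dirichlet_L \<psi> \<circ> cnj"
  proof (rule Dirichlet_L_eq_entire)
    show "cnj \<circ> Dirichlet_L \<psi> \<circ> cnj holomorphic_on UNIV"
      by (intro holomorphic_on_compose_cnj_cnj Dirichlet_L_holomorphic[OF mz]) auto
    fix s :: complex assume s: "Re s > 1"
    have lb: "(\<lambda>n. \<psi> (int (Suc n)) * of_nat (Suc n) powr - cnj s) sums Dirichlet_L \<psi> (cnj s)"
      using antidiff_series_summable[OF mz, of 0 "cnj s"] s
      by (simp add: Dirichlet_L_eq_dirichlet_series[OF mz] dirichlet_series_def summable_sums del: of_nat_Suc)
    have "cnj (of_nat (Suc n) powr - cnj s) = of_nat (Suc n) powr - s" for n
      by (subst cnj_powr) (auto simp del: of_nat_Suc simp: complex_nonpos_Reals_iff)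
    then have "(\<lambda>n. \<psi> (int (Suc n)) * of_nat (Suc n) powr - s) sums cnj (Dirichlet_L \<psi> (cnj s))"
      using lb[THEN sums_cnj[THEN iffD2]] by (simp add: c del: of_nat_Suc)
    then show "(cnj \<circ> Dirichlet_L \<psi> \<circ> cnj) s = (\<Sum>n. \<psi> (int (Suc n)) * of_nat (Suc n) powr - s)"
      by (simp add: sums_iff)
  qed
  from fun_cong[OF this, of "cnj s"] show ?thesis by simp
qed

lemma Dirichlet_L_real_zero_exists:
  assumes mz: "mean_zero_periodic q \<psi>" and \<psi>: "dirichlet_char q \<psi>" and q: "q \<ge> 2"
  shows "\<exists>\<beta>. Dirichlet_L \<psi> (of_real \<beta>) = 0"
proof -
  have mult: "\<psi> (m * n) = \<psi> m * \<psi> n" "\<psi> 1 = 1" for m n using \<psi> by (auto simp: dirichlet_char_def)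
  have "\<psi> (- 1) * \<psi> (- 1) = 1" using mult(1)[of "- 1" "- 1"] mult(2) by simp
  then have pm: "\<psi> (- 1) = 1 \<or> \<psi> (- 1) = - 1" by (simp add: square_eq_1_iff)
  have neg: "\<psi> (- n) = \<psi> (- 1) * \<psi> n" for n
    using mult(1)[of "- 1" n] by simp
  show ?thesis
  proof (cases "\<psi> (- 1) = 1")
    case True
    then have 1: "\<psi> (- n) = \<psi> n" for n using neg[of n] by simp
    have "\<psi> 0 = 0" using \<psi> q by (auto simp: dirichlet_char_def)
    then have "Dirichlet_L \<psi> (of_real 0) = 0"
      using periodic_L_even_zero[OF mz 1] Dirichlet_L_eq_periodic_L[OF mz] by simp
    then show ?thesis by blast
  next
    case False
    then have 2: "\<psi> (- n) = - \<psi> n" for n using neg[of n] pm by simp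
    have "Dirichlet_L \<psi> (of_real (- 1)) = 0"
      using periodic_L_odd_zero[OF mz 2] Dirichlet_L_eq_periodic_L[OF mz] by simp
    then show ?thesis by blast
  qed
qed

section \<open>The logarithmic derivative at one\<close>

text \<open>With w = 1 - z and v = w + \<delta> the difference 1/w - 1/v is \<delta>/(wv). Since |w|
  \<ge> 1/\<phi>, the shift is at most \<delta> \<phi> |w|, so |v| \<le> (1 + \<delta> \<phi>) |w|
  and 1/|wv| may be replaced by a multiple of 1/|v|^2. Finally Re (1/v) = Re v / |v|^2 is at least
  1/(\<phi> |v|^2).\<close>

lemma inverse_diff_shift_bound:
  fixes z :: complex and \<phi> \<delta> :: real
  assumes \<phi>: "\<phi> > 0" and \<delta>: "\<delta> > 0" and z: "Re z \<le> 1 - 1 / \<phi>"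
  shows "0 \<le> Re (1 / (1 + of_real \<delta> - z))"
    and "\<bar>Re (1 / (1 - z)) - Re (1 / (1 + of_real \<delta> - z))\<bar> \<le> \<delta> * \<phi> * (1 + \<delta> * \<phi>) * Re (1 / (1 + of_real \<delta> - z))"
proof -
  define w where "w = 1 - z"
  define v where "v = 1 + of_real \<delta> - z"
  have w: "Re w \<ge> 1 / \<phi>" using z by (simp add: w_def)
  have nw: "norm w \<ge> 1 / \<phi>" using w complex_Re_le_cmod[of w] by linarith
  have wpos: "norm w > 0" using nw \<phi> by (smt (verit) divide_pos_pos)
  have v: "Re v \<ge> 1 / \<phi>" using w \<delta> by (simp add: w_def v_def)
  have vpos: "norm v > 0" using v \<phi> complex_Re_le_cmod[of v] by (smt (verit) divide_pos_pos)
  have Rv: "Re (1 / v) = Re v / (norm v)\<^sup>2" by (simp add: Re_divide cmod_power2)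
  have "Re v \<ge> 0" using v \<phi> by (smt (verit) divide_pos_pos)
  then show "0 \<le> Re (1 / (1 + of_real \<delta> - z))"
    unfolding v_def[symmetric] Rv by simp
  have vw: "v = w + of_real \<delta>" by (simp add: v_def w_def)
  have "\<delta> \<le> \<delta> * \<phi> * norm w"
    using nw \<phi> \<delta> mult_left_mono[of "1 / \<phi>" "norm w" "\<delta> * \<phi>"] by simp
  then have nv: "norm v \<le> (1 + \<delta> * \<phi>) * norm w"
  proof -
    have "norm v \<le> norm w + \<delta>" using norm_triangle_ineq[of w "of_real \<delta>"] \<delta> by (simp add: vw)
    then show ?thesis using \<open>\<delta> \<le> \<delta> * \<phi> * norm w\<close> by (simp add: distrib_right)
  qed
  have ne: "w \<noteq> 0" "v \<noteq> 0" using wpos vpos by auto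
  have "1 / w - 1 / v = of_real \<delta> / (w * v)"
    using ne by (simp add: vw diff_frac_eq)
  then have "norm (1 / w - 1 / v) = \<delta> / (norm w * norm v)"
    using \<delta> by (simp add: norm_divide norm_mult)
  also have "\<dots> \<le> \<delta> * (1 + \<delta> * \<phi>) / (norm v)\<^sup>2"
  proof -
    have "\<delta> * norm v \<le> \<delta> * ((1 + \<delta> * \<phi>) * norm w)"
      using nv \<delta> by (intro mult_left_mono) auto
    then show ?thesis using wpos vpos by (simp add: field_simps power2_eq_square)
  qed
  also have "\<dots> = \<delta> * \<phi> * (1 + \<delta> * \<phi>) * ((1 / \<phi>) / (norm v)\<^sup>2)"
    using \<phi> by simp
  also have "\<dots> \<le> \<delta> * \<phi> * (1 + \<delta> * \<phi>) * Re (1 / v)"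
    unfolding Rv using v \<phi> \<delta> by (intro mult_left_mono divide_right_mono) auto
  finally have "norm (1 / w - 1 / v) \<le> \<delta> * \<phi> * (1 + \<delta> * \<phi>) * Re (1 / v)" .
  then show "\<bar>Re (1 / (1 - z)) - Re (1 / (1 + of_real \<delta> - z))\<bar> \<le> \<delta> * \<phi> * (1 + \<delta> * \<phi>) * Re (1 / (1 + of_real \<delta> - z))"
    using abs_Re_le_cmod[of "1 / w - 1 / v"] by (simp add: w_def v_def)
qed

lemma norm_log_deriv_Dirichlet_L_le:
  assumes mz: "mean_zero_periodic q \<psi>" and \<psi>: "dirichlet_char q \<psi>" and \<delta>: "0 < \<delta>" "\<delta> \<le> 1"
  shows "norm (deriv (Dirichlet_L \<psi>) (1 + of_real \<delta>) / Dirichlet_L \<psi> (1 + of_real \<delta>)) \<le> 9 / \<delta>"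
proof -
  let ?s = "1 + complex_of_real \<delta>" and ?a = "\<lambda>n. \<psi> (int n)"
  note a = dirichlet_char_completely_multiplicative[OF \<psi>]
  have s: "Re ?s > 1" using \<delta> by simp
  have "(Dirichlet_L \<psi> has_field_derivative dirichlet_series ?a ?s * - dirichlet_series (twisted_mangoldt ?a) ?s) (at ?s)"
  proof (rule has_field_derivative_transform_within_open[OF dirichlet_series_log_deriv[OF a s]])
    show "open {s. Re s > 1}" by (rule open_halfspace_Re_gt)
  qed (use s Dirichlet_L_eq_dirichlet_series[OF mz] in auto)
  then have "deriv (Dirichlet_L \<psi>) ?s = Dirichlet_L \<psi> ?s * - dirichlet_series (twisted_mangoldt ?a) ?s"
    using Dirichlet_L_eq_dirichlet_series[OF mz s] by (simp add: DERIV_imp_deriv)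
  then have "norm (deriv (Dirichlet_L \<psi>) ?s / Dirichlet_L \<psi> ?s) = norm (dirichlet_series (twisted_mangoldt ?a) ?s)"
    using Dirichlet_L_nonzero_right[OF mz \<psi> s] by (simp add: norm_mult norm_divide)
  also have "\<dots> \<le> mangoldt_series (1 + \<delta>)"
    using norm_dirichlet_series_mangoldt_le[OF a s] by simp
  also have "\<dots> \<le> (1 + 2 / \<delta>)\<^sup>2 * \<delta>" by (rule mangoldt_series_le[OF \<delta>(1)])
  also have "\<dots> \<le> (3 / \<delta>)\<^sup>2 * \<delta>"
    using \<delta> by (intro mult_right_mono power_mono) (auto simp: field_simps)
  also have "\<dots> = 9 / \<delta>" using \<delta> by (simp add: power2_eq_square)
  finally show ?thesis .
qed

text \<open>The estimate at \<open>s = 1\<close> is transported from \<open>s = 1 + 1 / sqrt (\<phi> * ln q)\<close>, where the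
  Dirichlet series converges; \<open>E\<close> is the set of exceptional zeros.\<close>

lemma Re_log_deriv_Dirichlet_L_at_one:
  fixes K :: real
  assumes K: "K \<ge> 1"
  shows "\<exists>C>0. \<forall>q \<psi> \<phi> E. mean_zero_periodic q \<psi> \<longrightarrow> dirichlet_char q \<psi> \<longrightarrow> ln (real q) \<ge> 1 \<longrightarrow>
    1 \<le> \<phi> \<longrightarrow> \<phi> \<le> K * ln (real q) \<longrightarrow> Dirichlet_L \<psi> 1 \<noteq> 0 \<longrightarrow> finite E \<longrightarrow> card E \<le> 1 \<longrightarrow>
    (\<forall>z\<in>E. z \<in> cball 2 (5/4) \<and> Dirichlet_L \<psi> z = 0 \<and> z \<in> \<real> \<and> Re z < 1 \<and> zorder (Dirichlet_L \<psi>) z = 1) \<longrightarrow>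
    (\<forall>z\<in>cball 2 (5/4) - E. Dirichlet_L \<psi> z = 0 \<longrightarrow> Re z \<le> 1 - 1 / \<phi>) \<longrightarrow>
    \<bar>Re (deriv (Dirichlet_L \<psi>) 1 / Dirichlet_L \<psi> 1) - (\<Sum>z\<in>E. Re (1 / (1 - z)))\<bar> \<le> C * sqrt (\<phi> * ln (real q))"
proof -
  obtain C0 where C0: "C0 > 0" "\<And>q a s. mean_zero_periodic q a \<Longrightarrow> (\<forall>n. norm (a n) \<le> 1) \<Longrightarrow> s \<in> cball 2 (5/2) \<Longrightarrow> 
      norm (periodic_L q a s) \<le> C0 * real q ^ 2"
    using periodic_L_growth by blast
  \<comment> \<open>\<open>C1\<close> will bound ln M / ln q, and \<open>C2\<close> the sum of the
    real parts over the unexceptional zeros at 1 + \<delta>, divided by ln q. The numbers 2432 =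
    3040 / (5/4) and 77824 = 121600 / (5/4)^2 come from the local factorization; the 10 is 9 from
    the Dirichlet series plus 1 from the exceptional zero.\<close>
  define C1 where "C1 = ln (4 * (C0 + 1)) + 2"
  have lnC0: "ln (4 * (C0 + 1)) \<ge> 0" using C0 by simp
  then have C1: "C1 > 0" by (simp add: C1_def)
  define C2 where "C2 = 9 * K + 2432 * C1"
  have C2: "C2 > 0" using K C1 by (simp add: C2_def)
  define C where "C = 77824 * C1 + (1 + K) * C2 + 10"
  have C: "C > 0" using K C1 C2 by (simp add: C_def add_pos_pos)
  show ?thesis
  proof (intro exI[of _ C] conjI C allI impI)
    fix q :: nat and \<psi> :: "int \<Rightarrow> complex" and \<phi> :: real and E :: "complex set"
    assume mz: "mean_zero_periodic q \<psi>" and \<psi>: "dirichlet_char q \<psi>" and l1: "ln (real q) \<ge> 1"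
      and \<phi>: "1 \<le> \<phi>" "\<phi> \<le> K * ln (real q)" and L1: "Dirichlet_L \<psi> 1 \<noteq> 0" and E: "finite E" "card E \<le> 1"
      and EZ: "\<forall>z\<in>E. z \<in> cball 2 (5/4) \<and> Dirichlet_L \<psi> z = 0 \<and> z \<in> \<real> \<and> Re z < 1 \<and> zorder (Dirichlet_L \<psi>) z = 1"
      and nE: "\<forall>z\<in>cball 2 (5/4) - E. Dirichlet_L \<psi> z = 0 \<longrightarrow> Re z \<le> 1 - 1 / \<phi>"
    define L where "L = Dirichlet_L \<psi>"
    define l where "l = ln (real q)"
    define R where "R = sqrt (\<phi> * l)"
    define \<delta> where "\<delta> = 1 / R"
    have l: "l \<ge> 1" using l1 by (simp add: l_def)
    have q: "q > 0" using mz by (simp add: mean_zero_periodic_def)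
    have "1 * 1 \<le> \<phi> * l" using \<phi> l by (intro mult_mono) auto
    then have R1: "R \<ge> 1" by (simp add: R_def)
    have R2: "R * R = \<phi> * l" using \<phi> l by (simp add: R_def)
    have \<delta>: "0 < \<delta>" "\<delta> \<le> 1" using R1 by (auto simp: \<delta>_def)
    have l\<delta>: "l * \<delta> \<le> R"
    proof -
      have "l * 1 \<le> \<phi> * l" using \<phi> l by simp
      then show ?thesis using R1 R2 by (simp add: \<delta>_def field_simps)
    qed
    have \<delta>\<phi>l: "\<delta> * \<phi> * l = R" using R1 R2 by (simp add: \<delta>_def field_simps)
    \<comment> \<open>This keeps the factor \<open>1 + \<delta> * \<phi>\<close> bounded; it follows
      from \<phi>^2 \<le> K \<phi> l = K R^2.\<close>
    have \<delta>\<phi>: "\<delta> * \<phi> \<le> K"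
    proof -
      have "\<phi>\<^sup>2 \<le> (K * l) * \<phi>" using \<phi> by (simp add: power2_eq_square l_def)
      also have "\<dots> = K * (R * R)" unfolding R2 by simp
      also have "\<dots> \<le> K * K * (R * R)" using K R1 by (intro mult_right_mono) auto
      finally have "\<phi>\<^sup>2 \<le> (K * R)\<^sup>2" by (simp add: power2_eq_square algebra_simps)
      then have "\<phi> \<le> K * R" using K R1 by (intro power2_le_imp_le[of \<phi>]) auto
      then show ?thesis using R1 by (simp add: \<delta>_def field_simps)
    qed
    have RK: "R \<le> K * l"
    proof -
      have "R\<^sup>2 \<le> (K * l) * l" unfolding power2_eq_square R2 using \<phi> l by (intro mult_right_mono) (auto simp: l_def)
      also have "\<dots> \<le> (K * l) * (K * l)" using K l by (intro mult_left_mono) auto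
      finally have "R\<^sup>2 \<le> (K * l)\<^sup>2" by (simp add: power2_eq_square)
      then show ?thesis using K l by (intro power2_le_imp_le[of R]) auto
    qed
    \<comment> \<open>The 4 compensates for |L(2)| being only known to be at least 1/4; the + 1
      ensures M > 1.\<close>
    define M where "M = 4 * (C0 + 1) * real q ^ 2"
    have hol: "L holomorphic_on UNIV" unfolding L_def by (rule Dirichlet_L_holomorphic[OF mz])
    have L2: "norm (L 2) \<ge> 1 / 4"
      using norm_dirichlet_series_ge[OF dirichlet_char_completely_multiplicative[OF \<psi>], of 2]
      by (simp add: L_def Dirichlet_L_eq_dirichlet_series[OF mz])
    have "real q ^ 2 \<ge> 1" using q by simp
    have "1 * 1 \<le> (C0 + 1) * real q ^ 2" using C0(1) \<open>real q ^ 2 \<ge> 1\<close> by (intro mult_mono) linarith+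
    then have M: "M > 1" unfolding M_def by linarith
    have "ln M = ln (4 * (C0 + 1)) + 2 * l"
      using C0 q unfolding M_def l_def by (subst ln_mult) (auto simp: ln_realpow)
    also have "\<dots> \<le> ln (4 * (C0 + 1)) * l + 2 * l" using mult_left_mono[OF l lnC0] by simp
    finally have lnM: "ln M \<le> C1 * l" by (simp add: C1_def algebra_simps)
    have bound: "norm (L s) \<le> M * norm (L 2)" if "s \<in> cball 2 (2 * (5/4))" for s
    proof -
      have "norm (L s) \<le> C0 * real q ^ 2"
        unfolding L_def Dirichlet_L_eq_periodic_L[OF mz] 
        using that dirichlet_char_norm_le[OF \<psi>] by (intro C0(2) mz) auto
      also have "\<dots> \<le> M * (1 / 4)" using C0 by (simp add: M_def algebra_simps)
      also have "\<dots> \<le> M * norm (L 2)" using L2 M by (intro mult_left_mono) auto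
      finally show ?thesis .
    qed
    have L2nz: "L 2 \<noteq> 0" using L2 by auto
    have pos: "(5/4 :: real) > 0" and sub: "cball (2::complex) (2 * (5/4)) \<subseteq> UNIV" by simp_all
    obtain Z Er where Z: "finite Z" "Z = {z \<in> cball 2 (5/4). L z = 0}" and
      dL: "\<And>s. s \<in> ball 2 (5/4) \<Longrightarrow> L s \<noteq> 0 \<Longrightarrow> 
        deriv L s / L s = Er s + (\<Sum>z\<in>Z. of_nat (nat (zorder L z)) / (s - z))" and
      Er: "\<And>s. dist 2 s \<le> 9 / 10 * (5/4) \<Longrightarrow> norm (Er s) \<le> 3040 * ln M / (5/4)" and
      Er': "\<And>s s'. dist 2 s \<le> 9 / 10 * (5/4) \<Longrightarrow> dist 2 s' \<le> 9 / 10 * (5/4) \<Longrightarrow>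
        norm (Er s - Er s') \<le> 121600 * ln M / (5/4) ^ 2 * norm (s - s')"
    proof (rule local_factorization_log_deriv_bounds[OF hol open_UNIV connected_UNIV pos sub L2nz M bound], goal_cases)
      case (2 Z Er)
      from that[OF 2(2-)] show ?case .
    qed
    let ?s = "1 + complex_of_real \<delta>"
    have d1: "dist (2 :: complex) 1 = 1" by (simp add: dist_norm)
    have "2 - ?s = of_real (1 - \<delta>)" by simp
    then have d2: "dist (2 :: complex) ?s \<le> 1"
      unfolding dist_norm using \<delta> by (simp only: norm_of_real)
    define T where "T = (\<lambda>s. \<Sum>z\<in>Z - E. of_nat (nat (zorder L z)) / (s - z))"
    define X where "X = (\<lambda>s. \<Sum>z\<in>E. 1 / (s - z))"
    have ld: "deriv L s / L s = Er s + T s + X s" if "dist 2 s \<le> 1" "L s \<noteq> 0" for s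
    proof -
      have EsubZ: "E \<subseteq> Z" using EZ Z by (auto simp: L_def)
      have "(\<Sum>z\<in>Z. of_nat (nat (zorder L z)) / (s - z)) = T s + (\<Sum>z\<in>E. of_nat (nat (zorder L z)) / (s - z))"
        unfolding T_def using sum.subset_diff[OF EsubZ Z(1)] by simp
      also have "(\<Sum>z\<in>E. of_nat (nat (zorder L z)) / (s - z)) = X s"
        unfolding X_def using EZ by (intro sum.cong) (auto simp: L_def)
      finally show ?thesis using dL[of s] that by (simp add: algebra_simps)
    qed
    have Ls: "L ?s \<noteq> 0" unfolding L_def using \<delta> by (intro Dirichlet_L_nonzero_right[OF mz \<psi>]) auto
    have at1: "Re (deriv L 1 / L 1) = Re (Er 1) + Re (T 1) + Re (X 1)"
      using ld[of 1] d1 L1 by (simp add: L_def)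
    have ats: "Re (deriv L ?s / L ?s) = Re (Er ?s) + Re (T ?s) + Re (X ?s)"
      using ld[OF d2 Ls] by simp
    have G: "\<bar>Re (deriv L ?s / L ?s)\<bar> \<le> 9 * R"
      using norm_log_deriv_Dirichlet_L_le[OF mz \<psi> \<delta>] abs_Re_le_cmod[of "deriv L ?s / L ?s"]
      by (simp add: L_def \<delta>_def)
    have "norm (Er ?s) \<le> 3040 * ln M / (5/4)" using d2 by (intro Er) simp
    then have Ers: "\<bar>Re (Er ?s)\<bar> \<le> 2432 * C1 * l"
      using abs_Re_le_cmod[of "Er ?s"] lnM by simp
    have "norm (Er 1 - Er ?s) \<le> 121600 * ln M / (5/4) ^ 2 * norm (1 - ?s)"
      using d1 d2 by (intro Er') simp_all
    also have "\<dots> = 77824 * (ln M * \<delta>)" using \<delta> by (simp add: power2_eq_square)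
    also have "\<dots> \<le> 77824 * (C1 * l * \<delta>)" using lnM \<delta> by (intro mult_left_mono mult_right_mono) auto
    also have "\<dots> \<le> 77824 * (C1 * R)" using l\<delta> C1 by simp
    finally have Erd: "\<bar>Re (Er 1) - Re (Er ?s)\<bar> \<le> 77824 * C1 * R"
      using abs_Re_le_cmod[of "Er 1 - Er ?s"] by simp
    have Xs: "0 \<le> Re (X ?s) \<and> Re (X ?s) \<le> R"
    proof (cases "E = {}")
      case True
      then show ?thesis using R1 by (simp add: X_def)
    next
      case False
      then obtain z where z: "E = {z}" using E by (metis card_1_singletonE card_0_eq le_antisym less_one not_le)
      then obtain b where b: "z = of_real b" "b < 1" using EZ by (auto elim!: Reals_cases)
      have "X ?s = of_real (1 / (1 + \<delta> - b))" by (simp add: X_def z b)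
      then have "Re (X ?s) = 1 / (1 + \<delta> - b)" by (simp only: Re_complex_of_real)
      moreover have "1 / (1 + \<delta> - b) \<le> 1 / \<delta>" using b \<delta> by (intro divide_left_mono) auto
      moreover have "1 / \<delta> = R" by (simp add: \<delta>_def)
      moreover have "0 \<le> 1 / (1 + \<delta> - b)" using b \<delta> by simp
      ultimately show ?thesis by simp
    qed
    have ReX1: "Re (X 1) = (\<Sum>z\<in>E. Re (1 / (1 - z)))" by (simp add: X_def)
    have summand: "0 \<le> Re (of_nat n / (?s - z)) \<and> \<bar>Re (of_nat n / (1 - z)) - Re (of_nat n / (?s - z))\<bar> \<le> \<delta> * \<phi> * (1 + \<delta> * \<phi>) * Re (of_nat n / (?s - z))"
      if z: "z \<in> Z - E" for z n
    proof -
      have "Re z \<le> 1 - 1 / \<phi>" using z nE Z by (auto simp: L_def)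
      then have *: "0 \<le> Re (1 / (?s - z))" "\<bar>Re (1 / (1 - z)) - Re (1 / (?s - z))\<bar> \<le> \<delta> * \<phi> * (1 + \<delta> * \<phi>) * Re (1 / (?s - z))"
        using \<phi> \<delta> by (intro inverse_diff_shift_bound; simp)+
      have e: "Re (of_nat n / w) = real n * Re (1 / w)" for w
        by (simp add: Re_divide)
      have "\<bar>real n * Re (1 / (1 - z)) - real n * Re (1 / (?s - z))\<bar> = real n * \<bar>Re (1 / (1 - z)) - Re (1 / (?s - z))\<bar>"
        by (simp only: right_diff_distrib[symmetric] abs_mult abs_of_nat)
      also have "\<dots> \<le> real n * (\<delta> * \<phi> * (1 + \<delta> * \<phi>) * Re (1 / (?s - z)))"
        using *(2) by (intro mult_left_mono) auto
      finally show ?thesis unfolding e using *(1) by (simp only: mult_ac) (simp add: mult_ac)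
    qed
    have "\<bar>Re (T 1) - Re (T ?s)\<bar> = \<bar>\<Sum>z\<in>Z - E. (Re (of_nat (nat (zorder L z)) / (1 - z)) - Re (of_nat (nat (zorder L z)) / (?s - z)))\<bar>"
      by (simp only: T_def Re_sum sum_subtractf)
    also have "\<dots> \<le> (\<Sum>z\<in>Z - E. \<delta> * \<phi> * (1 + \<delta> * \<phi>) * Re (of_nat (nat (zorder L z)) / (?s - z)))"
      using summand by (intro order_trans[OF sum_abs] sum_mono) blast
    also have "\<dots> = \<delta> * \<phi> * (1 + \<delta> * \<phi>) * Re (T ?s)"
      by (simp only: T_def Re_sum sum_distrib_left)
    also have "\<dots> \<le> \<delta> * \<phi> * (1 + K) * (C2 * l)"
    proof -
      \<comment> \<open>The total weight of the unexceptional zeros is read off from L'/L at 1 +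
        \<delta>; it is O(l) because R \<le> K l.\<close>
      have "Re (T ?s) = Re (deriv L ?s / L ?s) - Re (Er ?s) - Re (X ?s)" using ats by simp
      also have "\<dots> \<le> 9 * R + 2432 * C1 * l" using G Ers Xs by linarith
      also have "\<dots> \<le> 9 * (K * l) + 2432 * C1 * l" using RK by simp
      finally have "Re (T ?s) \<le> C2 * l" by (simp add: C2_def algebra_simps)
      moreover have "0 \<le> Re (T ?s)" unfolding T_def Re_sum using summand by (intro sum_nonneg) blast
      ultimately show ?thesis using \<delta>\<phi> \<delta> \<phi> K by (intro mult_mono) auto
    qed
    also have "\<dots> = (1 + K) * C2 * (\<delta> * \<phi> * l)" by simp
    finally have Td: "\<bar>Re (T 1) - Re (T ?s)\<bar> \<le> (1 + K) * C2 * R" unfolding \<delta>\<phi>l .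
    have "Re (deriv L 1 / L 1) - Re (X 1) = (Re (Er 1) - Re (Er ?s)) + (Re (T 1) - Re (T ?s)) + (Re (deriv L ?s / L ?s) - Re (X ?s))"
      using at1 ats by simp
    then have "\<bar>Re (deriv L 1 / L 1) - Re (X 1)\<bar> \<le> 77824 * C1 * R + (1 + K) * C2 * R + (9 * R + R)"
      using Erd Td G Xs by linarith
    then show "\<bar>Re (deriv (Dirichlet_L \<psi>) 1 / Dirichlet_L \<psi> 1) - (\<Sum>z\<in>E. Re (1 / (1 - z)))\<bar> \<le> C * sqrt (\<phi> * ln (real q))"
      unfolding ReX1[symmetric] by (simp add: L_def C_def R_def l_def algebra_simps)
  qed
qed

text \<open>Zeros with Re z > 1, or on the line Re z = 1 away from 1, are already excluded. For Re z
  < 1 the inequality |z - 2| \<le> 5/4 leaves (Im z)^2 < 25/16 - 1 = 9/16.\<close>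

lemma zero_in_disc_location:
  assumes mz: "mean_zero_periodic q \<psi>" and \<psi>: "dirichlet_char q \<psi>" and L1: "Dirichlet_L \<psi> 1 \<noteq> 0"
    and z: "z \<in> cball 2 (5/4)" "Dirichlet_L \<psi> z = 0"
  shows "Re z < 1" "Re z > 0" "\<bar>Im z\<bar> < 3 / 4"
proof -
  have "(norm (z - 2))\<^sup>2 \<le> (5/4)\<^sup>2" using z by (intro power_mono) (auto simp: dist_norm norm_minus_commute)
  moreover have sq: "(5/4 :: real)\<^sup>2 = 25 / 16" by (simp add: power2_eq_square)
  ultimately have nz: "(Re z - 2)\<^sup>2 + (Im z)\<^sup>2 \<le> 25 / 16" by (simp add: cmod_power2)
  have "(Re z - 2)\<^sup>2 \<le> (5/4)\<^sup>2" unfolding sq using nz zero_le_power2[of "Im z"] by linarith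
  then have "\<bar>Re z - 2\<bar> \<le> 5/4" using abs_le_square_iff[of "Re z - 2" "5/4"] by simp
  then show Re0: "Re z > 0" by linarith
  have "\<not> Re z > 1" using Dirichlet_L_nonzero_right[OF mz \<psi>] z by blast
  moreover have "Re z \<noteq> 1"
  proof
    assume 1: "Re z = 1"
    then have "(Im z)\<^sup>2 \<le> (3/4)\<^sup>2" using nz by (simp add: power2_eq_square)
    then have "\<bar>Im z\<bar> \<le> 3/4" using abs_le_square_iff[of "Im z" "3/4"] by simp
    then have "Im z = 0" using Dirichlet_L_nonzero_line[OF mz \<psi> 1] z by linarith
    then have "z = 1" using 1 by (simp add: complex_eq_iff)
    then show False using L1 z by simp
  qed
  ultimately show Re1: "Re z < 1" by linarith
  have "1\<^sup>2 < (2 - Re z)\<^sup>2" using Re1 by (intro power_strict_mono) auto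
  then have "(Im z)\<^sup>2 < (3/4)\<^sup>2" using nz by (simp add: power2_eq_square algebra_simps)
  then show "\<bar>Im z\<bar> < 3 / 4" using power2_less_imp_less[of "\<bar>Im z\<bar>" "3/4"] by simp
qed

text \<open>Difference quotients along 1 + 1/(n + 1) are real and the reals are closed. So for real
  characters the estimate of the real part is one of the quotient itself.\<close>

lemma Dirichlet_L_log_deriv_real:
  assumes mz: "mean_zero_periodic q \<psi>" and real: "real_char \<psi>"
  shows "deriv (Dirichlet_L \<psi>) 1 / Dirichlet_L \<psi> 1 \<in> \<real>"
proof -
  let ?L = "Dirichlet_L \<psi>"
  have L: "?L (of_real x) \<in> \<real>" for x
    using Dirichlet_L_cnj[OF mz real, of "of_real x"] by (simp add: Reals_cnj_iff)
  have lim: "(\<lambda>n. of_real (inverse (real (Suc n)))) \<longlonglongrightarrow> (0 :: complex)"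
    using tendsto_of_real[OF LIMSEQ_inverse_real_of_nat, where 'a = complex] by simp
  have "(?L has_field_derivative deriv ?L 1) (at 1)"
    using Dirichlet_L_holomorphic[OF mz, of UNIV] by (auto intro: holomorphic_derivI)
  then have "((\<lambda>h. (?L (1 + h) - ?L 1) / h) \<longlongrightarrow> deriv ?L 1) (at 0)" by (simp add: DERIV_def)
  moreover have "filterlim (\<lambda>n. of_real (inverse (real (Suc n))) :: complex) (at 0) sequentially"
    using lim by (auto simp: filterlim_at simp del: of_nat_Suc)
  ultimately have lim1: "(\<lambda>n. (?L (1 + of_real (inverse (real (Suc n)))) - ?L 1) / of_real (inverse (real (Suc n)))) \<longlonglongrightarrow> deriv ?L 1"
    by (rule filterlim_compose)
  have inR: "(?L (1 + of_real h) - ?L 1) / of_real h \<in> \<real>" for h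
  proof -
    have e: "1 + of_real h = complex_of_real (1 + h)" by simp
    show ?thesis using L[of 1] L[of "1 + h"] unfolding e by (intro Reals_divide Reals_diff Reals_of_real) simp_all
  qed
  have "deriv ?L 1 \<in> \<real>"
    by (rule closed_sequentially[OF closed_complex_Reals inR lim1])
  then show ?thesis using L[of 1] by (intro Reals_divide) auto
qed

text \<open>The set of real zeros is closed, nonempty and bounded above by 1, so it contains its
  supremum, and \<open>GREATEST\<close> denotes that.\<close>

lemma largest_real_zero_properties:
  assumes mz: "mean_zero_periodic q \<psi>" and \<psi>: "dirichlet_char q \<psi>" and q: "q \<ge> 2"
  defines "\<beta> \<equiv> (GREATEST \<beta>. Dirichlet_L \<psi> (of_real \<beta>) = 0)"
  shows "Dirichlet_L \<psi> (of_real \<beta>) = 0" "\<beta> \<le> 1" "\<And>x. Dirichlet_L \<psi> (of_real x) = 0 \<Longrightarrow> x \<le> \<beta>"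
proof -
  let ?Z = "{x. Dirichlet_L \<psi> (of_real x) = 0}"
  have le1: "x \<le> 1" if "x \<in> ?Z" for x
    using Dirichlet_L_nonzero_right[OF mz \<psi>, of "of_real x"] that by (force simp: not_le[symmetric])
  have "continuous_on UNIV (\<lambda>x. Dirichlet_L \<psi> (of_real x))"
    using holomorphic_on_imp_continuous_on[OF Dirichlet_L_holomorphic[OF mz, of UNIV]]
    by (rule continuous_on_compose2) (auto intro!: continuous_intros)
  then have "closed ?Z"
    using continuous_closed_preimage_constant[of UNIV "\<lambda>x. Dirichlet_L \<psi> (of_real x)" 0] by simp
  moreover have "?Z \<noteq> {}" using Dirichlet_L_real_zero_exists[OF mz \<psi> q] by blast
  moreover have bdd: "bdd_above ?Z" using le1 by (intro bdd_aboveI)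
  ultimately have S: "Sup ?Z \<in> ?Z" by (intro closed_contains_Sup)
  have up: "x \<le> Sup ?Z" if "x \<in> ?Z" for x using that bdd by (rule cSup_upper)
  have "\<beta> = Sup ?Z" unfolding \<beta>_def using S up by (intro Greatest_equality) auto
  then show "Dirichlet_L \<psi> (of_real \<beta>) = 0" "\<beta> \<le> 1" "\<And>x. Dirichlet_L \<psi> (of_real x) = 0 \<Longrightarrow> x \<le> \<beta>"
    using S up le1 by auto
qed

text \<open>The threshold 16 makes the square root at least 4, so the height allowed in the region
  is at least 3/4, above |Im z| for every zero in the disc.\<close>

lemma zero_in_disc_in_Q_region:
  assumes mz: "mean_zero_periodic q \<psi>" and \<psi>: "dirichlet_char q \<psi>" and L1: "Dirichlet_L \<psi> 1 \<noteq> 0"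
    and z: "z \<in> cball 2 (5/4)" "Dirichlet_L \<psi> z = 0" "Re z > 1 - 1 / f q"
    and f: "f q * ln (real q) \<ge> 16"
  shows "z \<in> Q_region q f \<inter> critical_strip"
proof -
  note loc = zero_in_disc_location[OF mz \<psi> L1 z(1,2)]
  have "sqrt (f q * ln (real q)) \<ge> 4" using real_sqrt_le_mono[OF f] by simp
  then have "1 / sqrt (f q * ln (real q)) \<le> 1 / 4" using f by (intro divide_left_mono) auto
  then show ?thesis using loc z by (auto simp: Q_region_def critical_strip_def)
qed

lemma log_deriv_complex_char_bound:
  assumes K: "K \<ge> 1"
  shows "\<exists>C>0. \<forall>q \<psi> f. primitive_char q \<psi> \<longrightarrow> \<not> real_char \<psi> \<longrightarrow> q \<ge> 2 \<longrightarrow> ln (real q) \<ge> 8 \<longrightarrow> 2 \<le> f q \<longrightarrow> 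
    f q \<le> K * ln (real q) \<longrightarrow> quasi_zero_free q (Q_region q f \<inter> critical_strip) \<longrightarrow>
    \<bar>Re (deriv (Dirichlet_L \<psi>) 1 / Dirichlet_L \<psi> 1)\<bar> \<le> C * sqrt (f q * ln (real q))"
proof -
  from Re_log_deriv_Dirichlet_L_at_one[OF K] obtain C where C: "C > 0" and
    *: "\<And>q \<psi> \<phi> E. mean_zero_periodic q \<psi> \<Longrightarrow> dirichlet_char q \<psi> \<Longrightarrow> ln (real q) \<ge> 1 \<Longrightarrow>
    1 \<le> \<phi> \<Longrightarrow> \<phi> \<le> K * ln (real q) \<Longrightarrow> Dirichlet_L \<psi> 1 \<noteq> 0 \<Longrightarrow> finite E \<Longrightarrow> card E \<le> 1 \<Longrightarrow>
    (\<forall>z\<in>E. z \<in> cball 2 (5/4) \<and> Dirichlet_L \<psi> z = 0 \<and> z \<in> \<real> \<and> Re z < 1 \<and> zorder (Dirichlet_L \<psi>) z = 1) \<Longrightarrow>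
    (\<forall>z\<in>cball 2 (5/4) - E. Dirichlet_L \<psi> z = 0 \<longrightarrow> Re z \<le> 1 - 1 / \<phi>) \<Longrightarrow>
    \<bar>Re (deriv (Dirichlet_L \<psi>) 1 / Dirichlet_L \<psi> 1) - (\<Sum>z\<in>E. Re (1 / (1 - z)))\<bar> \<le> C * sqrt (\<phi> * ln (real q))"
    by blast
  show ?thesis
  proof (intro exI[of _ C] conjI C allI impI)
    fix q \<psi> and f :: "nat \<Rightarrow> real"
    assume prim: "primitive_char q \<psi>" and cplx: "\<not> real_char \<psi>" and q: "q \<ge> 2" and l: "ln (real q) \<ge> 8"
      and f: "2 \<le> f q" "f q \<le> K * ln (real q)" and qzf: "quasi_zero_free q (Q_region q f \<inter> critical_strip)"
    note mz = primitive_char_mean_zero[OF prim q]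
    have \<psi>: "dirichlet_char q \<psi>" using prim by (simp add: primitive_char_def)
    \<comment> \<open>2 from f and 8 from the logarithm meet the threshold 16.\<close>
    have fl: "f q * ln (real q) \<ge> 16" using mult_mono[OF f(1) l] f(1) by simp
    show "\<bar>Re (deriv (Dirichlet_L \<psi>) 1 / Dirichlet_L \<psi> 1)\<bar> \<le> C * sqrt (f q * ln (real q))"
    proof (cases "Dirichlet_L \<psi> 1 = 0")
      case True
      \<comment> \<open>division by zero: the left-hand side is 0\<close>
      then show ?thesis using C fl by simp
    next
      case False
      have "\<forall>z\<in>cball 2 (5/4) - {}. Dirichlet_L \<psi> z = 0 \<longrightarrow> Re z \<le> 1 - 1 / f q"
      proof (intro ballI impI, rule ccontr)
        fix z assume z: "z \<in> cball 2 (5/4) - {}" "Dirichlet_L \<psi> z = 0" "\<not> Re z \<le> 1 - 1 / f q"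
        then have "z \<in> Q_region q f \<inter> critical_strip"
          using fl by (intro zero_in_disc_in_Q_region[OF mz \<psi> False]) auto
        then show False using qzf prim cplx z unfolding quasi_zero_free_def by blast
      qed
      then show ?thesis
        using *[OF mz \<psi>, of "f q" "{}"] l f False by simp
    qed
  qed
qed

text \<open>Beyond 1 - 1/f(q) the disc contains at most one zero. If there is one, it is \<beta>. If
  there is none, 1/(1 - \<beta>) is itself O(sqrt(f(q) ln q)) and is absorbed, which adds K + 4 to
  the constant.\<close>

lemma log_deriv_real_char_bound:
  assumes K: "K \<ge> 1"
  shows "\<exists>C>0. \<forall>q \<psi> f. primitive_char q \<psi> \<longrightarrow> real_char \<psi> \<longrightarrow> q \<ge> 2 \<longrightarrow> ln (real q) \<ge> 8 \<longrightarrow> 2 \<le> f q \<longrightarrow> 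
    f q \<le> K * ln (real q) \<longrightarrow> quasi_zero_free q (Q_region q f \<inter> critical_strip) \<longrightarrow>
    cmod (deriv (Dirichlet_L \<psi>) 1 / Dirichlet_L \<psi> 1 - of_real (1 / (1 - (GREATEST \<beta>. Dirichlet_L \<psi> (of_real \<beta>) = 0))))
      \<le> C * sqrt (f q * ln (real q))"
proof -
  from Re_log_deriv_Dirichlet_L_at_one[OF K] obtain C where C: "C > 0" and
    *: "\<And>q \<psi> \<phi> E. mean_zero_periodic q \<psi> \<Longrightarrow> dirichlet_char q \<psi> \<Longrightarrow> ln (real q) \<ge> 1 \<Longrightarrow>
    1 \<le> \<phi> \<Longrightarrow> \<phi> \<le> K * ln (real q) \<Longrightarrow> Dirichlet_L \<psi> 1 \<noteq> 0 \<Longrightarrow> finite E \<Longrightarrow> card E \<le> 1 \<Longrightarrow>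
    (\<forall>z\<in>E. z \<in> cball 2 (5/4) \<and> Dirichlet_L \<psi> z = 0 \<and> z \<in> \<real> \<and> Re z < 1 \<and> zorder (Dirichlet_L \<psi>) z = 1) \<Longrightarrow>
    (\<forall>z\<in>cball 2 (5/4) - E. Dirichlet_L \<psi> z = 0 \<longrightarrow> Re z \<le> 1 - 1 / \<phi>) \<Longrightarrow>
    \<bar>Re (deriv (Dirichlet_L \<psi>) 1 / Dirichlet_L \<psi> 1) - (\<Sum>z\<in>E. Re (1 / (1 - z)))\<bar> \<le> C * sqrt (\<phi> * ln (real q))"
    by blast
  show ?thesis
  proof (intro exI[of _ "C + K + 4"] conjI allI impI)
    show "C + K + 4 > 0" using C K by simp
    fix q \<psi> and f :: "nat \<Rightarrow> real"
    assume prim: "primitive_char q \<psi>" and real: "real_char \<psi>" and q: "q \<ge> 2" and l: "ln (real q) \<ge> 8"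
      and f: "2 \<le> f q" "f q \<le> K * ln (real q)" and qzf: "quasi_zero_free q (Q_region q f \<inter> critical_strip)"
    note mz = primitive_char_mean_zero[OF prim q]
    have \<psi>: "dirichlet_char q \<psi>" using prim by (simp add: primitive_char_def)
    have fl: "f q * ln (real q) \<ge> 16" using mult_mono[OF f(1) l] f(1) by simp
    define R where "R = sqrt (f q * ln (real q))"
    have R4: "R \<ge> 4" using real_sqrt_le_mono[OF fl] by (simp add: R_def)
    have R2: "R * R = f q * ln (real q)" using fl by (simp add: R_def)
    define \<beta> where "\<beta> = (GREATEST \<beta>. Dirichlet_L \<psi> (of_real \<beta>) = 0)"
    note \<beta> = largest_real_zero_properties[OF mz \<psi> q, folded \<beta>_def]
    let ?Q = "Q_region q f \<inter> critical_strip"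
    have uniq: "z = z'" if "z \<in> ?Q" "z' \<in> ?Q" "Dirichlet_L \<psi> z = 0" "Dirichlet_L \<psi> z' = 0" for z z'
      using qzf prim real that unfolding quasi_zero_free_def Uniq_def by blast
    have simple: "z \<in> \<real> \<and> zorder (Dirichlet_L \<psi>) z = 1" if "z \<in> ?Q" "Dirichlet_L \<psi> z = 0" for z
      using qzf prim real that unfolding quasi_zero_free_def by blast
    show "cmod (deriv (Dirichlet_L \<psi>) 1 / Dirichlet_L \<psi> 1 - of_real (1 / (1 - (GREATEST \<beta>. Dirichlet_L \<psi> (of_real \<beta>) = 0))))
      \<le> (C + K + 4) * sqrt (f q * ln (real q))"
      unfolding \<beta>_def[symmetric] R_def[symmetric]
    proof (cases "Dirichlet_L \<psi> 1 = 0")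
      case True
      \<comment> \<open>both quotients are divisions by zero, so that \<open>L(1) \<noteq> 0\<close> is never needed\<close>
      then have "\<beta> = 1" using \<beta>(2) \<beta>(3)[of 1] by simp
      then show "cmod (deriv (Dirichlet_L \<psi>) 1 / Dirichlet_L \<psi> 1 - of_real (1 / (1 - \<beta>))) \<le> (C + K + 4) * R"
        using True C K R4 by simp
    next
      case False
      then have "\<beta> \<noteq> 1" using \<beta>(1) by auto
      then have \<beta>1: "\<beta> < 1" using \<beta>(2) by simp
      define E where "E = {z \<in> cball 2 (5/4). Dirichlet_L \<psi> z = 0 \<and> Re z > 1 - 1 / f q}"
      have EQ: "z \<in> ?Q" if "z \<in> E" for z
        using that fl by (intro zero_in_disc_in_Q_region[OF mz \<psi> False]) (auto simp: E_def)
      have Esub: "\<exists>e. E \<subseteq> {e}" 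
      proof (cases "E = {}")
        case False
        then obtain e where "e \<in> E" by blast
        have "z = e" if "z \<in> E" for z
          by (rule uniq[OF EQ[OF that] EQ[OF \<open>e \<in> E\<close>]]) (use that \<open>e \<in> E\<close> in \<open>auto simp: E_def\<close>)
        then have "E \<subseteq> {e}" by blast
        then show ?thesis by blast
      qed auto
      then obtain e where e: "E \<subseteq> {e}" by blast
      have finE: "finite E" using e finite_subset by blast
      have cardE: "card E \<le> 1" using card_mono[OF _ e] by simp
      have "\<bar>Re (deriv (Dirichlet_L \<psi>) 1 / Dirichlet_L \<psi> 1) - (\<Sum>z\<in>E. Re (1 / (1 - z)))\<bar> \<le> C * sqrt (f q * ln (real q))"
      proof (rule *[OF mz \<psi> _ _ f(2) False finE cardE])
        show "\<forall>z\<in>E. z \<in> cball 2 (5/4) \<and> Dirichlet_L \<psi> z = 0 \<and> z \<in> \<real> \<and> Re z < 1 \<and> zorder (Dirichlet_L \<psi>) z = 1"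
          using EQ simple zero_in_disc_location(1)[OF mz \<psi> False] unfolding E_def by blast
        show "\<forall>z\<in>cball 2 (5/4) - E. Dirichlet_L \<psi> z = 0 \<longrightarrow> Re z \<le> 1 - 1 / f q"
          unfolding E_def by auto
      qed (use l f in auto)
      then have main: "\<bar>Re (deriv (Dirichlet_L \<psi>) 1 / Dirichlet_L \<psi> 1) - (\<Sum>z\<in>E. Re (1 / (1 - z)))\<bar> \<le> C * R"
        by (simp add: R_def)
      have diff: "\<bar>(\<Sum>z\<in>E. Re (1 / (1 - z))) - 1 / (1 - \<beta>)\<bar> \<le> (K + 4) * R"
      proof (cases "E = {}")
        case True
        \<comment> \<open>For \<beta> \<ge> 3/4 the zero lies in the disc and, not being in
          \<open>E\<close>, keeps distance at least 1/f(q) from 1. Otherwise that distance exceeds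
          1/4.\<close>
        have "1 / (1 - \<beta>) \<le> f q \<or> 1 / (1 - \<beta>) \<le> 4"
        proof (cases "\<beta> \<ge> 3 / 4")
          case True
          have "2 - complex_of_real \<beta> = of_real (2 - \<beta>)" by simp
          then have "dist 2 (complex_of_real \<beta>) \<le> 5 / 4"
            unfolding dist_norm using True \<beta>1 by (simp only: norm_of_real)
          then have "\<beta> \<le> 1 - 1 / f q" using \<open>E = {}\<close> \<beta>(1) by (auto simp: E_def not_less)
          then have "1 / (1 - \<beta>) \<le> 1 / (1 / f q)" using f \<beta>1 by (intro divide_left_mono) auto
          then show ?thesis by simp
        next
          case False
          then have "1 / (1 - \<beta>) \<le> 1 / (1 / 4)" by (intro divide_left_mono) auto
          then show ?thesis by simp
        qed
        moreover have "f q \<le> K * R"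
        proof -
          have "(f q)\<^sup>2 \<le> (K * ln (real q)) * f q" using f by (simp add: power2_eq_square)
          also have "\<dots> = K * (R * R)" unfolding R2 by simp
          also have "\<dots> \<le> K * K * (R * R)" using K R4 by (intro mult_right_mono) auto
          finally have "(f q)\<^sup>2 \<le> (K * R)\<^sup>2" by (simp add: power2_eq_square algebra_simps)
          then show ?thesis using K R4 by (intro power2_le_imp_le[of "f q"]) auto
        qed
        moreover have "1 / (1 - \<beta>) > 0" using \<beta>1 by simp
        moreover have "0 \<le> K * R" using K R4 by simp
        ultimately show ?thesis using R4 True by (auto simp: algebra_simps)
      next
        case False
        then have Ee: "E = {e}" using e by blast
        then have "e \<in> \<real>" using EQ simple by (auto simp: E_def)
        then obtain b where b: "e = of_real b" by (elim Reals_cases)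
        have eE: "Dirichlet_L \<psi> e = 0" "e \<in> ?Q" "Re e > 1 - 1 / f q" using Ee EQ by (auto simp: E_def)
        have "b \<le> \<beta>" using \<beta>(3) eE b by simp
        \<comment> \<open>\<beta> lies between b and 1 on the real axis, hence in the region as
          well; uniqueness of the zero there identifies the two.\<close>
        have "of_real \<beta> \<in> ?Q"
          using eE b \<open>b \<le> \<beta>\<close> \<beta>1 by (auto simp: Q_region_def critical_strip_def)
        then have "e = of_real \<beta>" using uniq eE \<beta>(1) by blast
        then have "b = \<beta>" using b by simp
        have "1 / (1 - e) = complex_of_real (1 / (1 - \<beta>))" by (simp add: \<open>e = of_real \<beta>\<close>)
        then have "Re (1 / (1 - e)) = 1 / (1 - \<beta>)" by (simp only: Re_complex_of_real)
        then show ?thesis using K R4 by (simp add: Ee)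
      qed
      obtain r where r: "deriv (Dirichlet_L \<psi>) 1 / Dirichlet_L \<psi> 1 = of_real r"
        using Dirichlet_L_log_deriv_real[OF mz real] by (elim Reals_cases)
      have "\<bar>r - 1 / (1 - \<beta>)\<bar> \<le> (C + K + 4) * R"
        using main diff unfolding r by (simp add: algebra_simps)
      then show "cmod (deriv (Dirichlet_L \<psi>) 1 / Dirichlet_L \<psi> 1 - of_real (1 / (1 - \<beta>))) \<le> (C + K + 4) * R"
        unfolding r of_real_diff[symmetric] norm_of_real .
    qed
  qed
qed

section \<open>Kronecker symbols as primitive characters\<close>

lemma Legendre_eq_0_iff: "Legendre a p = 0 \<longleftrightarrow> p dvd a"
  by (simp add: Legendre_def cong_0_iff)

lemma Legendre_values: "Legendre a p \<in> {-1, 0, 1}"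
  by (simp add: Legendre_def)

lemma Legendre_cong: 
  assumes "[a = b] (mod p)" shows "Legendre a p = Legendre b p"
proof -
  have "[a = 0] (mod p) \<longleftrightarrow> [b = 0] (mod p)" "\<And>y. [y\<^sup>2 = a] (mod p) \<longleftrightarrow> [y\<^sup>2 = b] (mod p)"
    using assms by (simp_all add: cong_def)
  then show ?thesis by (simp add: Legendre_def QuadRes_def)
qed

lemma cong_small_values:
  fixes x y p :: int
  assumes "[x = y] (mod p)" "x \<in> {-1, 0, 1}" "y \<in> {-1, 0, 1}" "p > 2"
  shows "x = y"
proof -
  have "p dvd x - y" using assms(1) by (simp add: cong_iff_dvd_diff)
  moreover have "\<bar>x - y\<bar> < p" using assms by auto
  moreover have "p \<le> \<bar>x - y\<bar>" if "p dvd x - y" "x \<noteq> y"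
    using dvd_imp_le_int[of "x - y" p] that assms(4) by simp
  ultimately show ?thesis by linarith
qed

locale odd_prime_int =
  fixes p :: int
  assumes prime: "prime p" and gt2: "p > 2"
begin

lemma nat_prime: "prime (nat p)" "nat p > 2" "int (nat p) = p"
proof -
  show "prime (nat p)" using prime prime_int_nat_transfer[of p] by blast
  show "nat p > 2" "int (nat p) = p" using gt2 by linarith+
qed

lemma odd: "odd p"
  by (rule prime_odd_int[OF prime gt2])

lemma coprime_iff: "coprime n p \<longleftrightarrow> \<not> p dvd n"
proof
  assume "coprime n p"
  then show "\<not> p dvd n" using coprime_common_divisor[of n p p] not_prime_unit[of p] prime by auto
next
  assume "\<not> p dvd n"
  then show "coprime n p" using prime_imp_coprime[OF prime] by (simp add: coprime_commute)
qed

lemma euler: "[Legendre a p = a ^ ((nat p - 1) div 2)] (mod p)"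
  using euler_criterion[OF nat_prime(1,2), of a] nat_prime(3) by simp

text \<open>Euler's criterion fixes the symbol modulo p, and -1, 0, 1 are distinct modulo p >
  2.\<close>

lemma Legendre_eqI: 
  assumes "[x = a ^ ((nat p - 1) div 2)] (mod p)" "x \<in> {-1, 0, 1}"
  shows "Legendre a p = x"
  by (rule cong_small_values[OF cong_trans[OF euler cong_sym[OF assms(1)]] Legendre_values assms(2) gt2])

lemma Legendre_mult: "Legendre (a * b) p = Legendre a p * Legendre b p"
proof (rule Legendre_eqI)
  show "[Legendre a p * Legendre b p = (a * b) ^ ((nat p - 1) div 2)] (mod p)"
    unfolding power_mult_distrib by (intro cong_mult euler)
  show "Legendre a p * Legendre b p \<in> {-1, 0, 1}"
    using Legendre_values[of a p] Legendre_values[of b p] by auto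
qed

lemma Legendre_1 [simp]: "Legendre 1 p = 1"
  by (rule Legendre_eqI) auto

lemma even_half: "even (nat ((p - 1) div 2)) \<longleftrightarrow> p mod 4 = 1"
proof -
  have "even ((p - 1) div 2) \<longleftrightarrow> p mod 4 = 1" using odd by presburger
  then show ?thesis using gt2 by (simp add: even_nat_iff)
qed

lemma Legendre_neg_1: "Legendre (- 1) p = (if p mod 4 = 1 then 1 else - 1)"
proof (rule Legendre_eqI)
  have "(nat p - 1) div 2 = nat ((p - 1) div 2)"
    using gt2 by (simp add: nat_div_distrib nat_diff_distrib)
  then have "even ((nat p - 1) div 2) \<longleftrightarrow> p mod 4 = 1"
    using even_half by simp
  then show "[(if p mod 4 = 1 then 1 else - 1) = (- 1) ^ ((nat p - 1) div 2)] (mod p)"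
    by simp
qed auto

text \<open>Gauss's lemma: with p = 2h + 1 the doubles 2x for 0 < x \<le> h are already reduced, and
  h - h div 2 of them exceed h.\<close>

lemma Legendre_2: "Legendre 2 p = (if p mod 8 = 1 \<or> p mod 8 = 7 then 1 else - 1)"
proof -
  have G: "GAUSS (nat p) 2"
  proof
    show "[2 \<noteq> 0] (mod int (nat p))" using gt2 zdvd_imp_le[of p 2] nat_prime by (auto simp: cong_0_iff)
  qed (use nat_prime in auto)
  define h where "h = (p - 1) div 2"
  have h: "p = 2 * h + 1" using odd by (auto simp: h_def elim: oddE)
  have C: "GAUSS.C (nat p) 2 = (\<lambda>x. x * 2) ` {0<..h}"
    unfolding GAUSS.C_def[OF G] GAUSS.B_def[OF G] GAUSS.A_def[OF G] nat_prime(3) image_image h_def[symmetric]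
    by (intro image_cong refl mod_pos_pos_trivial) (use h in auto)
  have "GAUSS.E (nat p) 2 = (\<lambda>x. x * 2) ` {h div 2<..h}"
    unfolding GAUSS.E_def[OF G] C nat_prime(3) h_def[symmetric] by (auto simp: h)
  moreover have "inj_on (\<lambda>x :: int. x * 2) {h div 2<..h}" by (auto simp: inj_on_def)
  ultimately have "card (GAUSS.E (nat p) 2) = nat (h - h div 2)" by (simp add: card_image)
  then have L: "Legendre 2 p = (- 1) ^ nat (h - h div 2)"
    using GAUSS.gauss_lemma[OF G] nat_prime(3) by simp
  have "h \<ge> 0" using gt2 by (simp add: h_def)
  then have "even (nat (h - h div 2)) \<longleftrightarrow> even (h - h div 2)" by (intro even_nat_iff) linarith
  also have "\<dots> \<longleftrightarrow> p mod 8 = 1 \<or> p mod 8 = 7" using h by presburger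
  finally have "even (nat (h - h div 2)) \<longleftrightarrow> p mod 8 = 1 \<or> p mod 8 = 7" .
  then show ?thesis using L by simp
qed

text \<open>Quadratic reciprocity with its sign moved into the top entry: p is replaced by whichever
  of p and -p is 1 mod 4.\<close>

lemma Legendre_reciprocity:
  assumes "odd_prime_int r" "r \<noteq> p"
  shows "Legendre r p = Legendre (if p mod 4 = 1 then p else - p) r"
proof -
  interpret r: odd_prime_int r by fact
  have pnr: "\<not> r dvd p" "\<not> p dvd r" using prime r.prime assms(2) primes_dvd_imp_eq by blast+
  have "Legendre p r \<noteq> 0" "Legendre r p \<noteq> 0" using pnr by (auto simp: Legendre_eq_0_iff)
  then have sq: "Legendre r p * Legendre r p = 1" using Legendre_values[of r p] by auto
  have rec: "Legendre p r * Legendre r p = (- 1) ^ nat ((p - 1) div 2 * ((r - 1) div 2))"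
    using nat_prime r.nat_prime assms(2) gt2 r.gt2 by (intro Quadratic_Reciprocity_int) auto
  have e: "nat ((p - 1) div 2 * ((r - 1) div 2)) = nat ((p - 1) div 2) * nat ((r - 1) div 2)"
    using gt2 by (intro nat_mult_distrib) auto
  note ep = even_half and er = r.even_half
  have "Legendre r p = (Legendre p r * Legendre r p) * Legendre p r"
  proof -
    have "Legendre p r * Legendre p r = 1" using \<open>Legendre p r \<noteq> 0\<close> Legendre_values[of p r] by auto
    then show ?thesis by (simp add: algebra_simps)
  qed
  also have "\<dots> = Legendre (if p mod 4 = 1 then p else - p) r"
  proof (cases "p mod 4 = 1")
    case True
    then show ?thesis unfolding rec e by (simp add: ep)
  next
    case False
    have "Legendre (- p) r = Legendre (- 1) r * Legendre p r" using r.Legendre_mult[of "- 1" p] by simp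
    then show ?thesis using False unfolding rec e r.Legendre_neg_1 by (auto simp: ep er minus_one_power_iff)
  qed
  finally show ?thesis .
qed

text \<open>Otherwise squaring would map the nonzero residues onto themselves, hence injectively,
  although 1 and p - 1 have the same square.\<close>

lemma Legendre_nonresidue: "\<exists>a. Legendre a p = - 1"
proof (rule ccontr)
  assume no: "\<nexists>a. Legendre a p = - 1"
  let ?S = "{1..<p}" and ?f = "\<lambda>y. y\<^sup>2 mod p"
  have "?S \<subseteq> ?f ` ?S"
  proof
    fix a assume a: "a \<in> ?S"
    then have "\<not> p dvd a" by (intro zdvd_not_zless) auto
    then have "Legendre a p \<noteq> 0" by (simp add: Legendre_eq_0_iff)
    then have "Legendre a p = 1" using no Legendre_values[of a p] by auto
    then have "QuadRes p a" by (auto simp: Legendre_def split: if_splits)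
    then obtain y where y: "[y\<^sup>2 = a] (mod p)" by (auto simp: QuadRes_def)
    have fy: "?f (y mod p) = a" using y a by (simp add: cong_def power_mod)
    have "y mod p \<noteq> 0" using fy a by (intro notI) simp
    moreover have "0 \<le> y mod p" "y mod p < p" using gt2 by auto
    ultimately have "y mod p \<in> ?S" by auto
    then show "a \<in> ?f ` ?S" using fy by blast
  qed
  then have inj: "inj_on ?f ?S" by (intro finite_surj_inj) auto
  have eq: "?f 1 = ?f (p - 1)"
  proof -
    have "(p - 1)\<^sup>2 = 1 + p * (p - 2)" by (simp add: power2_eq_square algebra_simps)
    then show ?thesis by simp
  qed
  have "1 = p - 1" by (rule inj_onD[OF inj eq]) (use gt2 in auto)
  then show False using gt2 by simp
qed

end

lemma prime_int_cases:
  assumes "prime (p :: int)" obtains "p = 2" | "odd_prime_int p"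
proof (cases "p = 2")
  case False
  then have "p > 2" using prime_ge_2_int[OF assms] by linarith
  then show ?thesis using that(2) assms by (simp only: odd_prime_int_def simp_thms)
qed (rule that(1))

lemma kronecker_prime_odd: "odd_prime_int p \<Longrightarrow> kronecker_prime a p = Legendre a p"
  by (simp add: kronecker_prime_def odd_prime_int_def)

lemma int_mod_8_cases:
  fixes a :: int assumes "odd a"
  shows "a mod 8 = 1 \<or> a mod 8 = 3 \<or> a mod 8 = 5 \<or> a mod 8 = 7"
  using assms by presburger

lemma kronecker_prime_mult:
  assumes "prime p"
  shows "kronecker_prime (a * b) p = kronecker_prime a p * kronecker_prime b p"
  using assms
proof (cases rule: prime_int_cases)
  case 1
  show ?thesis
  proof (cases "even a \<or> even b")
    case True
    then show ?thesis by (auto simp: 1 kronecker_prime_def)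
  next
    case False
    define i j where "i = a mod 8" and "j = b mod 8"
    have ij: "i = 1 \<or> i = 3 \<or> i = 5 \<or> i = 7" "j = 1 \<or> j = 3 \<or> j = 5 \<or> j = 7"
      using int_mod_8_cases[of a] int_mod_8_cases[of b] False unfolding i_def j_def by blast+
    have m: "(a * b) mod 8 = (i * j) mod 8" unfolding i_def j_def by (rule mod_mult_eq[symmetric])
    show ?thesis
      using False ij unfolding 1 kronecker_prime_def m i_def[symmetric] j_def[symmetric] by auto
  qed
next
  case 2
  then show ?thesis by (simp add: kronecker_prime_odd odd_prime_int.Legendre_mult)
qed

text \<open>Zero is excluded because of the sign factor: at n = -1 with a = 0 and b < 0 the left
  side is 1 and the right side -1.\<close>

lemma kronecker_mult_left:
  assumes "a \<noteq> 0" "b \<noteq> 0"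
  shows "kronecker (a * b) n = kronecker a n * kronecker b n"
proof (cases "n = 0")
  case True
  have "\<bar>a * b\<bar> = 1 \<longleftrightarrow> \<bar>a\<bar> = 1 \<and> \<bar>b\<bar> = 1"
    unfolding zdvd1_eq[symmetric] by (rule is_unit_mult_iff)
  then show ?thesis using True by (simp add: kronecker_def)
next
  case False
  have "(\<Prod>p\<in>#prime_factorization n. kronecker_prime (a * b) p) = 
    (\<Prod>p\<in>#prime_factorization n. kronecker_prime a p * kronecker_prime b p)"
    by (intro arg_cong[where f = prod_mset] image_mset_cong kronecker_prime_mult in_prime_factors_imp_prime)
  also have "\<dots> = (\<Prod>p\<in>#prime_factorization n. kronecker_prime a p) * (\<Prod>p\<in>#prime_factorization n. kronecker_prime b p)"
    by (rule prod_mset.distrib)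
  finally show ?thesis
    using False assms by (auto simp: kronecker_def mult_less_0_iff)
qed

text \<open>A completely multiplicative function on the integers is determined by its values at 0,
  -1 and the primes. The closed forms of particular Kronecker symbols are all verified this
  way.\<close>

lemma kronecker_eqI:
  fixes g :: "int \<Rightarrow> int"
  assumes mult: "\<And>m n. g (m * n) = g m * g n" and g1: "g 1 = 1" and g0: "g 0 = kronecker a 0"
    and gm1: "g (- 1) = (if a < 0 then - 1 else 1)" and gp: "\<And>p. prime p \<Longrightarrow> g p = kronecker_prime a p"
  shows "kronecker a n = g n"
proof (cases "n = 0")
  case True
  then show ?thesis using g0 by simp
next
  case False
  have M: "g (prod_mset M) = (\<Prod>p\<in>#M. g p)" for M
    by (induction M) (auto simp: g1 mult)
  have "g \<bar>n\<bar> = (\<Prod>p\<in>#prime_factorization n. g p)"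
    using M[of "prime_factorization n"] prod_mset_prime_factorization[OF False] by simp
  also have "\<dots> = (\<Prod>p\<in>#prime_factorization n. kronecker_prime a p)"
    by (intro arg_cong[where f = prod_mset] image_mset_cong gp in_prime_factors_imp_prime)
  finally have abs: "g \<bar>n\<bar> = \<dots>" .
  show ?thesis
  proof (cases "n < 0")
    case True
    then have "g n = g (- 1) * g \<bar>n\<bar>" using mult[of "- 1" "\<bar>n\<bar>"] by simp
    then show ?thesis using True False abs gm1 by (simp add: kronecker_def)
  next
    case 2: False
    then show ?thesis using False abs by (simp add: kronecker_def)
  qed
qed

section \<open>Kronecker symbols of the prime discriminants\<close>

definition char_mod_4 :: "int \<Rightarrow> int" where
  "char_mod_4 n = (if even n then 0 else if n mod 4 = 1 then 1 else - 1)"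

definition char_mod_8 :: "int \<Rightarrow> int" where
  "char_mod_8 n = (if even n then 0 else if n mod 8 = 1 \<or> n mod 8 = 7 then 1 else - 1)"

lemma char_mod_8_mult: "char_mod_8 (m * n) = char_mod_8 m * char_mod_8 n"
  using kronecker_prime_mult[of 2 m n] by (simp add: kronecker_prime_def char_mod_8_def)

lemma char_mod_4_mult: "char_mod_4 (m * n) = char_mod_4 m * char_mod_4 n"
proof -
  have c: "a mod 4 = 1 \<or> a mod 4 = 3" if "odd a" for a :: int using that by presburger
  show ?thesis
  proof (cases "even m \<or> even n")
    case True
    then show ?thesis by (auto simp: char_mod_4_def)
  next
    case False
    define i j where "i = m mod 4" and "j = n mod 4"
    have ij: "i = 1 \<or> i = 3" "j = 1 \<or> j = 3"
      using c[of m] c[of n] False unfolding i_def j_def by blast+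
    have e: "(m * n) mod 4 = (i * j) mod 4" unfolding i_def j_def by (rule mod_mult_eq[symmetric])
    show ?thesis
      using False ij unfolding char_mod_4_def e i_def[symmetric] j_def[symmetric] by auto
  qed
qed

text \<open>For odd p the sign is chosen so that the result is 1 mod 4.\<close>

definition prime_discriminant :: "int \<Rightarrow> int" where
  "prime_discriminant p = (if p mod 4 = 1 then p else - p)"

text \<open>Exchanging the two entries makes periodicity in n visible. At odd primes this is
  reciprocity, at 2 the second supplement, at -1 the first.\<close>

lemma kronecker_prime_discriminant:
  assumes "odd_prime_int p"
  shows "kronecker (prime_discriminant p) n = Legendre n p"
proof -
  interpret odd_prime_int p by fact
  show ?thesis
  proof (rule kronecker_eqI)
    show "Legendre (m * n) p = Legendre m p * Legendre n p" for m n by (rule Legendre_mult)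
    show "Legendre 0 p = kronecker (prime_discriminant p) 0"
      using gt2 by (simp add: kronecker_def prime_discriminant_def Legendre_def)
    show "Legendre (- 1) p = (if prime_discriminant p < 0 then - 1 else 1)"
      using gt2 by (simp add: Legendre_neg_1 prime_discriminant_def)
    fix r :: int assume r: "prime r"
    then show "Legendre r p = kronecker_prime (prime_discriminant p) r"
    proof (cases rule: prime_int_cases)
      case 1
      have "p mod 4 = 1 \<Longrightarrow> p mod 8 = 1 \<or> p mod 8 = 5" "p mod 4 \<noteq> 1 \<Longrightarrow> p mod 8 = 3 \<or> p mod 8 = 7"
        using odd by presburger+
      moreover have "- p mod 8 = 5 \<longleftrightarrow> p mod 8 = 3" "- p mod 8 = 1 \<longleftrightarrow> p mod 8 = 7" "- p mod 8 = 7 \<longleftrightarrow> p mod 8 = 1"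
        by presburger+
      ultimately show ?thesis
        using odd by (auto simp: 1 Legendre_2 kronecker_prime_def prime_discriminant_def)
    next
      case 2
      show ?thesis
      proof (cases "r = p")
        case True
        then show ?thesis using 2 by (auto simp: kronecker_prime_odd Legendre_def cong_0_iff prime_discriminant_def)
      next
        case False
        then show ?thesis
          using Legendre_reciprocity[OF 2] 2 by (simp add: kronecker_prime_odd prime_discriminant_def)
      qed
    qed
  qed simp
qed

lemma kronecker_neg_4: "kronecker (- 4) n = char_mod_4 n"
proof (rule kronecker_eqI)
  fix p :: int assume "prime p"
  then show "char_mod_4 p = kronecker_prime (- 4) p"
  proof (cases rule: prime_int_cases)
    case 2
    interpret odd_prime_int p by fact
    have "Legendre 2 p * Legendre 2 p = 1" by (simp add: Legendre_2)
    then have "Legendre (- 4) p = Legendre (- 1) p"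
      using Legendre_mult[of "- 1" 4] Legendre_mult[of 2 2] by simp
    then show ?thesis using odd by (simp add: kronecker_prime_odd[OF 2] Legendre_neg_1 char_mod_4_def)
  qed (simp add: char_mod_4_def kronecker_prime_def)
qed (simp_all add: char_mod_4_mult, simp_all add: char_mod_4_def kronecker_def)

lemma kronecker_8: "kronecker 8 n = char_mod_8 n"
proof (rule kronecker_eqI)
  fix p :: int assume "prime p"
  then show "char_mod_8 p = kronecker_prime 8 p"
  proof (cases rule: prime_int_cases)
    case 2
    interpret odd_prime_int p by fact
    have "Legendre 2 p * Legendre 2 p = 1" by (simp add: Legendre_2)
    then have "Legendre 8 p = Legendre 2 p"
      using Legendre_mult[of 2 4] Legendre_mult[of 2 2] by simp
    then show ?thesis using odd by (simp add: kronecker_prime_odd[OF 2] Legendre_2 char_mod_8_def)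
  qed (simp add: char_mod_8_def kronecker_prime_def)
qed (simp_all add: char_mod_8_mult, simp_all add: char_mod_8_def kronecker_def)

lemma kronecker_neg_8: "kronecker (- 8) n = char_mod_4 n * char_mod_8 n"
proof (rule kronecker_eqI)
  fix p :: int assume "prime p"
  then show "char_mod_4 p * char_mod_8 p = kronecker_prime (- 8) p"
  proof (cases rule: prime_int_cases)
    case 2
    interpret odd_prime_int p by fact
    have "Legendre 2 p * Legendre 2 p = 1" by (simp add: Legendre_2)
    then have "Legendre (- 8) p = Legendre (- 1) p * Legendre 2 p"
      using Legendre_mult[of "- 1" 8] Legendre_mult[of 2 4] Legendre_mult[of 2 2] by simp
    then show ?thesis using odd by (simp add: kronecker_prime_odd[OF 2] Legendre_2 Legendre_neg_1 char_mod_8_def char_mod_4_def)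
  qed (simp add: char_mod_8_def kronecker_prime_def)
qed (simp_all add: char_mod_8_mult char_mod_4_mult, simp_all add: char_mod_8_def char_mod_4_def kronecker_def)

section \<open>Primitivity of Kronecker symbols\<close>

lemma primitive_kronecker_prime_discriminant:
  assumes "odd_prime_int p"
  shows "primitive_char (nat p) (kronecker_char (prime_discriminant p))"
proof -
  interpret odd_prime_int p by fact
  have eq: "kronecker_char (prime_discriminant p) n = of_int (Legendre n p)" for n
    by (simp add: kronecker_char_def kronecker_prime_discriminant[OF assms])
  show ?thesis unfolding primitive_char_def dirichlet_char_def eq
  proof (intro conjI allI impI)
    show "nat p > 0" using gt2 by simp
    show "complex_of_int (Legendre (m * n) p) = of_int (Legendre m p) * of_int (Legendre n p)" for m n
      by (simp add: Legendre_mult)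
    show "complex_of_int (Legendre (n + int (nat p)) p) = of_int (Legendre n p)" for n
      using gt2 Legendre_cong[of "n + p" n p] by (simp add: cong_def)
    show "(complex_of_int (Legendre n p) = 0) = (\<not> coprime n (int (nat p)))" for n
      unfolding nat_prime(3) by (simp add: Legendre_eq_0_iff coprime_iff)
    fix d assume d: "induced_modulus (nat p) (\<lambda>n. complex_of_int (Legendre n p)) d"
    then have "d = 1 \<or> d = nat p" using nat_prime(1) by (auto simp: induced_modulus_def prime_nat_iff)
    moreover obtain a where a: "Legendre a p = - 1" using Legendre_nonresidue by blast
    then have "\<not> p dvd a" using Legendre_eq_0_iff[of a p] by simp
    then have "coprime a (int (nat p))" unfolding nat_prime(3) coprime_iff .
    then have "d \<noteq> 1" using d a by (auto simp: induced_modulus_def eq)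
    ultimately show "d = nat p" by blast
  qed simp
qed

lemma coprime_power_two_iff: "k > 0 \<Longrightarrow> coprime n (2 ^ k) \<longleftrightarrow> odd (n :: int)"
  by (simp add: coprime_right_2_iff_odd)

lemma primitive_kronecker_neg_4: "primitive_char 4 (kronecker_char (- 4))"
  unfolding primitive_char_def dirichlet_char_def kronecker_char_def kronecker_neg_4
proof (intro conjI allI impI)
  show "(complex_of_int (char_mod_4 n) = 0) = (\<not> coprime n (int 4))" for n
    using coprime_power_two_iff[of 2 n] by (simp add: char_mod_4_def)
  fix d assume d: "induced_modulus 4 (\<lambda>n. complex_of_int (char_mod_4 n)) d"
  show "d = 4"
  proof (rule ccontr)
    assume "d \<noteq> 4"
    moreover have "d dvd 4" using d by (simp add: induced_modulus_def)
    moreover from this have "d \<le> 4" by (rule dvd_imp_le) simp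
    ultimately have "d = 1 \<or> d = 2" by (cases "d = 0"; cases "d = 3") auto
    then have "[3 = 1] (mod int d)" by (auto simp: cong_def)
    moreover have "coprime (3::int) (int 4)" using coprime_power_two_iff[of 2 3] by simp
    ultimately have "complex_of_int (char_mod_4 3) = 1" using d unfolding induced_modulus_def by blast
    then show False by (simp add: char_mod_4_def)
  qed
qed (simp_all add: char_mod_4_mult, simp_all add: char_mod_4_def)

text \<open>A proper divisor of 8 divides 4, and 5 is 1 mod 4. The symbols of 8 and -8 are both -1
  at 5, which makes this the test for their primitivity.\<close>

lemma induced_modulus_8_imp_4:
  assumes "induced_modulus 8 \<psi> d" "d \<noteq> 8"
  shows "\<psi> 5 = 1"
proof -
  have "d dvd 8" using assms by (simp add: induced_modulus_def)
  then have "d \<le> 8" by (rule dvd_imp_le) simp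
  then have "d = 1 \<or> d = 2 \<or> d = 4" using \<open>d dvd 8\<close> assms(2)
    by (cases "d = 0"; cases "d = 3"; cases "d = 5"; cases "d = 6"; cases "d = 7") auto
  then have "[5 = 1] (mod int d)" by (auto simp: cong_def)
  moreover have "coprime (5::int) (int 8)" using coprime_power_two_iff[of 3 5] by simp
  ultimately show ?thesis using assms unfolding induced_modulus_def by blast
qed

lemma primitive_kronecker_8: "primitive_char 8 (kronecker_char 8)"
  unfolding primitive_char_def dirichlet_char_def kronecker_char_def kronecker_8
proof (intro conjI allI impI)
  show "(complex_of_int (char_mod_8 n) = 0) = (\<not> coprime n (int 8))" for n
    using coprime_power_two_iff[of 3 n] by (simp add: char_mod_8_def)
  fix d assume d: "induced_modulus 8 (\<lambda>n. complex_of_int (char_mod_8 n)) d"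
  show "d = 8" using induced_modulus_8_imp_4[OF d] by (auto simp: char_mod_8_def)
qed (simp_all add: char_mod_8_mult, simp_all add: char_mod_8_def)

lemma primitive_kronecker_neg_8: "primitive_char 8 (kronecker_char (- 8))"
  unfolding primitive_char_def dirichlet_char_def kronecker_char_def kronecker_neg_8
proof (intro conjI allI impI)
  show "(complex_of_int (char_mod_4 n * char_mod_8 n) = 0) = (\<not> coprime n (int 8))" for n
    using coprime_power_two_iff[of 3 n] by (simp add: char_mod_8_def char_mod_4_def)
  show "complex_of_int (char_mod_4 (n + int 8) * char_mod_8 (n + int 8)) = complex_of_int (char_mod_4 n * char_mod_8 n)" for n
  proof -
    have "(n + 8) mod 4 = n mod 4" by presburger
    then show ?thesis by (simp add: char_mod_8_def char_mod_4_def)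
  qed
  fix d assume d: "induced_modulus 8 (\<lambda>n. complex_of_int (char_mod_4 n * char_mod_8 n)) d"
  show "d = 8" using induced_modulus_8_imp_4[OF d] by (auto simp: char_mod_8_def char_mod_4_def)
qed (simp_all add: char_mod_8_mult char_mod_4_mult, simp_all add: char_mod_8_def char_mod_4_def)

text \<open>If d is an induced modulus of the product, then \<open>gcd d q1\<close> and
  \<open>gcd d q2\<close> are induced moduli of the factors, hence equal to \<open>q1\<close> and
  \<open>q2\<close>; so both divide d.\<close>

lemma primitive_char_mult:
  assumes 1: "primitive_char q1 \<psi>1" and 2: "primitive_char q2 \<psi>2" and cop: "coprime q1 q2"
  shows "primitive_char (q1 * q2) (\<lambda>n. \<psi>1 n * \<psi>2 n)"
proof -
  have d1: "dirichlet_char q1 \<psi>1" and d2: "dirichlet_char q2 \<psi>2" using 1 2 by (auto simp: primitive_char_def)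
  have dc: "dirichlet_char (q1 * q2) (\<lambda>n. \<psi>1 n * \<psi>2 n)"
    unfolding dirichlet_char_def
  proof (intro conjI allI)
    show "\<psi>1 (n + int (q1 * q2)) * \<psi>2 (n + int (q1 * q2)) = \<psi>1 n * \<psi>2 n" for n
      using dirichlet_char_cong[OF d1, of "n + int (q1 * q2)" n] dirichlet_char_cong[OF d2, of "n + int (q1 * q2)" n]
      by (simp add: cong_def)
    show "(\<psi>1 n * \<psi>2 n = 0) = (\<not> coprime n (int (q1 * q2)))" for n
      using d1 d2 by (auto simp: dirichlet_char_def)
  qed (use d1 d2 in \<open>auto simp: dirichlet_char_def\<close>)
  have key: "gcd d qa = qa"
    if prim: "primitive_char qa \<psi>a" and db: "dirichlet_char qb \<psi>b" and cab: "coprime qa qb"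
      and ind: "induced_modulus (qa * qb) (\<lambda>n. \<psi>a n * \<psi>b n) d" for qa qb \<psi>a \<psi>b d
  proof -
    have da: "dirichlet_char qa \<psi>a" using prim by (simp add: primitive_char_def)
    have "induced_modulus qa \<psi>a (gcd d qa)"
      unfolding induced_modulus_def
    proof (intro conjI allI impI)
      fix n assume n: "coprime n (int qa) \<and> [n = 1] (mod int (gcd d qa))"
      \<comment> \<open>The Chinese remainder theorem gives an x at which \<psi>a has the same value
        as at n, while \<psi>b is 1. It is 1 modulo both gcds, hence modulo d, which divides their
        product.\<close>
      obtain x where x: "[x = n] (mod int qa)" "[x = 1] (mod int qb)"
        using binary_chinese_remainder_int[of "int qa" "int qb" n 1] cab by auto
      have "coprime x (int qa)" using cong_imp_coprime[OF cong_sym[OF x(1)]] n by simp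
      moreover have "coprime x (int qb)" using cong_imp_coprime[OF cong_sym[OF x(2)]] by simp
      ultimately have cx: "coprime x (int (qa * qb))" by simp
      have "[x = 1] (mod int (gcd d qa))"
        using x(1) n by (meson cong_dvd_modulus cong_trans gcd_dvd2 of_nat_dvd_iff)
      moreover have "[x = 1] (mod int (gcd d qb))"
        using x(2) by (meson cong_dvd_modulus gcd_dvd2 of_nat_dvd_iff)
      moreover have "coprime (gcd d qa) (gcd d qb)"
        using cab by (meson coprime_divisors gcd_dvd2)
      then have "coprime (int (gcd d qa)) (int (gcd d qb))" by simp
      ultimately have "[x = 1] (mod int (gcd d qa) * int (gcd d qb))"
        by (intro coprime_cong_mult) auto
      moreover have "d dvd gcd d qa * gcd d qb"
        using ind cab by (simp add: induced_modulus_def gcd_mult_distrib_nat gcd_mult_right_right_cancel)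
          (metis division_decomp dvd_refl gcd_greatest mult_dvd_mono dvd_triv_left dvd_triv_right)
      then have "int d dvd int (gcd d qa) * int (gcd d qb)" by (metis of_nat_dvd_iff of_nat_mult)
      ultimately have "[x = 1] (mod int d)" by (rule cong_dvd_modulus)
      then have "\<psi>a x * \<psi>b x = 1" using ind cx by (simp add: induced_modulus_def)
      moreover have "\<psi>a x = \<psi>a n" by (rule dirichlet_char_cong[OF da x(1)])
      moreover have "\<psi>b x = 1" using dirichlet_char_cong[OF db x(2)] db by (simp add: dirichlet_char_def)
      ultimately show "\<psi>a n = 1" by simp
    qed simp
    then show ?thesis using prim by (simp add: primitive_char_def)
  qed
  show ?thesis
    unfolding primitive_char_def
  proof (intro conjI dc allI impI)
    fix d assume d: "induced_modulus (q1 * q2) (\<lambda>n. \<psi>1 n * \<psi>2 n) d"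
    then have d': "induced_modulus (q2 * q1) (\<lambda>n. \<psi>2 n * \<psi>1 n) d" by (simp add: mult.commute)
    have "gcd d q1 = q1" by (rule key[OF 1 d2 cop d])
    moreover have "gcd d q2 = q2" using cop by (intro key[OF 2 d1 _ d']) (simp add: coprime_commute)
    ultimately have "q1 dvd d" "q2 dvd d" by (metis gcd_dvd1)+
    then have "q1 * q2 dvd d" using cop by (rule divides_mult)
    moreover have "d dvd q1 * q2" using d by (simp add: induced_modulus_def)
    ultimately show "d = q1 * q2" by (rule dvd_antisym[symmetric])
  qed
qed

lemma primitive_kronecker_mult:
  assumes "primitive_char (nat \<bar>a\<bar>) (kronecker_char a)" "primitive_char (nat \<bar>b\<bar>) (kronecker_char b)" "coprime a b"
  shows "primitive_char (nat \<bar>a * b\<bar>) (kronecker_char (a * b))"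
proof -
  have "a \<noteq> 0" "b \<noteq> 0" using assms(1,2) by (auto simp: primitive_char_def dirichlet_char_def)
  then have "kronecker_char (a * b) = (\<lambda>n. kronecker_char a n * kronecker_char b n)"
    by (intro ext) (simp add: kronecker_char_def kronecker_mult_left)
  moreover have "coprime (nat \<bar>a\<bar>) (nat \<bar>b\<bar>)" using assms(3) by (simp add: coprime_int_iff[symmetric])
  moreover have "nat \<bar>a * b\<bar> = nat \<bar>a\<bar> * nat \<bar>b\<bar>" by (simp add: abs_mult nat_mult_distrib)
  ultimately show ?thesis using primitive_char_mult[OF assms(1,2)] by simp
qed

text \<open>Signed primes are split off one at a time. Since each is 1 mod 4, so is the cofactor,
  and the induction ends at d = 1; the value d = -1 is 3 mod 4.\<close>

lemma primitive_kronecker_squarefree: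
  fixes d :: int
  assumes "squarefree d" "d mod 4 = 1"
  shows "primitive_char (nat \<bar>d\<bar>) (kronecker_char d)"
  using assms
proof (induction "nat \<bar>d\<bar>" arbitrary: d rule: less_induct)
  case less
  show ?case
  proof (cases "\<bar>d\<bar> = 1")
    case True
    then have "d = 1" using less.prems by (auto simp: abs_if split: if_splits)
    have "kronecker 1 n = 1" for n
    proof (rule kronecker_eqI[where g = "\<lambda>_. 1"])
      fix p :: int assume "prime p"
      then show "1 = kronecker_prime 1 p"
        by (cases rule: prime_int_cases) (auto simp: kronecker_prime_odd odd_prime_int.Legendre_1, simp add: kronecker_prime_def)
    qed (auto simp: kronecker_def)
    then show ?thesis
      by (simp add: \<open>d = 1\<close> primitive_char_def dirichlet_char_def kronecker_char_def induced_modulus_def)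
  next
    case False
    then have "\<not> is_unit d" by (simp add: zdvd1_eq)
    have d0: "d \<noteq> 0" using less.prems by auto
    obtain p where p: "prime p" "p dvd d" using prime_divisorE[OF d0 \<open>\<not> is_unit d\<close>] by blast
    have "odd d" using less.prems by presburger
    then have "p \<noteq> 2" using p by auto
    then have odp: "odd_prime_int p" using p prime_int_cases by blast
    interpret odd_prime_int p by fact
    define P where "P = prime_discriminant p"
    have P: "\<bar>P\<bar> = p" "P mod 4 = 1"
    proof -
      show "\<bar>P\<bar> = p" using gt2 by (simp add: P_def prime_discriminant_def)
      have "p mod 4 \<noteq> 1 \<Longrightarrow> (- p) mod 4 = 1" using odd by presburger
      then show "P mod 4 = 1" by (simp add: P_def prime_discriminant_def)
    qed
    have "P dvd d" using p P by (metis abs_dvd_iff)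
    then obtain e where e: "d = P * e" by (elim dvdE)
    have e0: "e \<noteq> 0" using d0 e by auto
    have "e mod 4 = 1"
    proof -
      have "(P mod 4) * e mod 4 = 1" using less.prems e by (simp add: mod_mult_left_eq)
      then show ?thesis using P by simp
    qed
    moreover have "squarefree e" using less.prems(1) e by (metis squarefree_mono dvd_triv_right)
    moreover have "nat \<bar>e\<bar> < nat \<bar>d\<bar>"
    proof -
      have "\<bar>d\<bar> = p * \<bar>e\<bar>" using e P by (simp add: abs_mult)
      moreover have "1 * \<bar>e\<bar> < p * \<bar>e\<bar>" using gt2 e0 by (intro mult_strict_right_mono) auto
      ultimately show ?thesis using e0 by simp
    qed
    ultimately have IH: "primitive_char (nat \<bar>e\<bar>) (kronecker_char e)" using less.hyps by blast
    have "\<not> p dvd e"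
    proof
      assume "p dvd e"
      then have "p * p dvd P * e" using P(1) dvd_abs_iff[of p P] by (intro mult_dvd_mono) simp_all
      then have "p ^ 2 dvd d" using e by (simp add: power2_eq_square)
      then have "is_unit p" by (rule squarefreeD[OF less.prems(1)])
      then show False using prime not_prime_unit by blast
    qed
    then have "coprime p e" using prime by (simp add: prime_imp_coprime)
    then have "coprime P e" using P(1) coprime_abs_left_iff[of P e] by simp
    moreover have "primitive_char (nat \<bar>P\<bar>) (kronecker_char P)"
      using primitive_kronecker_prime_discriminant[OF odp] unfolding P(1) by (simp add: P_def)
    ultimately show ?thesis unfolding e using IH by (intro primitive_kronecker_mult)
  qed
qed

text \<open>4m is (-4)(-m), 8e or (-8)(-e), where the second factor is always squarefree and 1 mod
  4.\<close>

lemma primitive_kronecker_four_times_squarefree: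
  fixes m :: int
  assumes sq: "squarefree m" and m: "m mod 4 = 2 \<or> m mod 4 = 3"
  shows "primitive_char (nat \<bar>4 * m\<bar>) (kronecker_char (4 * m))"
proof -
  have odd_case: "primitive_char (nat \<bar>a * e\<bar>) (kronecker_char (a * e))"
    if "primitive_char (nat \<bar>a\<bar>) (kronecker_char a)" "a = - 4 \<or> a = 8 \<or> a = - 8" "squarefree e" "e mod 4 = 1" for a e
  proof -
    have "odd e" using that(4) by presburger
    then have "coprime a e" using that(2) coprime_power_two_iff[of 2 e] coprime_power_two_iff[of 3 e]
      by (auto simp: coprime_commute[of _ e])
    then show ?thesis using that primitive_kronecker_squarefree by (intro primitive_kronecker_mult) auto
  qed
  show ?thesis
  proof (cases "m mod 4 = 3")
    case True
    then have "(- m) mod 4 = 1" by presburger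
    then have "primitive_char (nat \<bar>(- 4) * (- m)\<bar>) (kronecker_char ((- 4) * (- m)))"
      using primitive_kronecker_neg_4 sq by (intro odd_case) auto
    then show ?thesis by simp
  next
    case False
    then have "even m" using m by presburger
    then obtain e where e: "m = 2 * e" by (elim evenE)
    then have sqe: "squarefree e" "squarefree (- e)" using sq by (auto intro: squarefree_mono[of e m])
    have "e mod 4 = 1 \<or> e mod 4 = 3" using False m e by presburger
    then show ?thesis
    proof
      assume "e mod 4 = 1"
      then have "primitive_char (nat \<bar>8 * e\<bar>) (kronecker_char (8 * e))"
        using primitive_kronecker_8 sqe by (intro odd_case) auto
      then show ?thesis by (simp add: e)
    next
      assume "e mod 4 = 3"
      then have "(- e) mod 4 = 1" by presburger
      then have "primitive_char (nat \<bar>(- 8) * (- e)\<bar>) (kronecker_char ((- 8) * (- e)))"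
        using primitive_kronecker_neg_8 sqe by (intro odd_case) auto
      then show ?thesis by (simp add: e)
    qed
  qed
qed

section \<open>Fundamental discriminants\<close>

definition eval_int_poly :: "complex \<Rightarrow> int poly \<Rightarrow> complex" where
  "eval_int_poly z f = poly (map_poly of_int f) z"

lemma eval_int_poly_pCons: "eval_int_poly z (pCons a f) = of_int a + z * eval_int_poly z f"
  by (simp add: eval_int_poly_def map_poly_pCons)

lemma eval_int_poly_0: "eval_int_poly z 0 = 0"
  by (simp add: eval_int_poly_def)

lemma eval_int_poly_add: "eval_int_poly z (f + g) = eval_int_poly z f + eval_int_poly z g"
  by (induction f g rule: poly_induct2) (simp_all add: eval_int_poly_pCons eval_int_poly_0 algebra_simps)

lemma eval_int_poly_smult: "eval_int_poly z (Polynomial.smult c f) = of_int c * eval_int_poly z f"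
  by (induction f) (simp_all add: eval_int_poly_pCons eval_int_poly_0 algebra_simps)

lemma eval_int_poly_mult: "eval_int_poly z (f * g) = eval_int_poly z f * eval_int_poly z g"
  by (induction f) (simp_all add: eval_int_poly_pCons eval_int_poly_0 eval_int_poly_add eval_int_poly_smult algebra_simps)

lemma quadratic_irrational_no_linear_relation:
  assumes "z \<notin> \<rat>" "(p :: complex) \<in> \<rat>" "q \<in> \<rat>" "p + q * z = 0"
  shows "p = 0" "q = 0"
proof -
  show "q = 0"
  proof (rule ccontr)
    assume "q \<noteq> 0"
    then have "z = - p / q" using assms(4) by (simp add: field_simps add_eq_0_iff2)
    then show False using assms by simp
  qed
  then show "p = 0" using assms(4) by simp
qed

text \<open>Gauss's lemma, applied to the pseudo-division of a monic integer polynomial vanishing at \<open>z\<close>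
  by the primitive quadratic polynomial vanishing at \<open>z\<close>: the latter has leading coefficient \<open>\<plusminus>1\<close>.\<close>

lemma algebraic_int_quadratic_coeffs:
  fixes z T N :: complex
  assumes z: "algebraic_int z" "z \<notin> \<rat>" and T: "T \<in> \<rat>" and N: "N \<in> \<rat>" and eq: "z\<^sup>2 - T * z + N = 0"
  shows "T \<in> \<int>" "N \<in> \<int>"
proof -
  obtain p :: "int poly" where p: "eval_int_poly z p = 0" "lead_coeff p = 1"
    using z(1) unfolding algebraic_int_altdef_ipoly eval_int_poly_def by blast
  obtain t t' where t: "t' > 0" "T = of_int t / of_int t'" using T by (elim Rats_cases') blast
  obtain n n' where n: "n' > 0" "N = of_int n / of_int n'" using N by (elim Rats_cases') blast
  \<comment> \<open>X^2 - T X + N cleared of denominators; removing the content leaves the primitive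
    \<open>Q\<close>.\<close>
  define Q0 where "Q0 = [:n * t', - (t * n'), t' * n':]"
  define Q where "Q = primitive_part Q0"
  define d where "d = content Q0"
  have c0: "t' * n' \<noteq> 0" using t n by simp
  then have Q0: "Q0 \<noteq> 0" "degree Q0 = 2" by (auto simp: Q0_def)
  have d: "d \<noteq> 0" using Q0 by (simp add: d_def)
  have dQ: "Polynomial.smult d Q = Q0" by (simp add: d_def Q_def)
  have cQ: "content Q = 1" using Q0 by (simp add: Q_def)
  have degQ: "degree Q = 2" using Q0 by (simp add: Q_def)
  have "eval_int_poly z Q0 = of_int (t' * n') * (z\<^sup>2 - T * z + N)"
  proof -
    have "of_int t = T * of_int t'" "of_int n = N * of_int n'" using t n by simp_all
    then show ?thesis
      by (simp add: Q0_def eval_int_poly_pCons eval_int_poly_0 power2_eq_square algebra_simps)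
  qed
  then have "of_int d * eval_int_poly z Q = 0" unfolding dQ[symmetric] eval_int_poly_smult by (simp add: eq)
  then have zQ: "eval_int_poly z Q = 0" using d by simp
  define c where "c = lead_coeff Q"
  define k where "k = Suc (degree p) - degree Q"
  have Qnz: "Q \<noteq> 0" using degQ by auto
  obtain g r where gr: "pseudo_divmod p Q = (g, r)" by force
  have div: "Polynomial.smult (c ^ k) p = Q * g + r" and degr: "r = 0 \<or> degree r < degree Q"
    using pseudo_divmod[OF Qnz gr] by (simp_all add: c_def k_def)
  have "eval_int_poly z r = 0"
    using arg_cong[OF div, of "eval_int_poly z"] by (simp add: eval_int_poly_smult eval_int_poly_add eval_int_poly_mult p zQ)
  have "r = 0"
  proof -
    have "degree r \<le> 1" using degr degQ by auto
    then have rr: "r = [:Polynomial.coeff r 0, Polynomial.coeff r 1:]"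
      by (intro poly_eqI) (auto simp: coeff_pCons coeff_eq_0 split: nat.split)
    have "of_int (Polynomial.coeff r 0) + of_int (Polynomial.coeff r 1) * z = 0"
      using \<open>eval_int_poly z r = 0\<close> by (subst (asm) rr) (simp add: eval_int_poly_pCons eval_int_poly_0 mult.commute)
    from quadratic_irrational_no_linear_relation[OF z(2) _ _ this]
    show ?thesis by (subst rr) simp
  qed
  then have div: "Polynomial.smult (c ^ k) p = Q * g" using div by simp
  \<comment> \<open>Contents and leading coefficients in c^k p = Q g are compared. The content of g
    is |c^k| and divides its leading coefficient, while c times that leading coefficient is c^k;
    hence c divides 1.\<close>
  have "content p dvd lead_coeff p" by (rule content_dvd_coeff)
  then have "is_unit (content p)" using p(2) by simp
  then have "content p = 1" using normalize_content[of p] is_unit_normalize[of "content p"] by simp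
  then have cg: "content g = \<bar>c ^ k\<bar>"
    using arg_cong[OF div, of content] by (simp add: content_mult cQ)
  have cnz: "c \<noteq> 0" using Qnz by (simp add: c_def)
  have "lead_coeff (Q * g) = c ^ k" using arg_cong[OF div, of lead_coeff] p(2) cnz by (simp add: lead_coeff_smult)
  then have "c ^ k = c * lead_coeff g" by (simp add: lead_coeff_mult c_def)
  moreover have "content g dvd lead_coeff g" by (rule content_dvd_coeff)
  then obtain h where "lead_coeff g = content g * h" by (elim dvdE)
  ultimately have "c ^ k = c * (\<bar>c ^ k\<bar> * h)" using cg by simp
  from arg_cong[OF this, of abs] have "\<bar>c ^ k\<bar> * 1 = \<bar>c ^ k\<bar> * (\<bar>c\<bar> * \<bar>h\<bar>)"
    unfolding abs_mult abs_abs by (simp only: mult_1_right mult.left_commute)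
  then have "1 = \<bar>c\<bar> * \<bar>h\<bar>" by (subst (asm) mult_cancel_left) (use cnz in simp)
  then have "\<bar>c\<bar> dvd 1" by (rule dvdI)
  then have "\<bar>c\<bar> = 1" by (simp only: zdvd1_eq abs_abs)
  then have cc: "c * c = 1" by (simp add: abs_mult_self_eq[of c, symmetric] del: abs_mult_self_eq)
  have co: "n * t' = d * Polynomial.coeff Q 0" "- (t * n') = d * Polynomial.coeff Q 1" "t' * n' = d * c"
  proof -
    have "Polynomial.coeff Q0 i = d * Polynomial.coeff Q i" for i using dQ[symmetric] by simp
    from this[of 0] this[of 1] this[of 2] show "n * t' = d * Polynomial.coeff Q 0" "- (t * n') = d * Polynomial.coeff Q 1" "t' * n' = d * c"
      using degQ by (simp_all add: Q0_def c_def numeral_2_eq_2)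
  qed
  have tn: "(of_int t' :: complex) \<noteq> 0" "(of_int n' :: complex) \<noteq> 0" "(of_int d :: complex) \<noteq> 0" "(of_int c :: complex) \<noteq> 0"
    using t n d cnz by simp_all
  have cc': "of_int c * of_int c = (1 :: complex)" using cc by (metis of_int_1 of_int_mult)
  have "of_int d * (of_int c * T) = of_int (t' * n') * T" using co(3) by simp
  also have "\<dots> = of_int (t * n')" using t tn by simp
  also have "\<dots> = of_int (- (d * Polynomial.coeff Q 1))"
  proof -
    have "t * n' = - (d * Polynomial.coeff Q 1)" using co(2) by linarith
    then show ?thesis by (simp only:)
  qed
  finally have "of_int d * (of_int c * T) = of_int d * of_int (- Polynomial.coeff Q 1)" by simp
  then have "of_int c * T = of_int (- Polynomial.coeff Q 1)" using tn(3) mult_cancel_left by blast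
  then have "T = of_int (c * - Polynomial.coeff Q 1)" using cc' by (metis mult.assoc mult_1 of_int_mult)
  then show "T \<in> \<int>" by (metis Ints_of_int)
  have "of_int d * (of_int c * N) = of_int (t' * n') * N" using co(3) by simp
  also have "\<dots> = of_int (n * t')" using n tn by simp
  also have "\<dots> = of_int (d * Polynomial.coeff Q 0)" using co(1) by simp
  finally have "of_int d * (of_int c * N) = of_int d * of_int (Polynomial.coeff Q 0)" by simp
  then have "of_int c * N = of_int (Polynomial.coeff Q 0)" using tn(3) mult_cancel_left by blast
  then have "N = of_int (c * Polynomial.coeff Q 0)" using cc' by (metis mult.assoc mult_1 of_int_mult)
  then show "N \<in> \<int>" by (metis Ints_of_int)
qed

section \<open>Quadratic subfields of the complex numbers\<close>

locale complex_subfield_locale =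
  fixes K :: "complex set"
  assumes subfield: "complex_subfield K"
begin

lemma one_mem: "1 \<in> K" and diff_mem: "x \<in> K \<Longrightarrow> y \<in> K \<Longrightarrow> x - y \<in> K"
  and mult_mem: "x \<in> K \<Longrightarrow> y \<in> K \<Longrightarrow> x * y \<in> K" and inverse_mem: "x \<in> K \<Longrightarrow> inverse x \<in> K"
  using subfield by (auto simp: complex_subfield_def)

lemma zero_mem: "0 \<in> K"
  using diff_mem[OF one_mem one_mem] by simp

lemma minus_mem: "x \<in> K \<Longrightarrow> - x \<in> K"
  using diff_mem[OF zero_mem, of x] by simp

lemma add_mem: "x \<in> K \<Longrightarrow> y \<in> K \<Longrightarrow> x + y \<in> K"
  using diff_mem[of x "- y"] minus_mem[of y] by simp

lemma of_nat_mem: "of_nat n \<in> K"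
  by (induction n) (auto intro: add_mem one_mem zero_mem)

lemma of_int_mem: "of_int n \<in> K"
  by (cases n rule: int_cases2) (auto intro: of_nat_mem minus_mem)

lemma Rats_mem: assumes "x \<in> \<rat>" shows "x \<in> K"
proof -
  obtain a b where "x = of_int a / of_int b" using assms by (elim Rats_cases') blast
  then show ?thesis by (simp add: divide_inverse mult_mem of_int_mem inverse_mem)
qed

lemmas mem = one_mem zero_mem diff_mem mult_mem inverse_mem minus_mem add_mem of_int_mem Rats_mem

lemma embedding_fixes_Rats:
  assumes \<sigma>: "field_embedding K \<sigma>" and x: "x \<in> \<rat>"
  shows "\<sigma> x = x"
proof -
  have add: "\<sigma> (x + y) = \<sigma> x + \<sigma> y" and mult: "\<sigma> (x * y) = \<sigma> x * \<sigma> y" and one: "\<sigma> 1 = 1"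
    if "x \<in> K" "y \<in> K" for x y
    using \<sigma> that by (auto simp: field_embedding_def)
  have zero: "\<sigma> 0 = 0" using add[OF zero_mem zero_mem] by simp
  have neg: "\<sigma> (- x) = - \<sigma> x" if "x \<in> K" for x
    using add[OF that minus_mem[OF that]] zero by (simp add: add_eq_0_iff)
  have nat: "\<sigma> (of_nat n) = of_nat n" for n
    by (induction n) (auto simp: zero add[OF one_mem of_nat_mem] one[OF one_mem one_mem])
  have int: "\<sigma> (of_int n) = of_int n" for n
    by (cases n rule: int_cases2) (auto simp: nat neg[OF of_nat_mem])
  obtain a b where ab: "b > 0" "x = of_int a / of_int b" using x by (elim Rats_cases') blast
  then have "x * of_int b = of_int a" by simp
  then have "\<sigma> x * of_int b = of_int a"
    using mult[OF Rats_mem[OF x] of_int_mem[of b]] int by metis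
  then have "\<sigma> x * of_int b = x * of_int b" using \<open>x * of_int b = of_int a\<close> by simp
  then show ?thesis using ab(1) by simp
qed

end

text \<open>1 is a combination of two basis elements with some nonzero coefficient, so it can be
  exchanged for the corresponding element.\<close>

lemma quadratic_number_field_span:
  assumes "quadratic_number_field K"
  obtains \<alpha> where "\<alpha> \<in> K" "\<And>z. z \<in> K \<Longrightarrow> \<exists>x\<in>\<rat>. \<exists>y\<in>\<rat>. z = x + y * \<alpha>"
proof -
  interpret F: complex_subfield_locale K
    using assms by unfold_locales (simp add: quadratic_number_field_def)
  interpret V: vector_space "\<lambda>(r::rat) (x::complex). of_rat r * x"
    by unfold_locales (auto simp: algebra_simps of_rat_add of_rat_mult)
  obtain B where B: "B \<subseteq> K" "K \<subseteq> V.span B" "card B = V.dim K"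
    using V.basis_exists[of K] by metis
  have "card B = 2" using assms B(3) by (simp add: quadratic_number_field_def)
  then obtain b1 b2 where b: "B = {b1, b2}" by (auto simp: card_2_iff)
  have bK: "b1 \<in> K" "b2 \<in> K" using B(1) b by auto
  have span: "\<exists>x\<in>\<rat>. \<exists>y\<in>\<rat>. z = x * b1 + y * b2" if "z \<in> K" for z
  proof -
    have "z \<in> V.span {b1, b2}" using that B(2) b by auto
    then obtain k l where "z - of_rat k * b1 - of_rat l * b2 = 0"
      by (auto simp: V.span_breakdown_eq)
    then have "z = of_rat k * b1 + of_rat l * b2" by (simp add: algebra_simps)
    then show ?thesis using Rats_of_rat by blast
  qed
  obtain r s where rs: "r \<in> \<rat>" "s \<in> \<rat>" "1 = r * b1 + s * b2" using span[OF F.one_mem] by blast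
  have *: "\<exists>x\<in>\<rat>. \<exists>y\<in>\<rat>. z = x + y * c2"
    if "r \<in> \<rat>" "s \<in> \<rat>" "1 = r * c1 + s * c2" "r \<noteq> 0" "k \<in> \<rat>" "l \<in> \<rat>" "z = k * c1 + l * c2" for r s c1 c2 k l z :: complex
  proof (intro bexI)
    have "1 - s * c2 = r * c1" using that(3) by (simp add: algebra_simps)
    then have "c1 = (1 - s * c2) / r" using that(4) by simp
    then have "z = k * ((1 - s * c2) / r) + l * c2" using that(7) by simp
    also have "\<dots> = k / r + (l - k * s / r) * c2" by (simp add: diff_divide_distrib algebra_simps)
    finally show "z = k / r + (l - k * s / r) * c2" .
  qed (use that in auto)
  show thesis
  proof (cases "r = 0")
    case False
    show ?thesis
    proof (rule that[OF bK(2)])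
      fix z assume "z \<in> K"
      then obtain k l where "k \<in> \<rat>" "l \<in> \<rat>" "z = k * b1 + l * b2" using span by blast
      then show "\<exists>x\<in>\<rat>. \<exists>y\<in>\<rat>. z = x + y * b2" by (rule *[OF rs False])
    qed
  next
    case True
    then have "s \<noteq> 0" using rs by auto
    have 1: "1 = s * b2 + r * b1" using rs(3) by (simp only: add.commute)
    show ?thesis
    proof (rule that[OF bK(1)])
      fix z assume "z \<in> K"
      then obtain k l where kl: "k \<in> \<rat>" "l \<in> \<rat>" "z = k * b1 + l * b2" using span by blast
      then have "z = l * b2 + k * b1" by simp
      then show "\<exists>x\<in>\<rat>. \<exists>y\<in>\<rat>. z = x + y * b1" by (rule *[OF rs(2) rs(1) 1 \<open>s \<noteq> 0\<close> kl(2,1)])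
    qed
  qed
qed

text \<open>Completing the square gives an element with rational square a/b. Scaling by b makes the
  square the integer ab, and dividing by the root of its square part leaves a squarefree m. The
  embedding sends \<delta> to \<delta> or -\<delta>, and not being the identity on K rules out the
  first.\<close>

lemma quadratic_number_field_sqrt_generator:
  assumes K: "quadratic_number_field K" and \<sigma>: "field_embedding K \<sigma>" "\<exists>x\<in>K. \<sigma> x \<noteq> x"
  obtains \<delta> and m :: int where "squarefree m" "\<delta> \<in> K" "\<delta> \<notin> \<rat>" "\<delta>\<^sup>2 = of_int m"
    "\<And>z. z \<in> K \<Longrightarrow> \<exists>x\<in>\<rat>. \<exists>y\<in>\<rat>. z = x + y * \<delta>"
    "\<And>x y. x \<in> \<rat> \<Longrightarrow> y \<in> \<rat> \<Longrightarrow> \<sigma> (x + y * \<delta>) = x - y * \<delta>"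
proof -
  interpret F: complex_subfield_locale K
    using K by unfold_locales (simp add: quadratic_number_field_def)
  obtain \<alpha> where \<alpha>: "\<alpha> \<in> K" "\<And>z. z \<in> K \<Longrightarrow> \<exists>x\<in>\<rat>. \<exists>y\<in>\<rat>. z = x + y * \<alpha>"
    using quadratic_number_field_span[OF K] by metis
  note fixQ = F.embedding_fixes_Rats[OF \<sigma>(1)]
  have \<alpha>Q: "\<alpha> \<notin> \<rat>"
  proof
    assume "\<alpha> \<in> \<rat>"
    have "\<sigma> z = z" if zK: "z \<in> K" for z
    proof -
      obtain x y where xy: "x \<in> \<rat>" "y \<in> \<rat>" "z = x + y * \<alpha>" using \<alpha>(2)[OF zK] by blast
      then have "z \<in> \<rat>" using \<open>\<alpha> \<in> \<rat>\<close> by simp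
      then show ?thesis by (rule fixQ)
    qed
    then show False using \<sigma>(2) by blast
  qed
  obtain u v where uv: "u \<in> \<rat>" "v \<in> \<rat>" "\<alpha> * \<alpha> = u + v * \<alpha>" using \<alpha>(2)[OF F.mult_mem[OF \<alpha>(1) \<alpha>(1)]] by blast
  define \<delta>0 where "\<delta>0 = \<alpha> - v / 2"
  have "\<delta>0\<^sup>2 = u + v\<^sup>2 / 4"
    using uv(3) by (simp add: \<delta>0_def power2_eq_square algebra_simps)
  then have "\<delta>0\<^sup>2 \<in> \<rat>" using uv by simp
  then obtain a b where ab: "b > 0" "\<delta>0\<^sup>2 = of_int a / of_int b" by (elim Rats_cases') blast
  have \<delta>0Q: "\<delta>0 \<notin> \<rat>"
  proof
    assume "\<delta>0 \<in> \<rat>"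
    then have "\<delta>0 + v / 2 \<in> \<rat>" using uv by simp
    then show False using \<alpha>Q by (simp add: \<delta>0_def)
  qed
  define n where "n = a * b"
  have \<delta>1: "(of_int b * \<delta>0)\<^sup>2 = of_int n"
  proof -
    have "(of_int b * \<delta>0)\<^sup>2 = (of_int b)\<^sup>2 * (of_int a / of_int b)"
      unfolding power_mult_distrib ab(2) ..
    then show ?thesis using ab(1) by (simp add: n_def power2_eq_square)
  qed
  have "\<delta>0 \<noteq> 0" using \<delta>0Q by auto
  then have "n \<noteq> 0" using \<delta>1 ab(1) by auto
  define m where "m = squarefree_part n"
  define e where "e = square_part n"
  have e0: "e \<noteq> 0" using \<open>n \<noteq> 0\<close> by (simp add: e_def)
  have nme: "n = m * e\<^sup>2" unfolding m_def e_def by (rule squarefree_decompose)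
  define c :: complex where "c = of_int b / of_int e"
  have cQ: "c \<in> \<rat>" "c \<noteq> 0" using ab e0 by (auto simp: c_def)
  define \<delta> where "\<delta> = c * \<delta>0"
  have \<delta>2: "\<delta>\<^sup>2 = of_int m"
  proof -
    have "\<delta>\<^sup>2 = (of_int b * \<delta>0)\<^sup>2 / (of_int e)\<^sup>2" by (simp add: \<delta>_def c_def power_mult_distrib power_divide)
    also have "\<dots> = of_int m" unfolding \<delta>1 nme using e0 by simp
    finally show ?thesis .
  qed
  have \<delta>Q: "\<delta> \<notin> \<rat>"
  proof
    assume "\<delta> \<in> \<rat>"
    then have "\<delta> / c \<in> \<rat>" using cQ by simp
    then show False using \<delta>0Q cQ by (simp add: \<delta>_def)
  qed
  have "v / 2 \<in> K" using uv by (intro F.Rats_mem) simp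
  then have \<delta>K: "\<delta> \<in> K" unfolding \<delta>_def \<delta>0_def
    by (intro F.mult_mem F.diff_mem \<alpha>(1) F.Rats_mem[OF cQ(1)])
  have span: "\<exists>x\<in>\<rat>. \<exists>y\<in>\<rat>. z = x + y * \<delta>" if zK: "z \<in> K" for z
  proof -
    obtain x y where xy: "x \<in> \<rat>" "y \<in> \<rat>" "z = x + y * \<alpha>" using \<alpha>(2)[OF zK] by blast
    have "z = (x + y * v / 2) + (y / c) * \<delta>" using xy cQ by (simp add: \<delta>_def \<delta>0_def algebra_simps)
    moreover have "x + y * v / 2 \<in> \<rat>" "y / c \<in> \<rat>" using xy uv cQ by auto
    ultimately show ?thesis by blast
  qed
  have add: "\<sigma> (x + y) = \<sigma> x + \<sigma> y" and mult: "\<sigma> (x * y) = \<sigma> x * \<sigma> y" if "x \<in> K" "y \<in> K" for x y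
    using \<sigma>(1) that by (auto simp: field_embedding_def)
  have lin: "\<sigma> (x + y * \<delta>) = x + y * \<sigma> \<delta>" if "x \<in> \<rat>" "y \<in> \<rat>" for x y
    using that by (simp add: add mult fixQ F.mem \<delta>K)
  have "\<sigma> \<delta> * \<sigma> \<delta> = \<delta> * \<delta>"
    using mult[OF \<delta>K \<delta>K] fixQ[of "of_int m"] \<delta>2 by (simp add: power2_eq_square)
  then have "\<sigma> \<delta> = \<delta> \<or> \<sigma> \<delta> = - \<delta>" by (simp add: square_eq_iff)
  moreover have "\<sigma> \<delta> \<noteq> \<delta>"
  proof
    assume "\<sigma> \<delta> = \<delta>"
    then have "\<sigma> z = z" if "z \<in> K" for z using span[OF that] lin by auto
    then show False using \<sigma>(2) by blast
  qed
  ultimately have "\<sigma> \<delta> = - \<delta>" by blast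
  then have "\<sigma> (x + y * \<delta>) = x - y * \<delta>" if "x \<in> \<rat>" "y \<in> \<rat>" for x y
    using lin[OF that] by simp
  moreover have "squarefree m" by (simp add: m_def)
  ultimately show thesis using that \<delta>K \<delta>Q \<delta>2 span by blast
qed

text \<open>Trace 2x and norm x^2 - m y^2 are integers, so m (2y)^2 is one too. A denominator of 2y
  would enter squared and divide m, which is squarefree. The divisibility by 4 restates that the
  norm is integral.\<close>

lemma quadratic_algebraic_int_coordinates:
  fixes m :: int and \<delta> x y :: complex
  assumes m: "squarefree m" and \<delta>: "\<delta> \<notin> \<rat>" "\<delta>\<^sup>2 = of_int m" and xy: "x \<in> \<rat>" "y \<in> \<rat>"
    and int: "algebraic_int (x + y * \<delta>)"
  obtains a u :: int where "2 * x = of_int a" "2 * y = of_int u" "4 dvd a\<^sup>2 - m * u\<^sup>2"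
proof (cases "y = 0")
  case True
  then have "x \<in> \<int>" using int xy rational_algebraic_int_is_int[of x] by simp
  then obtain k where k: "x = of_int k" by (elim Ints_cases)
  show thesis by (rule that[of "2 * k" 0]) (use k True in \<open>auto simp: power_mult_distrib\<close>)
next
  case False
  have zQ: "x + y * \<delta> \<notin> \<rat>"
  proof
    assume "x + y * \<delta> \<in> \<rat>"
    then have "((x + y * \<delta>) - x) / y \<in> \<rat>" using xy by (intro Rats_divide Rats_diff)
    then show False using False \<delta> by simp
  qed
  have eq: "(x + y * \<delta>)\<^sup>2 - (2 * x) * (x + y * \<delta>) + (x\<^sup>2 - of_int m * y\<^sup>2) = 0"
    unfolding \<delta>(2)[symmetric] by (simp add: power2_eq_square algebra_simps)
  have TN: "2 * x \<in> \<rat>" "x\<^sup>2 - of_int m * y\<^sup>2 \<in> \<rat>" using xy by auto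
  obtain a where a: "2 * x = of_int a" using algebraic_int_quadratic_coeffs(1)[OF int zQ TN eq] by (elim Ints_cases)
  obtain c where c: "x\<^sup>2 - of_int m * y\<^sup>2 = of_int c" using algebraic_int_quadratic_coeffs(2)[OF int zQ TN eq] by (elim Ints_cases)
  have "2 * y \<in> \<rat>" using xy by simp
  then obtain u v where uv: "v > 0" "coprime u v" "2 * y = of_int u / of_int v" by (elim Rats_cases') blast
  have "of_int m * (2 * y)\<^sup>2 = (2 * x)\<^sup>2 - 4 * (x\<^sup>2 - of_int m * y\<^sup>2)" by (simp add: power2_eq_square algebra_simps)
  then have my: "of_int m * (2 * y)\<^sup>2 = of_int (a\<^sup>2 - 4 * c)" unfolding a c by simp
  then have "of_int (m * u\<^sup>2) = (of_int ((a\<^sup>2 - 4 * c) * v\<^sup>2) :: complex)"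
    unfolding uv(3) using uv(1) by (simp add: power_divide field_simps)
  then have muv: "m * u\<^sup>2 = (a\<^sup>2 - 4 * c) * v\<^sup>2" by (simp only: of_int_eq_iff)
  then have "v\<^sup>2 dvd m * u\<^sup>2" by simp
  moreover have "coprime (v\<^sup>2) (u\<^sup>2)" using uv(2) by (simp add: coprime_commute)
  ultimately have "v\<^sup>2 dvd m" by (simp add: coprime_dvd_mult_left_iff)
  then have "is_unit v" by (rule squarefreeD[OF m])
  then have v: "v = 1" using uv(1) by simp
  show thesis
  proof (rule that[OF a])
    show "2 * y = of_int u" using uv(3) v by simp
    show "4 dvd a\<^sup>2 - m * u\<^sup>2" using muv v by simp
  qed
qed

text \<open>The integers of the field have the basis 1, \<omega> with \<omega> = (1 + \<delta>)/2 if
  m is 1 mod 4 and \<omega> = \<delta> otherwise. Passing to any other integral basis multiplies the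
  determinant of conjugates by a unit, so its square is m or 4m.\<close>

lemma fundamental_discriminant_form:
  assumes "fundamental_discriminant D"
  obtains m where "squarefree m" "D = m" "m mod 4 = 1"
  | m where "squarefree m" "D = 4 * m" "m mod 4 = 2 \<or> m mod 4 = 3"
proof -
  obtain K w1 w2 \<sigma> where K: "quadratic_number_field K"
    and O: "ring_of_integers K = {of_int a * w1 + of_int b * w2 | a b. True}"
    and \<sigma>: "field_embedding K \<sigma>" "\<exists>x\<in>K. \<sigma> x \<noteq> x" and D: "of_int D = (w1 * \<sigma> w2 - w2 * \<sigma> w1)\<^sup>2"
    using assms unfolding fundamental_discriminant_def quadratic_field_discriminant_def by blast
  interpret F: complex_subfield_locale K
    using K by unfold_locales (simp add: quadratic_number_field_def)
  obtain \<delta> and m :: int where m: "squarefree m" and \<delta>: "\<delta> \<in> K" "\<delta> \<notin> \<rat>" "\<delta>\<^sup>2 = of_int m"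
    and span: "\<And>z. z \<in> K \<Longrightarrow> \<exists>x\<in>\<rat>. \<exists>y\<in>\<rat>. z = x + y * \<delta>"
    and \<sigma>\<delta>: "\<And>x y. x \<in> \<rat> \<Longrightarrow> y \<in> \<rat> \<Longrightarrow> \<sigma> (x + y * \<delta>) = x - y * \<delta>"
    using quadratic_number_field_sqrt_generator[OF K \<sigma>] by metis
  \<comment> \<open>Stated for \<omega> = h + k\<delta>, to serve both shapes of the integral
    basis.\<close>
  have disc: "of_int D = (2 * k * \<delta>)\<^sup>2"
    if h: "h \<in> \<rat>" and k: "k \<in> \<rat>" "k \<noteq> 0" and \<omega>: "algebraic_int (h + k * \<delta>)"
      and basis: "\<And>x y. x \<in> \<rat> \<Longrightarrow> y \<in> \<rat> \<Longrightarrow> algebraic_int (x + y * \<delta>) \<Longrightarrow> 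
        \<exists>p q :: int. x + y * \<delta> = of_int p + of_int q * (h + k * \<delta>)" for h k
  proof -
    define \<omega> where "\<omega> = h + k * \<delta>"
    have \<omega>Q: "\<omega> \<notin> \<rat>"
    proof
      assume "\<omega> \<in> \<rat>"
      then have "(\<omega> - h) / k \<in> \<rat>" using h k by (intro Rats_divide Rats_diff)
      then show False using k \<delta> by (simp add: \<omega>_def)
    qed
    have coords: "\<exists>p q :: int. w = of_int p + of_int q * \<omega>" if "w \<in> ring_of_integers K" for w
    proof -
      have w: "w \<in> K" "algebraic_int w" using that by (auto simp: ring_of_integers_def)
      obtain x y where "x \<in> \<rat>" "y \<in> \<rat>" "w = x + y * \<delta>" using span[OF w(1)] by blast
      then show ?thesis using basis[of x y] w by (simp add: \<omega>_def)
    qed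
    have "w1 = of_int 1 * w1 + of_int 0 * w2" "w2 = of_int 0 * w1 + of_int 1 * w2" by simp_all
    then have "w1 \<in> ring_of_integers K" "w2 \<in> ring_of_integers K" unfolding O by blast+
    then obtain p1 q1 p2 q2 :: int where w: "w1 = of_int p1 + of_int q1 * \<omega>" "w2 = of_int p2 + of_int q2 * \<omega>"
      using coords by blast
    have "1 \<in> ring_of_integers K" by (simp add: ring_of_integers_def F.one_mem)
    then obtain A B :: int where AB: "1 = of_int A * w1 + of_int B * w2" unfolding O by blast
    have "\<omega> \<in> ring_of_integers K"
    proof -
      have "\<omega> \<in> K" unfolding \<omega>_def by (intro F.add_mem F.mult_mem F.Rats_mem h k \<delta>)
      then show ?thesis using \<omega> by (simp add: ring_of_integers_def \<omega>_def)
    qed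
    then obtain C E :: int where CE: "\<omega> = of_int C * w1 + of_int E * w2" unfolding O by blast
    have ind: "p = 0 \<and> q = 0" if "of_int p + of_int q * \<omega> = 0" for p q :: int
      using quadratic_irrational_no_linear_relation[OF \<omega>Q _ _ that] by simp
    have "of_int (A * p1 + B * p2 - 1) + of_int (A * q1 + B * q2) * \<omega> = 0"
      using AB unfolding w by (simp add: algebra_simps)
    from ind[OF this] have 1: "A * p1 + B * p2 = 1" "A * q1 + B * q2 = 0" by simp_all
    have "of_int (C * p1 + E * p2) + of_int (C * q1 + E * q2 - 1) * \<omega> = 0"
      using CE unfolding w by (simp add: algebra_simps)
    from ind[OF this] have 2: "C * p1 + E * p2 = 0" "C * q1 + E * q2 = 1" by simp_all
    \<comment> \<open>The determinant of the matrix expressing w1, w2 through 1, \<omega>. Integer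
      matrices exist in both directions, so it is \<plusminus>1, and only its square enters
      D.\<close>
    define \<Delta> where "\<Delta> = p1 * q2 - p2 * q1"
    have "(A * E - B * C) * \<Delta> = (A * p1 + B * p2) * (C * q1 + E * q2) - (A * q1 + B * q2) * (C * p1 + E * p2)"
      by (simp add: \<Delta>_def algebra_simps)
    also have "\<dots> = 1" unfolding 1 2 by simp
    finally have "\<Delta> dvd 1" by (metis dvd_triv_right)
    then have "\<bar>\<Delta>\<bar> = 1" by (simp only: zdvd1_eq)
    then have \<Delta>2: "\<Delta>\<^sup>2 = 1" by (metis one_power2 power2_abs)
    have \<sigma>w: "\<sigma> (of_int p + of_int q * \<omega>) = of_int p + of_int q * (h - k * \<delta>)" for p q :: int
    proof -
      have e: "of_int p + of_int q * \<omega> = (of_int p + of_int q * h) + (of_int q * k) * \<delta>" by (simp add: \<omega>_def algebra_simps)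
      show ?thesis unfolding e using h k by (subst \<sigma>\<delta>) (auto simp: algebra_simps)
    qed
    have "w1 * \<sigma> w2 - w2 * \<sigma> w1 = - (2 * k * \<delta> * of_int \<Delta>)"
      unfolding w \<sigma>w by (simp add: \<omega>_def \<Delta>_def algebra_simps)
    then have "of_int D = (2 * k * \<delta>)\<^sup>2 * (of_int \<Delta>)\<^sup>2" unfolding D by (simp add: power_mult_distrib)
    also have "(of_int \<Delta>)\<^sup>2 = (1 :: complex)" using \<Delta>2 by (metis of_int_1 of_int_power)
    finally show ?thesis by simp
  qed
  have aint: "algebraic_int z" if "z\<^sup>2 - of_int t * z + of_int n = 0" for z :: complex and t n :: int
  proof (rule algebraic_int.intros[of "[:of_int n, - of_int t, 1:]"])
    show "poly [:of_int n, - of_int t, 1:] z = 0" using that by (simp add: power2_eq_square algebra_simps)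
    show "\<forall>i. Polynomial.coeff [:of_int n, - of_int t, 1:] i \<in> \<int>" by (auto simp: coeff_pCons split: nat.split)
  qed simp
  have m4: "m mod 4 \<noteq> 0"
  proof
    assume "m mod 4 = 0"
    then have "2\<^sup>2 dvd m" by (simp add: dvd_eq_mod_eq_0)
    then have "is_unit (2 :: int)" by (rule squarefreeD[OF m])
    then show False by simp
  qed
  show thesis
  proof (cases "m mod 4 = 1")
    case True
    have "of_int D = (2 * (1/2) * \<delta>)\<^sup>2"
    proof (rule disc[of "1/2" "1/2"])
      have "4 dvd 1 - m" using True by presburger
      then obtain n where n: "1 - m = 4 * n" by (elim dvdE)
      have "(of_int (1 - m) :: complex) = of_int (4 * n)" using n by simp
      then have n': "(1 - of_int m) / 4 = (of_int n :: complex)" by simp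
      have "(1/2 + 1/2 * \<delta>)\<^sup>2 - of_int 1 * (1/2 + 1/2 * \<delta>) + of_int n = 0"
        unfolding n'[symmetric] \<delta>(3)[symmetric] by (simp add: power2_eq_square field_simps)
      then show "algebraic_int (1/2 + 1/2 * \<delta>)" by (rule aint)
      fix x y assume xy: "x \<in> \<rat>" "y \<in> \<rat>" "algebraic_int (x + y * \<delta>)"
      obtain a u where au: "2 * x = of_int a" "2 * y = of_int u" "4 dvd a\<^sup>2 - m * u\<^sup>2"
        using quadratic_algebraic_int_coordinates[OF m \<delta>(2,3) xy] .
      have "odd m" using True by presburger
      have "even (a\<^sup>2 - m * u\<^sup>2)" using au(3) by (rule dvd_trans[rotated]) simp
      \<comment> \<open>a and u have the same parity, so x + y\<delta> = (a - u)/2 + u (1 +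
        \<delta>)/2 has integral coordinates.\<close>
      then have "even (a - u)" using \<open>odd m\<close> by simp
      then obtain p where p: "a - u = 2 * p" by (elim evenE)
      have "x = of_int a / 2" "y = of_int u / 2" using au by (simp_all add: field_simps)
      moreover have "a = 2 * p + u" using p by simp
      ultimately have "x + y * \<delta> = of_int p + of_int u * (1/2 + 1/2 * \<delta>)" by (simp add: field_simps)
      then show "\<exists>p q :: int. x + y * \<delta> = of_int p + of_int q * (1/2 + 1/2 * \<delta>)" by blast
    qed auto
    then have "of_int D = (of_int m :: complex)" using \<delta>(3) by simp
    then have "D = m" by simp
    then show ?thesis using that(1) m True by blast
  next
    case False
    have "of_int D = (2 * 1 * \<delta>)\<^sup>2"
    proof (rule disc[of 0 1])
      have "\<delta>\<^sup>2 - of_int 0 * \<delta> + of_int (- m) = 0" using \<delta>(3) by simp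
      then show "algebraic_int (0 + 1 * \<delta>)" using aint[of \<delta> 0 "- m"] by simp
      fix x y assume xy: "x \<in> \<rat>" "y \<in> \<rat>" "algebraic_int (x + y * \<delta>)"
      obtain a u where au: "2 * x = of_int a" "2 * y = of_int u" "4 dvd a\<^sup>2 - m * u\<^sup>2"
        using quadratic_algebraic_int_coordinates[OF m \<delta>(2,3) xy] .
      \<comment> \<open>Squares are 0 or 1 mod 4. With m congruent to 2 or 3, divisibility of a^2 -
        m u^2 by 4 forces both to be even.\<close>
      have "even a \<and> even u"
      proof -
        have sq: "k\<^sup>2 mod 4 = (if even k then 0 else 1)" for k :: int
        proof -
          have "k mod 4 = 0 \<or> k mod 4 = 1 \<or> k mod 4 = 2 \<or> k mod 4 = 3" by presburger
          moreover have "k\<^sup>2 mod 4 = (k mod 4)\<^sup>2 mod 4" by (rule power_mod[symmetric])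
          moreover have "even k \<longleftrightarrow> k mod 4 = 0 \<or> k mod 4 = 2" by presburger
          ultimately show ?thesis by auto
        qed
        have mm: "m mod 4 = 2 \<or> m mod 4 = 3" using False m4 by presburger
        have "a\<^sup>2 mod 4 = (m * u\<^sup>2) mod 4" using au(3) by (simp add: mod_eq_dvd_iff)
        also have "\<dots> = ((m mod 4) * (u\<^sup>2 mod 4)) mod 4" by (rule mod_mult_eq[symmetric])
        finally show ?thesis unfolding sq using mm by (auto split: if_splits)
      qed
      then obtain p q where pq: "a = 2 * p" "u = 2 * q" by (auto elim!: evenE)
      have "x = of_int p" "y = of_int q" using au pq by simp_all
      then have "x + y * \<delta> = of_int p + of_int q * (0 + 1 * \<delta>)" by simp
      then show "\<exists>p q :: int. x + y * \<delta> = of_int p + of_int q * (0 + 1 * \<delta>)" by blast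
    qed auto
    then have "of_int D = (of_int (4 * m) :: complex)" using \<delta>(3) by (simp add: power_mult_distrib)
    then have "D = 4 * m" by (simp only: of_int_eq_iff)
    moreover have "m mod 4 = 2 \<or> m mod 4 = 3" using False m4 by presburger
    ultimately show ?thesis using that(2) m by blast
  qed
qed

lemma primitive_kronecker_fundamental_discriminant:
  assumes "fundamental_discriminant D"
  shows "primitive_char (nat \<bar>D\<bar>) (kronecker_char D)"
  using assms
proof (cases rule: fundamental_discriminant_form)
  case (1 m)
  then show ?thesis using primitive_kronecker_squarefree by blast
next
  case (2 m)
  then show ?thesis using primitive_kronecker_four_times_squarefree by blast
qed

lemma real_char_kronecker: "real_char (kronecker_char D)"
  by (auto simp: real_char_def kronecker_char_def)

theorem mainTheorem1:
  fixes f :: "nat \<Rightarrow> real"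
  assumes f_ge: "\<And>q. q \<ge> 2 \<Longrightarrow> 2 \<le> f q"
    and f_bigo: "f \<in> O(\<lambda>q. ln (real q))"
    and qzf: "\<And>q. q \<ge> 2 \<Longrightarrow> quasi_zero_free q (Q_region q f \<inter> critical_strip)"
  shows "(\<exists>C. \<forall>\<^sub>F q in at_top. \<forall>\<psi>. primitive_char q \<psi> \<and> \<not> real_char \<psi> \<longrightarrow>
            \<bar>Re (deriv (Dirichlet_L \<psi>) 1 / Dirichlet_L \<psi> 1)\<bar> \<le> C * sqrt (f q * ln (real q))) \<and>
         (\<exists>C. \<forall>\<^sub>F q in at_top. \<forall>D. fundamental_discriminant D \<and> nat \<bar>D\<bar> = q \<longrightarrow>
            cmod (deriv (Dirichlet_L (kronecker_char D)) 1 / Dirichlet_L (kronecker_char D) 1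
                  - of_real (1 / (1 - largest_real_zero D)))
              \<le> C * sqrt (f q * ln (real q)))"
proof -
  obtain c where c: "\<forall>\<^sub>F q in at_top. norm (f q) \<le> c * norm (ln (real q))"
    using f_bigo by (elim landau_o.bigE)
  \<comment> \<open>The estimates for both kinds of characters ask for a constant of at least
    1.\<close>
  define K where "K = max 1 c"
  have K: "K \<ge> 1" by (simp add: K_def)
  have "filterlim (\<lambda>q :: nat. ln (real q)) at_top at_top"
    by (rule filterlim_compose[OF ln_at_top filterlim_real_sequentially])
  then have ln8: "\<forall>\<^sub>F q in at_top. ln (real q) \<ge> 8"
    by (simp add: filterlim_at_top)
  have large: "\<forall>\<^sub>F q in at_top. q \<ge> 2 \<and> ln (real q) \<ge> 8 \<and> f q \<le> K * ln (real q)"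
    using c ln8 eventually_ge_at_top[of "2 :: nat"]
  proof eventually_elim
    case (elim q)
    have "f q \<le> c * ln (real q)" using elim by simp
    also have "\<dots> \<le> K * ln (real q)" using elim by (intro mult_right_mono) (auto simp: K_def)
    finally show ?case using elim by simp
  qed
  obtain C1 where C1: "\<And>q \<psi> f. primitive_char q \<psi> \<Longrightarrow> \<not> real_char \<psi> \<Longrightarrow> q \<ge> 2 \<Longrightarrow> ln (real q) \<ge> 8 \<Longrightarrow> 2 \<le> f q \<Longrightarrow> 
    f q \<le> K * ln (real q) \<Longrightarrow> quasi_zero_free q (Q_region q f \<inter> critical_strip) \<Longrightarrow>
    \<bar>Re (deriv (Dirichlet_L \<psi>) 1 / Dirichlet_L \<psi> 1)\<bar> \<le> C1 * sqrt (f q * ln (real q))"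
    using log_deriv_complex_char_bound[OF K] by blast
  obtain C2 where C2: "\<And>q \<psi> f. primitive_char q \<psi> \<Longrightarrow> real_char \<psi> \<Longrightarrow> q \<ge> 2 \<Longrightarrow> ln (real q) \<ge> 8 \<Longrightarrow> 2 \<le> f q \<Longrightarrow> 
    f q \<le> K * ln (real q) \<Longrightarrow> quasi_zero_free q (Q_region q f \<inter> critical_strip) \<Longrightarrow>
    cmod (deriv (Dirichlet_L \<psi>) 1 / Dirichlet_L \<psi> 1 - of_real (1 / (1 - (GREATEST \<beta>. Dirichlet_L \<psi> (of_real \<beta>) = 0))))
      \<le> C2 * sqrt (f q * ln (real q))"
    using log_deriv_real_char_bound[OF K] by blast
  have "\<forall>\<^sub>F q in at_top. \<forall>\<psi>. primitive_char q \<psi> \<and> \<not> real_char \<psi> \<longrightarrow>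
            \<bar>Re (deriv (Dirichlet_L \<psi>) 1 / Dirichlet_L \<psi> 1)\<bar> \<le> C1 * sqrt (f q * ln (real q))"
    using large by eventually_elim (use C1 f_ge qzf in blast)
  moreover have "\<forall>\<^sub>F q in at_top. \<forall>D. fundamental_discriminant D \<and> nat \<bar>D\<bar> = q \<longrightarrow>
            cmod (deriv (Dirichlet_L (kronecker_char D)) 1 / Dirichlet_L (kronecker_char D) 1
                  - of_real (1 / (1 - largest_real_zero D)))
              \<le> C2 * sqrt (f q * ln (real q))"
    using large
  proof eventually_elim
    case (elim q)
    show ?case
    proof (intro allI impI)
      fix D assume D: "fundamental_discriminant D \<and> nat \<bar>D\<bar> = q"
      then have "primitive_char q (kronecker_char D)"
        using primitive_kronecker_fundamental_discriminant by blast
      from C2[OF this real_char_kronecker _ _ f_ge _ qzf] elim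
      show "cmod (deriv (Dirichlet_L (kronecker_char D)) 1 / Dirichlet_L (kronecker_char D) 1
                  - of_real (1 / (1 - largest_real_zero D)))
              \<le> C2 * sqrt (f q * ln (real q))"
        unfolding largest_real_zero_def by blast
    qed
  qed
  ultimately show ?thesis by blast
qed

end
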